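(* Let $T>0$, let $(x_t)_{t\in[0,T]}$ be the PDMP with data $(f,\lambda,Q)$ and, for $h>0$, let $(\overline x_t)_{t\in[0,T]}$ be its Euler approximation with time step $h$ (both as constructed in the context), with $x_0=\overline x_0=x$ for some $x\in E$. Assume that for all $\theta\in\Theta$ and for all $A\in\mathcal B(\Theta)$ the functions $\nu\mapsto Q((\theta,\nu),A)$, $\nu\mapsto\lambda(\theta,\nu)$ and $\nu\mapsto f_\theta(\nu)$ are bounded and twice continuously differentiable with bounded derivatives. Let $F:E\to\mathbb R$ be a bounded function such that the solution $u$ of the integro-differential equation $$\mathcal Au(t,x)=0,\ (t,x)\in[0,T)\times E,\qquad u(T,x)=F(x),\ x\in E,$$ is such that for all $\theta\in\Theta$ the function $(t,\nu)\mapsto u(t,\theta,\nu)$ is bounded and two times differentiable with bounded derivatives, and moreover the second derivatives of $(t,\nu)\mapsto u(t,\theta,\nu)$ are uniformly Lipschitz in $\theta$. Then there exists a constant $c_1$ independent of $h$ such that $$\mathbb E[F(\overline x_T)]-\mathbb E[F(x_T)]=h\,c_1+O(h^2).$$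
   Context: Let $\Theta=\{k_1,\dots,k_{|\Theta|}\}$ be a finite or countable set and $E=\Theta\times\mathbb R$; elements are written $x=(\theta,\nu)$. Given: vector fields $f_\theta:\mathbb R\to\mathbb R$, $\theta\in\Theta$, bounded and Lipschitz with constant $L$ independent of $\theta$; a measurable $\lambda:E\to(0,\infty)$ with $\lambda(x)\le\lambda^*<\infty$ for all $x\in E$; a transition measure $Q:E\times\mathcal B(E)\to[0,1]$ of the form $Q((\theta,\nu),A\times B)=Q((\theta,\nu),A)\delta_\nu(B)$ (only the $\theta$-component jumps). Write $f(x)=f_\theta(\nu)$. Flows: $\phi_\theta(\cdot,\nu)$ is the solution of $y'=f_\theta(y)$, $y(0)=\nu$. For $h>0$, the Euler polygon is: $\overline y_0=\nu$, $\overline y_{i+1}=\overline y_i+hf_\theta(\overline y_i)$, and $\overline\phi_\theta(t,\nu)=\overline y_i+(t-ih)f_\theta(\overline y_i)$ for $t\in[ih,(i+1)h]$, $i\ge0$. Data: a homogeneous Poisson process $(N^*_t)_{t\ge0}$ with intensity $\lambda^*$ and jump times $(T^*_k)_{k\ge1}$, $T^*_0=0$; two i.i.d. sequences $(U_k)$, $(V_k)$ of uniform variables on $[0,1]$, independent of each other and of $(T^*_k)$. Construction by thinning for a family of flows $\Phi=(\Phi_\theta)$: let $a_0=0$, $a_j(x)=\sum_{i=1}^jQ(x,\{k_i\})$, $H(x,u)=\sum_ik_i\mathbf 1_{a_{i-1}(x)<u\le a_i(x)}$. Start from $(\theta_0,\nu_0)=x$, $T_0=0$, $\tau_0=0$.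 For $n\ge1$, $$\tau_n=\inf\{k>\tau_{n-1}:U_k\lambda^*\le\lambda(\theta_{n-1},\Phi_{\theta_{n-1}}(T^*_k-T^*_{\tau_{n-1}},\nu_{n-1}))\},\quad T_n=T^*_{\tau_n},$$ $$\nu_n=\Phi_{\theta_{n-1}}(T_n-T_{n-1},\nu_{n-1}),\quad\theta_n=H((\theta_{n-1},\nu_n),V_n),$$ and $x_t=(\theta_n,\Phi_{\theta_n}(t-T_n,\nu_n))$ for $t\in[T_n,T_{n+1})$. The PDMP $(x_t)$ is obtained with $\Phi=\phi$; its Euler approximation $(\overline x_t)$ is obtained with $\Phi=\overline\phi$ (so the Euler grid restarts at each jump time), from the same data. Generator: for $g$ on $\mathbb R_+\times E$, $$\mathcal Ag(t,x)=\partial_tg(t,x)+f(x)\,\partial_\nu g(t,x)+\lambda(x)\int_E\big(g(t,y)-g(t,x)\big)Q(x,dy),$$ where $\partial_\nu g(t,x)=\frac{\partial g}{\partial\nu}(t,\theta,\nu)$ for $x=(\theta,\nu)$.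
   Formalization: The bounds on Q, λ, f and on their first and second derivatives in ν are assumed uniform in θ and A; for infinite Θ the claim with bounds depending on θ fails (f_θ'' unbounded in θ can destroy the O(h²) remainder), while for finite Θ nothing changes. *)

theory Defs
  imports "HOL-Probability.Probability"
begin

text \<open>The set of modes is the type \<open>'k\<close>, carrying the discrete \<open>\<sigma>\<close>-algebra. It is enumerated by
  \<open>k 1, k 2, \<dots>\<close>, the admissible indices being \<open>1 \<le> i \<le> N\<close> where \<open>N\<close> may be \<open>\<infinity>\<close>.\<close>

abbreviation state_space :: "('k::countable \<times> real) measure" where
  "state_space \<equiv> count_space UNIV \<Otimes>\<^sub>M borel"

definition mode_indices :: "enat \<Rightarrow> nat set" where
  "mode_indices N = {i. 1 \<le> i \<and> enat i \<le> N}"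


section \<open>Flows\<close>

definition is_flow :: "('k \<Rightarrow> real \<Rightarrow> real) \<Rightarrow> ('k \<Rightarrow> real \<Rightarrow> real \<Rightarrow> real) \<Rightarrow> bool" where
  "is_flow f \<phi> \<longleftrightarrow>
     (\<forall>\<theta> \<nu>. \<phi> \<theta> 0 \<nu> = \<nu> \<and>
        (\<forall>t. ((\<lambda>s. \<phi> \<theta> s \<nu>) has_real_derivative f \<theta> (\<phi> \<theta> t \<nu>)) (at t)))"

primrec euler_node :: "('k \<Rightarrow> real \<Rightarrow> real) \<Rightarrow> real \<Rightarrow> 'k \<Rightarrow> real \<Rightarrow> nat \<Rightarrow> real" where
  "euler_node f h \<theta> \<nu> 0 = \<nu>"
| "euler_node f h \<theta> \<nu> (Suc i) = euler_node f h \<theta> \<nu> i + h * f \<theta> (euler_node f h \<theta> \<nu> i)"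

definition euler_flow :: "('k \<Rightarrow> real \<Rightarrow> real) \<Rightarrow> real \<Rightarrow> 'k \<Rightarrow> real \<Rightarrow> real \<Rightarrow> real" where
  "euler_flow f h \<theta> t \<nu> =
     (let i = nat \<lfloor>t / h\<rfloor>; y = euler_node f h \<theta> \<nu> i in y + (t - real i * h) * f \<theta> y)"


section \<open>Driving noise\<close>

text \<open>A homogeneous Poisson process of intensity \<open>r\<close>, given as the counting process of its jump
  times, which have independent exponential increments.\<close>

definition poisson_process ::
  "'w measure \<Rightarrow> real \<Rightarrow> (real \<Rightarrow> 'w \<Rightarrow> nat) \<Rightarrow> (nat \<Rightarrow> 'w \<Rightarrow> real) \<Rightarrow> bool" where
  "poisson_process M r Np Ts \<longleftrightarrow>
     (\<forall>\<omega>\<in>space M. Ts 0 \<omega> = 0) \<and>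
     prob_space.indep_vars M (\<lambda>_. borel) (\<lambda>k \<omega>. Ts k \<omega> - Ts (k - 1) \<omega>) {1..} \<and>
     (\<forall>k\<ge>1. distributed M lborel (\<lambda>\<omega>. Ts k \<omega> - Ts (k - 1) \<omega>) (exponential_density r)) \<and>
     (\<forall>t\<ge>0. \<forall>\<omega>\<in>space M. Np t \<omega> = card {k. 1 \<le> k \<and> Ts k \<omega> \<le> t})"

text \<open>The last clause makes the whole family of increments of \<open>Ts\<close> and of the \<open>U k\<close> and \<open>V k\<close>
  independent: the variables of each sequence are independent, and so are the three sequences.\<close>

definition thinning_data ::
  "'w measure \<Rightarrow> real \<Rightarrow> (real \<Rightarrow> 'w \<Rightarrow> nat) \<Rightarrow> (nat \<Rightarrow> 'w \<Rightarrow> real) \<Rightarrow>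
   (nat \<Rightarrow> 'w \<Rightarrow> real) \<Rightarrow> (nat \<Rightarrow> 'w \<Rightarrow> real) \<Rightarrow> bool" where
  "thinning_data M r Np Ts U V \<longleftrightarrow>
     poisson_process M r Np Ts \<and>
     (\<forall>k\<ge>1. distr M borel (U k) = uniform_measure lborel {0..1}) \<and>
     (\<forall>k\<ge>1. distr M borel (V k) = uniform_measure lborel {0..1}) \<and>
     prob_space.indep_vars M (\<lambda>_. borel)
       (\<lambda>i. case i of
              Inl k \<Rightarrow> (\<lambda>\<omega>. Ts k \<omega> - Ts (k - 1) \<omega>)
            | Inr (Inl k) \<Rightarrow> U k
            | Inr (Inr k) \<Rightarrow> V k)
       ({1..} <+> ({1..} <+> {1..}))"


section \<open>Construction by thinning\<close>

text \<open>\<open>Q ((\<theta>, \<nu>), A)\<close> for a set \<open>A\<close> of modes abbreviates \<open>Q ((\<theta>, \<nu>), A \<times> \<real>)\<close>.\<close>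

definition mode_prob :: "('k \<times> real \<Rightarrow> ('k \<times> real) measure) \<Rightarrow> 'k \<times> real \<Rightarrow> 'k set \<Rightarrow> real" where
  "mode_prob Q x A = measure (Q x) (A \<times> UNIV)"

definition cum_prob ::
  "(nat \<Rightarrow> 'k) \<Rightarrow> ('k \<times> real \<Rightarrow> ('k \<times> real) measure) \<Rightarrow> nat \<Rightarrow> 'k \<times> real \<Rightarrow> real" where
  "cum_prob k Q j x = (\<Sum>i=1..j. mode_prob Q x {k i})"

text \<open>The function \<open>H\<close>. No interval contains \<open>u\<close> only for a null set of values \<open>u \<in> [0, 1]\<close> (such
  as \<open>u = 0\<close>); there the mode \<open>k 1\<close> is a dummy.\<close>

definition select_mode ::
  "(nat \<Rightarrow> 'k) \<Rightarrow> enat \<Rightarrow> ('k \<times> real \<Rightarrow> ('k \<times> real) measure) \<Rightarrow> 'k \<times> real \<Rightarrow> real \<Rightarrow> 'k" where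
  "select_mode k N Q x u =
     (let P = (\<lambda>i. i \<in> mode_indices N \<and> cum_prob k Q (i - 1) x < u \<and> u \<le> cum_prob k Q i x)
      in if \<exists>i. P i then k (THE i. P i) else k 1)"

text \<open>\<open>thinning \<dots> n\<close> is \<open>(\<tau>\<^sub>n, \<theta>\<^sub>n, \<nu>\<^sub>n)\<close>. The index \<open>\<tau>\<^sub>n\<close> is \<open>\<infinity>\<close> if fewer than \<open>n\<close> proposals are ever
  accepted, which may happen with positive probability as \<open>\<lambda>\<close> need not be bounded away from \<open>0\<close>;
  then \<open>\<theta>\<^sub>n\<close> and \<open>\<nu>\<^sub>n\<close> are meaningless, and they are not used by \<open>thinning_path\<close>.\<close>

primrec thinning ::
  "(nat \<Rightarrow> 'k) \<Rightarrow> enat \<Rightarrow> ('k \<times> real \<Rightarrow> ('k \<times> real) measure) \<Rightarrow> ('k \<times> real \<Rightarrow> real) \<Rightarrow> real \<Rightarrow>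
   ('k \<Rightarrow> real \<Rightarrow> real \<Rightarrow> real) \<Rightarrow> 'k \<times> real \<Rightarrow>
   (nat \<Rightarrow> real) \<Rightarrow> (nat \<Rightarrow> real) \<Rightarrow> (nat \<Rightarrow> real) \<Rightarrow> nat \<Rightarrow> enat \<times> 'k \<times> real" where
  "thinning k N Q lam lamstar \<Phi> x Ts U V 0 = (0, x)"
| "thinning k N Q lam lamstar \<Phi> x Ts U V (Suc n) =
     (let (\<tau>, \<theta>, \<nu>) = thinning k N Q lam lamstar \<Phi> x Ts U V n;
          s = Ts (the_enat \<tau>);
          \<tau>' = Inf {enat j | j. \<tau> < enat j \<and> U j * lamstar \<le> lam (\<theta>, \<Phi> \<theta> (Ts j - s) \<nu>)};
          \<nu>' = \<Phi> \<theta> (Ts (the_enat \<tau>') - s) \<nu>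
      in (\<tau>', select_mode k N Q (\<theta>, \<nu>') (V (Suc n)), \<nu>'))"

definition jump_time :: "(nat \<Rightarrow> real) \<Rightarrow> enat \<Rightarrow> ereal" where
  "jump_time Ts \<tau> = (case \<tau> of enat j \<Rightarrow> ereal (Ts j) | \<infinity> \<Rightarrow> \<infinity>)"

text \<open>Almost surely there is exactly one \<open>n\<close> with \<open>T\<^sub>n \<le> t < T\<^sub>n\<^sub>+\<^sub>1\<close>.\<close>

definition thinning_path ::
  "(nat \<Rightarrow> 'k) \<Rightarrow> enat \<Rightarrow> ('k \<times> real \<Rightarrow> ('k \<times> real) measure) \<Rightarrow> ('k \<times> real \<Rightarrow> real) \<Rightarrow> real \<Rightarrow>
   ('k \<Rightarrow> real \<Rightarrow> real \<Rightarrow> real) \<Rightarrow> 'k \<times> real \<Rightarrow>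
   (nat \<Rightarrow> real) \<Rightarrow> (nat \<Rightarrow> real) \<Rightarrow> (nat \<Rightarrow> real) \<Rightarrow> real \<Rightarrow> 'k \<times> real" where
  "thinning_path k N Q lam lamstar \<Phi> x Ts U V t =
     (let st = thinning k N Q lam lamstar \<Phi> x Ts U V;
          n = (LEAST n. jump_time Ts (fst (st n)) \<le> ereal t \<and>
                        ereal t < jump_time Ts (fst (st (Suc n))));
          (\<tau>, \<theta>, \<nu>) = st n
      in (\<theta>, \<Phi> \<theta> (t - Ts (the_enat \<tau>)) \<nu>))"


section \<open>Generator and regularity\<close>

definition generator ::
  "('k \<Rightarrow> real \<Rightarrow> real) \<Rightarrow> ('k \<times> real \<Rightarrow> real) \<Rightarrow> ('k \<times> real \<Rightarrow> ('k \<times> real) measure) \<Rightarrow>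
   (real \<Rightarrow> 'k \<times> real \<Rightarrow> real) \<Rightarrow> real \<Rightarrow> 'k \<times> real \<Rightarrow> real" where
  "generator f lam Q g t x =
     vector_derivative (\<lambda>s. g s x) (at t within {0..})
     + f (fst x) (snd x) * deriv (\<lambda>\<nu>. g t (fst x, \<nu>)) (snd x)
     + lam x * (\<integral>y. (g t y - g t x) \<partial>Q x)"

text \<open>The bound \<open>C\<close> is an explicit argument so that it can be required to be the same for all modes and
  all sets of modes. For infinitely many modes a weak error expansion with remainder \<open>O(h\<^sup>2)\<close> fails
  when, for instance, the bounds on \<open>f\<^sub>\<theta>''\<close> depend on \<open>\<theta>\<close>.\<close>

definition C2_bounded_by :: "real \<Rightarrow> (real \<Rightarrow> real) \<Rightarrow> bool" where
  "C2_bounded_by C g \<longleftrightarrow>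
     (\<exists>g' g''. (\<forall>\<nu>. (g has_real_derivative g' \<nu>) (at \<nu>)) \<and>
               (\<forall>\<nu>. (g' has_real_derivative g'' \<nu>) (at \<nu>)) \<and>
               continuous_on UNIV g'' \<and>
               (\<forall>\<nu>. \<bar>g \<nu>\<bar> \<le> C \<and> \<bar>g' \<nu>\<bar> \<le> C \<and> \<bar>g'' \<nu>\<bar> \<le> C))"

definition has_partials_on ::
  "(real \<times> real \<Rightarrow> real) \<Rightarrow> (real \<times> real \<Rightarrow> real) \<Rightarrow> (real \<times> real \<Rightarrow> real) \<Rightarrow> (real \<times> real) set \<Rightarrow> bool"
where
  "has_partials_on g g\<^sub>1 g\<^sub>2 S \<longleftrightarrow>
     (\<forall>z\<in>S. (g has_derivative (\<lambda>v. g\<^sub>1 z * fst v + g\<^sub>2 z * snd v)) (at z within S))"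

text \<open>The bounds may depend on the mode; only the Lipschitz constant \<open>K\<close> may not.\<close>

definition regular_solution :: "real \<Rightarrow> (real \<Rightarrow> 'k \<times> real \<Rightarrow> real) \<Rightarrow> bool" where
  "regular_solution T u \<longleftrightarrow>
     (\<exists>K. \<forall>\<theta>. \<exists>u\<^sub>t u\<^sub>\<nu> u\<^sub>t\<^sub>t u\<^sub>t\<^sub>\<nu> u\<^sub>\<nu>\<^sub>t u\<^sub>\<nu>\<^sub>\<nu>.
        let S = {0..T} \<times> UNIV; u\<^sub>\<theta> = (\<lambda>(t, \<nu>). u t (\<theta>, \<nu>)) in
          has_partials_on u\<^sub>\<theta> u\<^sub>t u\<^sub>\<nu> S \<and>
          has_partials_on u\<^sub>t u\<^sub>t\<^sub>t u\<^sub>t\<^sub>\<nu> S \<and>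
          has_partials_on u\<^sub>\<nu> u\<^sub>\<nu>\<^sub>t u\<^sub>\<nu>\<^sub>\<nu> S \<and>
          (\<forall>g\<in>{u\<^sub>\<theta>, u\<^sub>t, u\<^sub>\<nu>, u\<^sub>t\<^sub>t, u\<^sub>t\<^sub>\<nu>, u\<^sub>\<nu>\<^sub>t, u\<^sub>\<nu>\<^sub>\<nu>}. bounded (g ` S)) \<and>
          (\<forall>g\<in>{u\<^sub>t\<^sub>t, u\<^sub>t\<^sub>\<nu>, u\<^sub>\<nu>\<^sub>t, u\<^sub>\<nu>\<^sub>\<nu>}. K-lipschitz_on S g))"

text \<open>The integrability clause is the well-definedness of the integral in the generator, which
  would otherwise silently be \<open>0\<close>.\<close>

definition solves_backward_equation ::
  "('k \<Rightarrow> real \<Rightarrow> real) \<Rightarrow> ('k \<times> real \<Rightarrow> real) \<Rightarrow> ('k \<times> real \<Rightarrow> ('k \<times> real) measure) \<Rightarrow>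
   real \<Rightarrow> ('k \<times> real \<Rightarrow> real) \<Rightarrow> (real \<Rightarrow> 'k \<times> real \<Rightarrow> real) \<Rightarrow> bool" where
  "solves_backward_equation f lam Q T F u \<longleftrightarrow>
     (\<forall>t\<in>{0..<T}. \<forall>x. integrable (Q x) (u t) \<and> generator f lam Q u t x = 0) \<and>
     (\<forall>x. u T x = F x)"

end

theory Submission
  imports Defs
begin


text \<open>A rejected proposal of the Poisson process leaves the state unchanged, so conditioning on the first
  proposal gives a fixed-point equation \<open>H = src + J H\<close> for the expected terminal value, where \<open>J\<close> is an
  integral operator of Volterra type depending on the flow. The value is discounted by \<open>exp (\<lambda>\<^sup>* t)\<close>, which
  removes the exponential weights from \<open>J\<close>; its \<open>n\<close>-th iterate is of size \<open>1/n!\<close>, so approximate fixed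
  points are close to the expected value.

  For the exact flow, the backward equation and the fundamental theorem of calculus along the flow show that
  \<open>u\<close> is an exact fixed point. For the Euler polygon the residual of \<open>u\<close> is
  \<open>\<integral> (f(y) - f(y_grid)) \<partial>\<^sub>\<nu>u = h/2 \<integral> f f' \<partial>\<^sub>\<nu>u + O(h\<^sup>2)\<close>, because the distance to the last grid
  point is \<open>h/2\<close> plus a sawtooth whose primitive is \<open>O(h\<^sup>2)\<close>. Hence the error is \<open>h\<close> times the solution of
  the Euler fixed-point equation with this source. That solution differs by \<open>O(h)\<close> from the one for the exact
  flow, whose value at the starting point yields \<open>c\<^sub>1\<close>.\<close>

section \<open>Volterra operators of piecewise deterministic processes\<close>

text \<open>Proposals arrive at a constant rate, so both flows are driven by the same noise law and
  the flow enters the fixed-point equation only through the integrand of \<open>jump_op\<close> and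
  the source. Truncating by the number of proposals turns expected values into Picard iterates
  exactly; the paths are recovered by dominated convergence, since almost surely only finitely many
  proposals precede \<open>T\<close>. Three obstacles shape the estimates. A jump may lead to any
  mode, so every constant has to be uniform in the mode, while bounds of \<open>u\<close> are given
  mode by mode; they are made uniform before consistency is studied. Modes are discrete, so kernels
  at two nearby positions are compared in total variation, which is why sets \<open>A\<close> of
  modes and not single modes appear in the Lipschitz condition on \<open>Q\<close>. The slope defect
  of the polygon is only O(h) pointwise; the sawtooth gains an order by partial integration, at the
  price of one derivative of \<open>f * f1 * u_n\<close>, hence of second derivatives of
  \<open>f\<close> and \<open>u\<close>.\<close>

definition flow_map :: "('k \<Rightarrow> real \<Rightarrow> real \<Rightarrow> real) \<Rightarrow> real \<Rightarrow> 'k \<times> real \<Rightarrow> 'k \<times> real" where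
  "flow_map \<Phi> t x = (fst x, \<Phi> (fst x) t (snd x))"

text \<open>Joint measurability is asked mode by mode; countability of the modes then allows a
  random mode, as in \<open>measurable_flow_apply\<close>.\<close>

definition measurable_flow :: "('k \<Rightarrow> real \<Rightarrow> real \<Rightarrow> real) \<Rightarrow> bool" where
  "measurable_flow \<Phi> \<longleftrightarrow> (\<forall>\<theta>. (\<lambda>(t, \<nu>). \<Phi> \<theta> t \<nu>) \<in> borel_measurable (borel \<Otimes>\<^sub>M borel))"

lemma measurable_flowD:
  assumes "measurable_flow \<Phi>" "f \<in> borel_measurable M" "g \<in> borel_measurable M"
  shows "(\<lambda>\<omega>. \<Phi> \<theta> (f \<omega>) (g \<omega>)) \<in> borel_measurable M"
proof -
  have "(\<lambda>(t, \<nu>). \<Phi> \<theta> t \<nu>) \<in> borel_measurable (borel \<Otimes>\<^sub>M borel)"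
    using assms(1) by (auto simp: measurable_flow_def)
  from measurable_compose[OF measurable_Pair[OF assms(2,3)] this] show ?thesis
    by simp
qed

lemma measurable_flow_apply:
  fixes \<Phi> :: "'k::countable \<Rightarrow> real \<Rightarrow> real \<Rightarrow> real"
  assumes "measurable_flow \<Phi>" "f \<in> borel_measurable M" "g \<in> borel_measurable M"
    and "\<theta> \<in> M \<rightarrow>\<^sub>M count_space UNIV"
  shows "(\<lambda>\<omega>. \<Phi> (\<theta> \<omega>) (f \<omega>) (g \<omega>)) \<in> borel_measurable M"
  by (rule measurable_compose_countable[OF _ assms(4)]) (rule measurable_flowD[OF assms(1-3)])

lemma measurable_flow_map:
  fixes \<Phi> :: "'k::countable \<Rightarrow> real \<Rightarrow> real \<Rightarrow> real"
  assumes "measurable_flow \<Phi>" "f \<in> borel_measurable M" and [measurable]: "X \<in> M \<rightarrow>\<^sub>M state_space"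
  shows "(\<lambda>\<omega>. flow_map \<Phi> (f \<omega>) (X \<omega>)) \<in> M \<rightarrow>\<^sub>M state_space"
proof -
  have [measurable]: "(\<lambda>\<omega>. \<Phi> (fst (X \<omega>)) (f \<omega>) (snd (X \<omega>))) \<in> borel_measurable M"
    by (rule measurable_flow_apply[OF assms(1,2)]) measurable
  show ?thesis unfolding flow_map_def by measurable
qed

section \<open>Elementary integral estimates\<close>

lemma (in prob_space) abs_expectation_le:
  fixes g :: "'a \<Rightarrow> real"
  assumes "\<And>x. x \<in> space M \<Longrightarrow> \<bar>g x\<bar> \<le> b"
  shows "\<bar>\<integral>x. g x \<partial>M\<bar> \<le> b"
proof (cases "integrable M g")
  case True
  have "\<bar>\<integral>x. g x \<partial>M\<bar> \<le> (\<integral>x. \<bar>g x\<bar> \<partial>M)" by (rule integral_abs_bound)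
  also have "\<dots> \<le> (\<integral>x. b \<partial>M)" using True assms by (intro integral_mono) auto
  finally show ?thesis by (simp add: prob_space)
next
  \<comment> \<open>The integral is 0 by convention here, and \<open>0 \<le> b\<close> follows from
    the bound at any point of the nonempty space.\<close>
  case False
  obtain x where "x \<in> space M" using not_empty by auto
  with assms have "0 \<le> b" by force
  then show ?thesis using False by (simp add: not_integrable_integral_eq)
qed

text \<open>The majorant comes with a primitive \<open>G\<close> because all later majorants,
  exponentials and terms \<open>(lamstar * t) ^ n / fact n\<close>, have explicit ones. Bounding a
  Volterra integral then means evaluating \<open>G\<close> at two points.\<close>

lemma set_integral_le_FTC:
  fixes g :: "real \<Rightarrow> real"
  assumes "a \<le> b" and g: "set_integrable lborel {a..b} g"
    and le: "\<And>r. a \<le> r \<Longrightarrow> r \<le> b \<Longrightarrow> \<bar>g r\<bar> \<le> G' r"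
    and G: "\<And>r. a \<le> r \<Longrightarrow> r \<le> b \<Longrightarrow> (G has_real_derivative G' r) (at r)"
    and cont: "\<And>r. a \<le> r \<Longrightarrow> r \<le> b \<Longrightarrow> isCont G' r"
  shows "\<bar>LINT r:{a..b}|lborel. g r\<bar> \<le> G b - G a"
proof -
  have int: "set_integrable lborel {a..b} G'"
    by (rule borel_integrable_atLeastAtMost') (auto intro!: continuous_at_imp_continuous_on cont)
  have "\<bar>LINT r:{a..b}|lborel. g r\<bar> \<le> (LINT r:{a..b}|lborel. \<bar>g r\<bar>)"
    unfolding set_lebesgue_integral_def
    using integral_abs_bound[of lborel "\<lambda>r. indicator {a..b} r *\<^sub>R g r"] by (simp add: abs_mult)
  also have "\<dots> \<le> (LINT r:{a..b}|lborel. G' r)"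
    using set_integrable_abs[OF g] int le by (intro set_integral_mono) auto
  also have "\<dots> = (\<integral>r. G' r * indicator {a..b} r \<partial>lborel)"
    unfolding set_lebesgue_integral_def by (simp add: mult.commute)
  also have "\<dots> = G b - G a"
    by (rule integral_FTC_Icc_real[OF assms(1) G cont])
  finally show ?thesis .
qed

lemma set_integral_abs_le_const:
  fixes g :: "real \<Rightarrow> real"
  assumes "a \<le> b" "set_integrable lborel {a..b} g" "\<And>r. a \<le> r \<Longrightarrow> r \<le> b \<Longrightarrow> \<bar>g r\<bar> \<le> c"
  shows "\<bar>LINT r:{a..b}|lborel. g r\<bar> \<le> c * (b - a)"
proof -
  have "((\<lambda>r. c * r) has_real_derivative c) (at r)" for r
    by (auto intro!: derivative_eq_intros)
  then have "\<bar>LINT r:{a..b}|lborel. g r\<bar> \<le> c * b - c * a"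
    using assms by (intro set_integral_le_FTC[where G'="\<lambda>_. c"]) auto
  then show ?thesis by (simp add: algebra_simps)
qed

lemma set_integrable_bounded_borel:
  fixes g :: "real \<Rightarrow> real"
  assumes "g \<in> borel_measurable borel" "\<And>r. a \<le> r \<Longrightarrow> r \<le> b \<Longrightarrow> \<bar>g r\<bar> \<le> c"
  shows "set_integrable lborel {a..b} g"
  unfolding set_integrable_def
proof (rule integrableI_bounded_set[where A="{a..b}" and B="max c 0"])
  show "(\<lambda>x. indicator {a..b} x *\<^sub>R g x) \<in> borel_measurable lborel"
    using assms(1) by measurable
  show "AE x in lborel. x \<in> {a..b} \<longrightarrow> norm (indicator {a..b} x *\<^sub>R g x) \<le> max c 0"
    using assms(2) by (auto simp: le_max_iff_disj)
  show "emeasure lborel {a..b} < \<infinity>"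
    by (cases "a \<le> b") auto
qed (auto simp: indicator_def)

section \<open>Weights: functions of remaining time, age and last jump state\<close>

type_synonym 'k weight = "real \<Rightarrow> real \<Rightarrow> 'k \<times> real \<Rightarrow> real"

text \<open>A weight \<open>H t s x\<close> is the discounted value of a process with remaining time \<open>t\<close> whose last
  jump, \<open>s\<close> time units ago, led to the state \<open>x\<close>. The age \<open>s\<close> is needed since the Euler polygon has no
  semigroup property.\<close>

definition measurable_weight :: "'k::countable weight \<Rightarrow> bool" where
  "measurable_weight H \<longleftrightarrow>
     (\<lambda>(t, s, x). H t s x) \<in> borel_measurable (borel \<Otimes>\<^sub>M (borel \<Otimes>\<^sub>M state_space))"

text \<open>The bound is uniform over all states, since the operator integrates over whatever modes
  a jump can reach.\<close>

definition weight_bounded :: "real \<Rightarrow> real \<Rightarrow> 'k weight \<Rightarrow> bool" where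
  "weight_bounded T B H \<longleftrightarrow> (\<forall>t\<in>{0..T}. \<forall>s\<ge>0. \<forall>x. \<bar>H t s x\<bar> \<le> B)"

lemma weight_boundedD: "weight_bounded T B H \<Longrightarrow> 0 \<le> t \<Longrightarrow> t \<le> T \<Longrightarrow> 0 \<le> s \<Longrightarrow> \<bar>H t s x\<bar> \<le> B"
  unfolding weight_bounded_def by (cases x) auto

lemma weight_boundedI:
  "(\<And>t s x. 0 \<le> t \<Longrightarrow> t \<le> T \<Longrightarrow> 0 \<le> s \<Longrightarrow> \<bar>H t s x\<bar> \<le> B) \<Longrightarrow> weight_bounded T B H"
  by (simp add: weight_bounded_def)

lemma measurable_weightD:
  assumes "measurable_weight H" "f \<in> borel_measurable M" "g \<in> borel_measurable M" "X \<in> M \<rightarrow>\<^sub>M state_space"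
  shows "(\<lambda>\<omega>. H (f \<omega>) (g \<omega>) (X \<omega>)) \<in> borel_measurable M"
proof -
  have "(\<lambda>(t, s, x). H t s x) \<in> borel_measurable (borel \<Otimes>\<^sub>M (borel \<Otimes>\<^sub>M state_space))"
    using assms(1) by (auto simp: measurable_weight_def)
  from measurable_compose[OF measurable_Pair[OF assms(2) measurable_Pair[OF assms(3,4)]] this] show ?thesis
    by simp
qed

lemma measurable_weightI:
  fixes H :: "'k::countable weight"
  assumes "(\<lambda>z. H (fst z) (fst (snd z)) (snd (snd z))) \<in> borel_measurable (borel \<Otimes>\<^sub>M (borel \<Otimes>\<^sub>M state_space))"
  shows "measurable_weight H"
  using assms unfolding measurable_weight_def by (simp add: case_prod_beta')

lemma measurable_weight_lincomb:
  fixes H :: "'k::countable weight"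
  assumes "measurable_weight H" "measurable_weight H'"
  shows "measurable_weight (\<lambda>t s x. H t s x + c * H' t s x)"
  using assms unfolding measurable_weight_def by (simp add: case_prod_beta')

text \<open>Contribution of the event that no further proposal arrives; its probability
  \<open>exp (- lamstar * t)\<close> is cancelled by the discount. The flow runs for
  \<open>s + t\<close> from the last jump state, so that the Euler grid keeps its origin.\<close>

definition terminal_weight :: "('k \<Rightarrow> real \<Rightarrow> real \<Rightarrow> real) \<Rightarrow> ('k \<times> real \<Rightarrow> real) \<Rightarrow> 'k weight" where
  "terminal_weight \<Phi> F t s x = F (flow_map \<Phi> (s + t) x)"

lemma terminal_weight_measurable:
  fixes F :: "'k::countable \<times> real \<Rightarrow> real"
  assumes "measurable_flow \<Phi>" "F \<in> borel_measurable state_space"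
  shows "measurable_weight (terminal_weight \<Phi> F)"
  unfolding terminal_weight_def
  by (rule measurable_weightI, rule measurable_compose[OF measurable_flow_map[OF assms(1)] assms(2)]) measurable

lemma power_fact_derivative:
  "((\<lambda>t. (a * t) ^ Suc n / fact (Suc n)) has_real_derivative a * ((a * t) ^ n / fact n)) (at t)"
proof -
  have "((\<lambda>t. (a * t) ^ Suc n / fact (Suc n)) has_real_derivative
     (real (Suc n) * (a * t) ^ n * a) / fact (Suc n)) (at t)"
    by (auto intro!: derivative_eq_intros simp del: fact_Suc power_Suc)
  also have "(real (Suc n) * (a * t) ^ n * a) / fact (Suc n) = a * ((a * t) ^ n / fact n)"
    by (simp add: field_simps del: of_nat_Suc)
  finally show ?thesis .
qed

section \<open>The Volterra operator and its Picard iterates\<close>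

locale pdmp_kernel =
  fixes lam :: "'k::countable \<times> real \<Rightarrow> real" and lamstar :: real
    and Q :: "'k \<times> real \<Rightarrow> ('k \<times> real) measure"
  assumes lam_measurable [measurable]: "lam \<in> borel_measurable state_space"
    and lam_bounds: "\<And>y. 0 < lam y \<and> lam y \<le> lamstar"
    and Q_kernel [measurable]: "Q \<in> state_space \<rightarrow>\<^sub>M prob_algebra state_space"
    and Q_mode_jump: "\<And>\<theta> \<nu> A B. B \<in> sets borel \<Longrightarrow>
          measure (Q (\<theta>, \<nu>)) (A \<times> B) = mode_prob Q (\<theta>, \<nu>) A * indicator B \<nu>"
begin

lemma lamstar_pos: "0 < lamstar"
  using lam_bounds[of undefined] by linarith

lemma space_state_space: "space (state_space :: ('k \<times> real) measure) = UNIV"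
  by (simp add: space_pair_measure)

lemma Q_in: "Q y \<in> space (prob_algebra state_space)"
  using measurable_space[OF Q_kernel, of y] by (simp add: space_state_space)

lemma Q_prob: "prob_space (Q y)" and sets_Q [measurable_cong]: "sets (Q y) = sets state_space"
  using Q_in[of y] by (auto simp: space_prob_algebra)

lemma space_Q: "space (Q y) = UNIV"
  using sets_eq_imp_space_eq[OF sets_Q, of y] by (simp add: space_state_space)

text \<open>Pushing \<open>Q (X \<omega>)\<close> forward along
  \<open>z \<mapsto> (\<omega>, z)\<close> makes the integrand a fixed function on the product, and
  integrating a fixed function against a kernel is measurable in the parameter.\<close>

lemma Q_integral_measurable:
  assumes f: "(\<lambda>(\<omega>, z). f \<omega> z) \<in> borel_measurable (M \<Otimes>\<^sub>M state_space)" and X: "X \<in> M \<rightarrow>\<^sub>M state_space"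
  shows "(\<lambda>\<omega>. \<integral>z. f \<omega> z \<partial>Q (X \<omega>) :: real) \<in> borel_measurable M"
proof -
  have *: "(\<lambda>\<omega>. Q (X \<omega>)) \<in> M \<rightarrow>\<^sub>M subprob_algebra state_space"
    by (rule measurable_prob_algebraD) (rule measurable_compose[OF X Q_kernel])
  have eq: "integral\<^sup>L (distr (Q (X \<omega>)) (M \<Otimes>\<^sub>M state_space) (\<lambda>z. (\<omega>, z))) (\<lambda>(\<omega>, z). f \<omega> z)
      = (\<integral>z. f \<omega> z \<partial>Q (X \<omega>))" if "\<omega> \<in> space M" for \<omega>
  proof -
    have "(\<lambda>z. (\<omega>, z)) \<in> Q (X \<omega>) \<rightarrow>\<^sub>M M \<Otimes>\<^sub>M state_space"
      using that by (intro measurable_Pair) (simp_all add: measurable_ident_sets sets_Q)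
    from integral_distr[OF this f] show ?thesis by simp
  qed
  have "(\<lambda>\<omega>. integral\<^sup>L (distr (Q (X \<omega>)) (M \<Otimes>\<^sub>M state_space) (\<lambda>z. (\<omega>, z))) (\<lambda>(\<omega>, z). f \<omega> z)) \<in> borel_measurable M"
    by (rule measurable_compose[OF measurable_distr2[OF _ *] integral_measurable_subprob_algebra[OF f]]) simp
  then show ?thesis
    by (rule measurable_cong[THEN iffD1, rotated]) (rule eq)
qed

text \<open>First summand: the proposal at time \<open>r\<close> is rejected, so \<open>x\<close> is
  kept, the age grows to \<open>s + r\<close> and the polygon is not restarted. Second summand: it
  is accepted and the age restarts at 0. The coefficients sum to \<open>lamstar\<close>.\<close>

definition jump_integrand :: "('k \<Rightarrow> real \<Rightarrow> real \<Rightarrow> real) \<Rightarrow> 'k weight \<Rightarrow> real \<Rightarrow> real \<Rightarrow> 'k \<times> real \<Rightarrow> real \<Rightarrow> real"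
where
  "jump_integrand \<Phi> H t s x r =
     (lamstar - lam (flow_map \<Phi> (s + r) x)) * H (t - r) (s + r) x
     + lam (flow_map \<Phi> (s + r) x) * (\<integral>z. H (t - r) 0 z \<partial>Q (flow_map \<Phi> (s + r) x))"

definition jump_op :: "('k \<Rightarrow> real \<Rightarrow> real \<Rightarrow> real) \<Rightarrow> 'k weight \<Rightarrow> 'k weight" where
  "jump_op \<Phi> H t s x = (LINT r:{0..t}|lborel. jump_integrand \<Phi> H t s x r)"

text \<open>Starting from 0 makes the \<open>n\<close>-th iterate with source
  \<open>terminal_weight\<close> the discounted value on the event of fewer than \<open>n\<close>
  proposals; this is what \<open>integral_thinned_value\<close> confirms.\<close>

primrec picard :: "('k \<Rightarrow> real \<Rightarrow> real \<Rightarrow> real) \<Rightarrow> 'k weight \<Rightarrow> nat \<Rightarrow> 'k weight" where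
  "picard \<Phi> src 0 = (\<lambda>t s x. 0)"
| "picard \<Phi> src (Suc n) = (\<lambda>t s x. src t s x + jump_op \<Phi> (picard \<Phi> src n) t s x)"

lemma jump_integrand_measurable:
  assumes \<Phi>: "measurable_flow \<Phi>" and H: "measurable_weight H"
    and [measurable]: "a \<in> borel_measurable M" "b \<in> borel_measurable M" "X \<in> M \<rightarrow>\<^sub>M state_space" "c \<in> borel_measurable M"
  shows "(\<lambda>\<omega>. jump_integrand \<Phi> H (a \<omega>) (b \<omega>) (X \<omega>) (c \<omega>)) \<in> borel_measurable M"
proof -
  have Y [measurable]: "(\<lambda>\<omega>. flow_map \<Phi> (b \<omega> + c \<omega>) (X \<omega>)) \<in> M \<rightarrow>\<^sub>M state_space"
    by (rule measurable_flow_map[OF \<Phi>]) measurable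
  have [measurable]: "(\<lambda>\<omega>. H (a \<omega> - c \<omega>) (b \<omega> + c \<omega>) (X \<omega>)) \<in> borel_measurable M"
    by (rule measurable_weightD[OF H]) measurable
  have [measurable]: "(\<lambda>\<omega>. \<integral>z. H (a \<omega> - c \<omega>) 0 z \<partial>Q (flow_map \<Phi> (b \<omega> + c \<omega>) (X \<omega>))) \<in> borel_measurable M"
    by (rule Q_integral_measurable[OF _ Y]) (auto simp: case_prod_beta' intro!: measurable_weightD[OF H])
  show ?thesis unfolding jump_integrand_def by measurable
qed

lemma jump_op_measurable:
  assumes \<Phi>: "measurable_flow \<Phi>" and H: "measurable_weight H"
  shows "measurable_weight (jump_op \<Phi> H)"
proof (rule measurable_weightI)
  have [measurable]: "(\<lambda>(z, r). jump_integrand \<Phi> H (fst z) (fst (snd z)) (snd (snd z)) r)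
      \<in> borel_measurable ((borel \<Otimes>\<^sub>M (borel \<Otimes>\<^sub>M state_space)) \<Otimes>\<^sub>M lborel)"
    unfolding case_prod_beta' by (rule jump_integrand_measurable[OF \<Phi> H]) measurable
  have "(\<lambda>z. \<integral>r. (if 0 \<le> r \<and> r \<le> fst z then jump_integrand \<Phi> H (fst z) (fst (snd z)) (snd (snd z)) r else 0) \<partial>lborel)
      \<in> borel_measurable (borel \<Otimes>\<^sub>M (borel \<Otimes>\<^sub>M (state_space :: ('k \<times> real) measure)))"
    by measurable
  also have "(\<lambda>z. \<integral>r. (if 0 \<le> r \<and> r \<le> fst z then jump_integrand \<Phi> H (fst z) (fst (snd z)) (snd (snd z)) r else 0) \<partial>lborel)
     = (\<lambda>z. jump_op \<Phi> H (fst z) (fst (snd z)) (snd (snd z)))"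
    unfolding jump_op_def set_lebesgue_integral_def by (intro ext Bochner_Integration.integral_cong) auto
  finally show "(\<lambda>z. jump_op \<Phi> H (fst z) (fst (snd z)) (snd (snd z)))
    \<in> borel_measurable (borel \<Otimes>\<^sub>M (borel \<Otimes>\<^sub>M state_space))" .
qed

lemma picard_measurable:
  assumes \<Phi>: "measurable_flow \<Phi>" and src: "measurable_weight src"
  shows "measurable_weight (picard \<Phi> src n)"
proof (induction n)
  case 0 then show ?case by (simp add: measurable_weight_def case_prod_beta')
next
  case (Suc n)
  from measurable_weight_lincomb[OF src jump_op_measurable[OF \<Phi> Suc], of 1] show ?case by simp
qed

lemma Q_integrable:
  assumes "measurable_weight H" "weight_bounded T B H" "0 \<le> t" "t \<le> T" "0 \<le> s"
  shows "integrable (Q y) (\<lambda>z. H t s z)"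
proof -
  interpret prob_space "Q y" by (rule Q_prob)
  show ?thesis
  proof (rule integrable_const_bound[of _ B])
    show "AE z in Q y. norm (H t s z) \<le> B"
      using weight_boundedD[OF assms(2-5)] by (intro AE_I2) simp
    show "(\<lambda>z. H t s z) \<in> borel_measurable (Q y)"
      by (rule measurable_weightD[OF assms(1)]) measurable
  qed
qed

lemma jump_integrand_lincomb:
  assumes "measurable_weight H" "weight_bounded T B H" "measurable_weight H'" "weight_bounded T B' H'"
    and "t \<le> T" "0 \<le> r" "r \<le> t"
  shows "jump_integrand \<Phi> (\<lambda>t s x. H t s x + c * H' t s x) t s x r
     = jump_integrand \<Phi> H t s x r + c * jump_integrand \<Phi> H' t s x r"
proof -
  note * = Q_integrable[OF assms(1,2), of "t - r" 0] Q_integrable[OF assms(3,4), of "t - r" 0]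
  show ?thesis unfolding jump_integrand_def using * assms(5-7)
    by (simp add: algebra_simps)
qed

lemma jump_integrand_bound:
  assumes "\<And>s x. 0 \<le> s \<Longrightarrow> \<bar>H (t - r) s x\<bar> \<le> b" "0 \<le> s" "0 \<le> r"
  shows "\<bar>jump_integrand \<Phi> H t s x r\<bar> \<le> lamstar * b"
proof -
  let ?y = "flow_map \<Phi> (s + r) x"
  interpret prob_space "Q ?y" by (rule Q_prob)
  have 1: "\<bar>\<integral>z. H (t - r) 0 z \<partial>Q ?y\<bar> \<le> b"
    by (rule abs_expectation_le) (use assms in auto)
  have 2: "\<bar>H (t - r) (s + r) x\<bar> \<le> b" using assms by simp
  have "\<bar>jump_integrand \<Phi> H t s x r\<bar> \<le> (lamstar - lam ?y) * b + lam ?y * b"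
    unfolding jump_integrand_def using lam_bounds[of ?y] 1 2
    by (intro order_trans[OF abs_triangle_ineq] add_mono) (auto simp: abs_mult intro!: mult_mono)
  then show ?thesis by (simp add: algebra_simps)
qed

lemma jump_integrand_integrable:
  assumes "measurable_flow \<Phi>" "measurable_weight H" "weight_bounded T B H" "t \<le> T" "0 \<le> s"
  shows "set_integrable lborel {0..t} (jump_integrand \<Phi> H t s x)"
proof (rule set_integrable_bounded_borel)
  show "jump_integrand \<Phi> H t s x \<in> borel_measurable borel"
    by (rule jump_integrand_measurable[OF assms(1,2)]) (simp_all add: space_state_space)
  show "\<bar>jump_integrand \<Phi> H t s x r\<bar> \<le> lamstar * B" if "0 \<le> r" "r \<le> t" for r
    by (rule jump_integrand_bound) (use that assms weight_boundedD[OF assms(3)] in auto)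
qed

lemma jump_op_lincomb:
  assumes "measurable_flow \<Phi>" "measurable_weight H" "weight_bounded T B H" "measurable_weight H'" "weight_bounded T B' H'"
    and "t \<le> T" "0 \<le> s"
  shows "jump_op \<Phi> (\<lambda>t s x. H t s x + c * H' t s x) t s x = jump_op \<Phi> H t s x + c * jump_op \<Phi> H' t s x"
proof -
  have "jump_op \<Phi> (\<lambda>t s x. H t s x + c * H' t s x) t s x
    = (LINT r:{0..t}|lborel. jump_integrand \<Phi> H t s x r + c * jump_integrand \<Phi> H' t s x r)"
    unfolding jump_op_def
    by (rule set_lebesgue_integral_cong) (use jump_integrand_lincomb[OF assms(2-5)] assms in auto)
  then show ?thesis
    using jump_integrand_integrable[OF assms(1,2,3,6,7)] jump_integrand_integrable[OF assms(1,4,5,6,7)]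
    by (simp add: jump_op_def set_integral_add)
qed

text \<open>Since \<open>lamstar - lam\<close> and \<open>lam\<close> are nonnegative with sum
  \<open>lamstar\<close>, the operator acts on majorants depending on time alone like
  \<open>lamstar\<close> times integration from 0. It sends each term of the series of
  \<open>exp (lamstar * t)\<close> to the next one.\<close>

lemma jump_op_bound:
  assumes "measurable_flow \<Phi>" "measurable_weight H" "weight_bounded T B H" "0 \<le> t" "t \<le> T" "0 \<le> s"
    and b: "\<And>t s x. 0 \<le> t \<Longrightarrow> t \<le> T \<Longrightarrow> 0 \<le> s \<Longrightarrow> \<bar>H t s x\<bar> \<le> b t"
    and G: "\<And>t. (G has_real_derivative lamstar * b t) (at t)" and cont: "\<And>t. isCont b t"
  shows "\<bar>jump_op \<Phi> H t s x\<bar> \<le> G t - G 0"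
proof -
  have "\<bar>LINT r:{0..t}|lborel. jump_integrand \<Phi> H t s x r\<bar> \<le> - G (t - t) - - G (t - 0)"
  proof (rule set_integral_le_FTC[where G'="\<lambda>r. lamstar * b (t - r)"])
    show "\<bar>jump_integrand \<Phi> H t s x r\<bar> \<le> lamstar * b (t - r)" if "0 \<le> r" "r \<le> t" for r
      by (rule jump_integrand_bound) (use that assms in auto)
    show "((\<lambda>r. - G (t - r)) has_real_derivative lamstar * b (t - r)) (at r)" for r
    proof -
      have "((\<lambda>r. G (t - r)) has_real_derivative lamstar * b (t - r) * (- 1)) (at r)"
        by (rule DERIV_chain2[of G _ "\<lambda>r. t - r", OF G]) (auto intro!: derivative_eq_intros)
      from DERIV_minus[OF this] show ?thesis by simp
    qed
    show "isCont (\<lambda>r. lamstar * b (t - r)) r" for r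
      by (intro continuous_intros isCont_o2[OF _ cont])
  qed (use jump_integrand_integrable[OF assms(1-3,5,6)] assms in auto)
  then show ?thesis by (simp add: jump_op_def)
qed

text \<open>The function \<open>b * exp (lamstar * t)\<close> solves the scalar equation in which
  the operator is replaced by \<open>lamstar\<close> times integration and the source by
  \<open>b\<close>.\<close>

lemma picard_bound:
  assumes \<Phi>: "measurable_flow \<Phi>" and src: "measurable_weight src" "weight_bounded T b src"
    and "0 \<le> t" "t \<le> T" "0 \<le> s"
  shows "\<bar>picard \<Phi> src n t s x\<bar> \<le> b * exp (lamstar * t)"
  using assms(4-)
proof (induction n arbitrary: t s x)
  case 0
  from weight_boundedD[OF src(2), of 0 0] 0 have "0 \<le> b" by force
  then show ?case by simp
next
  case (Suc n)
  from weight_boundedD[OF src(2), of 0 0] Suc have "0 \<le> b" by force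
  have "weight_bounded T (b * exp (lamstar * T)) (picard \<Phi> src n)"
  proof (rule weight_boundedI)
    fix t s :: real and x assume t: "0 \<le> t" "t \<le> T" "0 \<le> s"
    have "b * exp (lamstar * t) \<le> b * exp (lamstar * T)"
      using t \<open>0 \<le> b\<close> lamstar_pos by (intro mult_left_mono) auto
    with Suc.IH[OF t, of x] show "\<bar>picard \<Phi> src n t s x\<bar> \<le> b * exp (lamstar * T)" by linarith
  qed
  then have "\<bar>jump_op \<Phi> (picard \<Phi> src n) t s x\<bar> \<le> b * exp (lamstar * t) - b * exp (lamstar * 0)"
    by (rule jump_op_bound[where b="\<lambda>t. b * exp (lamstar * t)", OF \<Phi> picard_measurable[OF \<Phi> src(1)]])
       (use Suc in \<open>auto intro!: derivative_eq_intros\<close>)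
  moreover have "\<bar>src t s x\<bar> \<le> b" using weight_boundedD[OF src(2)] Suc by auto
  ultimately show ?case by simp
qed

lemma picard_weight_bounded:
  assumes "measurable_flow \<Phi>" "measurable_weight src" "weight_bounded T b src"
  shows "weight_bounded T (b * exp (lamstar * T)) (picard \<Phi> src n)"
proof (cases "0 \<le> T")
  case True
  with weight_boundedD[OF assms(3), of 0 0] have "0 \<le> b" by force
  then show ?thesis
  unfolding weight_bounded_def
  using lamstar_pos by (auto intro!: order_trans[OF picard_bound[OF assms]] mult_left_mono)
qed (auto simp: weight_bounded_def)

lemma picard_lincomb:
  assumes \<Phi>: "measurable_flow \<Phi>" and src: "measurable_weight src" "weight_bounded T b src"
    and src': "measurable_weight src'" "weight_bounded T b' src'"
    and "0 \<le> t" "t \<le> T" "0 \<le> s"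
  shows "picard \<Phi> (\<lambda>t s x. src t s x + c * src' t s x) n t s x = picard \<Phi> src n t s x + c * picard \<Phi> src' n t s x"
  using assms(6-)
proof (induction n arbitrary: t s x)
  case (Suc n)
  \<comment> \<open>The induction hypothesis covers only admissible times and ages; under the
    integral \<open>t - r\<close> and \<open>s + r\<close> stay admissible.\<close>
  have "jump_op \<Phi> (picard \<Phi> (\<lambda>t s x. src t s x + c * src' t s x) n) t s x
    = jump_op \<Phi> (\<lambda>t s x. picard \<Phi> src n t s x + c * picard \<Phi> src' n t s x) t s x"
    unfolding jump_op_def
  proof (rule set_lebesgue_integral_cong)
    show "\<forall>r. r \<in> {0..t} \<longrightarrow>
         jump_integrand \<Phi> (picard \<Phi> (\<lambda>t s x. src t s x + c * src' t s x) n) t s x r =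
         jump_integrand \<Phi> (\<lambda>t s x. picard \<Phi> src n t s x + c * picard \<Phi> src' n t s x) t s x r"
      unfolding jump_integrand_def using Suc
      by (auto intro!: arg_cong2[where f="(+)"] arg_cong2[where f="(*)"] Bochner_Integration.integral_cong)
  qed simp
  also have "\<dots> = jump_op \<Phi> (picard \<Phi> src n) t s x + c * jump_op \<Phi> (picard \<Phi> src' n) t s x"
    by (rule jump_op_lincomb[OF \<Phi> picard_measurable[OF \<Phi> src(1)] picard_weight_bounded[OF \<Phi> src]
         picard_measurable[OF \<Phi> src'(1)] picard_weight_bounded[OF \<Phi> src']]) (use Suc in auto)
  finally show ?case by (simp add: algebra_simps)
qed simp

text \<open>The residual \<open>\<rho>\<close> is fed in at every step and sums to an exponential,
  whereas the initial error, at most \<open>B\<close> because the iteration starts at 0, is divided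
  by \<open>fact n\<close>. Letting \<open>n\<close> grow, any approximate fixed point approximates
  the limit.\<close>

lemma picard_stability:
  assumes \<Phi>: "measurable_flow \<Phi>" and src: "measurable_weight src" "weight_bounded T b src"
    and W: "measurable_weight W" "weight_bounded T B W"
    and res: "\<And>t s x. 0 \<le> t \<Longrightarrow> t \<le> T \<Longrightarrow> 0 \<le> s \<Longrightarrow> \<bar>W t s x - src t s x - jump_op \<Phi> W t s x\<bar> \<le> \<rho>"
    and "0 \<le> t" "t \<le> T" "0 \<le> s"
  shows "\<bar>picard \<Phi> src n t s x - W t s x\<bar> \<le> \<rho> * exp (lamstar * t) + B * ((lamstar * t) ^ n / fact n)"
  using assms(7-)
proof (induction n arbitrary: t s x)
  case 0
  with res[of t s x] have "0 \<le> \<rho>" by linarith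
  with weight_boundedD[OF W(2), of t s x] 0 show ?case by (simp add: add_increasing)
next
  case (Suc n)
  note P = picard_measurable[OF \<Phi> src(1), of n] picard_weight_bounded[OF \<Phi> src, of n]
  let ?E = "\<lambda>t s x. picard \<Phi> src n t s x + (- 1) * W t s x"
  let ?b = "\<lambda>t. \<rho> * exp (lamstar * t) + B * ((lamstar * t) ^ n / fact n)"
  let ?G = "\<lambda>t. \<rho> * exp (lamstar * t) + B * ((lamstar * t) ^ Suc n / fact (Suc n))"
  have E: "weight_bounded T (b * exp (lamstar * T) + B) ?E"
    unfolding weight_bounded_def
  proof (intro ballI allI impI)
    fix t s :: real and x assume "t \<in> {0..T}" "0 \<le> s"
    then show "\<bar>?E t s x\<bar> \<le> b * exp (lamstar * T) + B"
      using weight_boundedD[OF P(2), of t s x] weight_boundedD[OF W(2), of t s x] by auto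
  qed
  have "\<bar>jump_op \<Phi> ?E t s x\<bar> \<le> ?G t - ?G 0"
  proof (rule jump_op_bound[where b="?b", OF \<Phi> measurable_weight_lincomb[OF P(1) W(1)] E])
    show "(?G has_real_derivative lamstar * ?b t) (at t)" for t
      by (rule derivative_eq_intros refl power_fact_derivative | simp add: algebra_simps)+
    show "isCont ?b t" for t by (intro continuous_intros) auto
  qed (use Suc in auto)
  also have "jump_op \<Phi> ?E t s x = jump_op \<Phi> (picard \<Phi> src n) t s x - jump_op \<Phi> W t s x"
    by (subst jump_op_lincomb[OF \<Phi> P W]) (use Suc in auto)
  finally have "\<bar>jump_op \<Phi> (picard \<Phi> src n) t s x - jump_op \<Phi> W t s x\<bar> \<le> ?G t - \<rho>" by simp
  then show ?case using res[of t s x] Suc.prems by simp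
qed

text \<open>Meant for the first-order source, for which no explicit fixed point is available: the
  limit is the constant of the expansion up to discount. Successive iterates differ by at most a
  term of an exponential series.\<close>

lemma picard_convergent:
  assumes \<Phi>: "measurable_flow \<Phi>" and src: "measurable_weight src" "weight_bounded T b src"
    and t: "0 \<le> t" "t \<le> T" "0 \<le> s"
  shows "convergent (\<lambda>n. picard \<Phi> src n t s x)"
proof -
  note P = picard_measurable[OF \<Phi> src(1)] picard_weight_bounded[OF \<Phi> src]
  have "0 \<le> b" using weight_boundedD[OF src(2), of t s x] t by linarith
  have *: "\<bar>picard \<Phi> src (Suc n) t s x - picard \<Phi> src n t s x\<bar> \<le> b * ((lamstar * t) ^ n / fact n)"
    if "0 \<le> t" "t \<le> T" "0 \<le> s" for n t s x
    using that
  proof (induction n arbitrary: t s x)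
    case 0
    then show ?case using weight_boundedD[OF src(2)]
      by (simp add: jump_op_def jump_integrand_def set_lebesgue_integral_def)
  next
    case (Suc n)
    let ?E = "\<lambda>t s x. picard \<Phi> src (Suc n) t s x + (- 1) * picard \<Phi> src n t s x"
    have E: "weight_bounded T (b * exp (lamstar * T) + b * exp (lamstar * T)) ?E"
      unfolding weight_bounded_def
    proof (intro ballI allI impI)
      fix t s :: real and x assume "t \<in> {0..T}" "0 \<le> s"
      then show "\<bar>?E t s x\<bar> \<le> b * exp (lamstar * T) + b * exp (lamstar * T)"
        using weight_boundedD[OF P(2)[of "Suc n"], of t s x] weight_boundedD[OF P(2)[of n], of t s x] 
        by (simp del: picard.simps)
    qed
    have "\<bar>jump_op \<Phi> ?E t s x\<bar> \<le> b * ((lamstar * t) ^ Suc n / fact (Suc n)) - b * ((lamstar * 0) ^ Suc n / fact (Suc n))"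
    proof (rule jump_op_bound[where b="\<lambda>t. b * ((lamstar * t) ^ n / fact n)", OF \<Phi> measurable_weight_lincomb[OF P(1)[of "Suc n"] P(1)[of n]] E])
      show "((\<lambda>t. b * ((lamstar * t) ^ Suc n / fact (Suc n))) has_real_derivative lamstar * (b * ((lamstar * t) ^ n / fact n))) (at t)" for t
        by (rule DERIV_cong[OF DERIV_cmult[OF power_fact_derivative]]) (simp only: mult.left_commute)
      show "isCont (\<lambda>t. b * ((lamstar * t) ^ n / fact n)) t" for t by (intro continuous_intros) auto
      show "\<bar>?E t s x\<bar> \<le> b * ((lamstar * t) ^ n / fact n)" if "0 \<le> t" "t \<le> T" "0 \<le> s" for t s x
        using Suc.IH[OF that] by (simp del: picard.simps)
    qed (use Suc in auto)
    also have "jump_op \<Phi> ?E t s x = jump_op \<Phi> (picard \<Phi> src (Suc n)) t s x - jump_op \<Phi> (picard \<Phi> src n) t s x"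
      by (subst jump_op_lincomb[OF \<Phi> P(1) P(2) P(1) P(2)]) (use Suc in \<open>auto simp del: picard.simps\<close>)
    also have "\<dots> = picard \<Phi> src (Suc (Suc n)) t s x - picard \<Phi> src (Suc n) t s x"
      unfolding picard.simps(2)[of \<Phi> src "Suc n"] picard.simps(2)[of \<Phi> src n]
      by simp
    finally have "\<bar>picard \<Phi> src (Suc (Suc n)) t s x - picard \<Phi> src (Suc n) t s x\<bar>
      \<le> b * ((lamstar * t) ^ Suc n / fact (Suc n)) - b * ((lamstar * 0) ^ Suc n / fact (Suc n))" .
    moreover have "b * ((lamstar * 0) ^ Suc n / fact (Suc n)) = 0" by simp
    ultimately show ?case by linarith
  qed
  have "summable (\<lambda>n. b * ((lamstar * t) ^ n / fact n))"
    using summable_exp[of "lamstar * t"] by (intro summable_mult) (simp add: field_simps)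
  then have "summable (\<lambda>n. picard \<Phi> src (Suc n) t s x - picard \<Phi> src n t s x)"
    by (rule summable_comparison_test'[where N=0]) (use * t in \<open>auto simp del: picard.simps\<close>)
  then have "convergent (\<lambda>m. \<Sum>n<m. picard \<Phi> src (Suc n) t s x - picard \<Phi> src n t s x)"
    by (simp add: summable_iff_convergent)
  then have "convergent (\<lambda>m. picard \<Phi> src m t s x - picard \<Phi> src 0 t s x)"
    by (simp only: sum_lessThan_telescope[of "\<lambda>n. picard \<Phi> src n t s x"])
  then show ?thesis by simp
qed

end


text \<open>The inequality passes from atoms to all sets. On a set and on its complement it goes the
  same way, and both total masses are 1, so it is an equality.\<close>

lemma measure_eqI_countable_prob:
  fixes M N :: "'a::countable measure"
  assumes "prob_space M" "prob_space N" and sets: "sets M = UNIV" "sets N = UNIV"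
    and le: "\<And>a. emeasure M {a} \<le> emeasure N {a}"
  shows "M = N"
proof -
  interpret M: prob_space M by fact
  interpret N: prob_space N by fact
  have space: "space M = UNIV" "space N = UNIV"
    using sets sets_eq_imp_space_eq[of M "count_space UNIV"] sets_eq_imp_space_eq[of N "count_space UNIV"] by auto
  have mono: "emeasure M A \<le> emeasure N A" for A
    by (subst (1 2) emeasure_countable_singleton) (auto simp: sets intro!: nn_integral_mono le)
  have "measure M A = measure N A" for A
  proof -
    have "measure M A \<le> measure N A" "measure M (UNIV - A) \<le> measure N (UNIV - A)"
      using mono by (auto simp: M.emeasure_eq_measure N.emeasure_eq_measure)
    moreover have "measure M (UNIV - A) = 1 - measure M A" "measure N (UNIV - A) = 1 - measure N A"
      using M.prob_compl[of A] N.prob_compl[of A] sets space by auto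
    ultimately show ?thesis by linarith
  qed
  then show ?thesis
    using sets by (intro measure_eqI) (auto simp: M.emeasure_eq_measure N.emeasure_eq_measure)
qed

abbreviation unif :: "real measure" where "unif \<equiv> uniform_measure lborel {0..1}"

lemma prob_space_unif: "prob_space unif"
  by (rule prob_space_uniform_measure) auto

lemma emeasure_unif: "A \<in> sets borel \<Longrightarrow> emeasure unif A = emeasure lborel ({0..1} \<inter> A)"
  by (subst emeasure_uniform_measure) (auto simp: divide_ennreal_def)

section \<open>Selection of modes\<close>

context pdmp_kernel begin

lemma mode_prob_measurable: "(\<lambda>y. mode_prob Q y A) \<in> borel_measurable state_space"
proof -
  have "(\<lambda>y. Q y) \<in> state_space \<rightarrow>\<^sub>M subprob_algebra state_space"
    by (rule measurable_prob_algebraD) simp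
  moreover have "A \<times> UNIV \<in> sets (state_space :: ('k \<times> real) measure)"
    by (intro pair_measureI) auto
  ultimately show ?thesis unfolding mode_prob_def by measurable
qed

text \<open>\<open>Q_mode_jump\<close> gives the sets \<open>UNIV \<times> {\<nu>}\<close> and
  \<open>UNIV \<times> UNIV\<close> the same mass, which is 1.\<close>

lemma AE_Q_snd: "AE z in Q (\<theta>, \<nu>). snd z = \<nu>"
proof -
  interpret prob_space "Q (\<theta>, \<nu>)" by (rule Q_prob)
  have U: "UNIV = (UNIV :: 'k set) \<times> (UNIV :: real set)" by auto
  have "prob (UNIV \<times> {\<nu>}) = mode_prob Q (\<theta>, \<nu>) UNIV"
    by (subst Q_mode_jump) auto
  also have "\<dots> = prob (UNIV \<times> UNIV)" by (subst Q_mode_jump) auto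
  also have "\<dots> = 1" using prob_space by (simp add: space_Q)
  finally have "prob (UNIV \<times> {\<nu>}) = 1" .
  moreover have "(UNIV :: 'k set) \<times> {\<nu>} \<in> events"
    unfolding sets_Q by (intro pair_measureI) auto
  ultimately have "AE z in Q (\<theta>, \<nu>). z \<in> UNIV \<times> {\<nu>}"
    by (subst prob_eq_1[symmetric]) auto
  then show ?thesis by eventually_elim auto
qed

text \<open>A jump freezes the position, so this projection determines \<open>Q y\<close>; on the
  countable mode set all subsets are measurable and atoms determine the measure.\<close>

definition mode_law :: "'k \<times> real \<Rightarrow> 'k measure" where
  "mode_law y = distr (Q y) (count_space UNIV) fst"

lemma fst_Q_measurable: "fst \<in> Q y \<rightarrow>\<^sub>M count_space UNIV"
  by (simp add: measurable_cong_sets[OF sets_Q refl])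

lemma prob_space_mode_law: "prob_space (mode_law y)"
  unfolding mode_law_def by (intro prob_space.prob_space_distr Q_prob fst_Q_measurable)

lemma sets_mode_law: "sets (mode_law y) = UNIV"
  by (simp add: mode_law_def)

lemma measure_mode_law: "measure (mode_law y) A = mode_prob Q y A"
  unfolding mode_law_def mode_prob_def
  by (subst measure_distr[OF fst_Q_measurable]) (auto simp: space_Q intro!: arg_cong2[where f=measure])

lemma integral_Q_eq:
  fixes g :: "'k \<times> real \<Rightarrow> real"
  assumes "g \<in> borel_measurable state_space"
  shows "(\<integral>z. g z \<partial>Q (\<theta>, \<nu>)) = (\<integral>a. g (a, \<nu>) \<partial>mode_law (\<theta>, \<nu>))"
proof -
  have [measurable]: "g \<in> borel_measurable (Q (\<theta>, \<nu>))" using assms by (simp add: measurable_cong_sets[OF sets_Q refl])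
  have "(\<lambda>z. g (fst z, \<nu>)) \<in> borel_measurable (Q (\<theta>, \<nu>))"
    by (subst measurable_cong_sets[OF sets_Q refl]) (rule measurable_compose[OF _ assms], measurable)
  then have "(\<integral>z. g z \<partial>Q (\<theta>, \<nu>)) = (\<integral>z. g (fst z, \<nu>) \<partial>Q (\<theta>, \<nu>))"
  proof (intro integral_cong_AE)
    show "AE z in Q (\<theta>, \<nu>). g z = g (fst z, \<nu>)"
      using AE_Q_snd[of \<nu> \<theta>] by eventually_elim auto
  qed auto
  also have "\<dots> = (\<integral>a. g (a, \<nu>) \<partial>mode_law (\<theta>, \<nu>))"
    unfolding mode_law_def by (subst integral_distr[OF fst_Q_measurable]) auto
  finally show ?thesis .
qed

end

locale pdmp_modes = pdmp_kernel lam lamstar Q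
  for lam :: "'k::countable \<times> real \<Rightarrow> real" and lamstar Q +
  fixes k :: "nat \<Rightarrow> 'k" and N :: enat
  assumes modes: "bij_betw k (mode_indices N) UNIV"
begin

lemma cum_prob_mono: "i \<le> j \<Longrightarrow> cum_prob k Q i y \<le> cum_prob k Q j y"
  unfolding cum_prob_def mode_prob_def by (intro sum_mono2) auto

text \<open>The enumeration is injective on admissible indices, so the summands are masses of
  disjoint singletons under one probability measure.\<close>

lemma cum_prob_le_1: assumes "j \<in> mode_indices N" shows "cum_prob k Q j y \<le> 1"
proof -
  interpret m: prob_space "mode_law y" by (rule prob_space_mode_law)
  have sub: "{1..j} \<subseteq> mode_indices N" using assms
    by (auto simp: mode_indices_def) (meson enat_ord_simps(1) order_trans)
  then have inj: "inj_on k {1..j}" using modes by (meson bij_betw_def inj_on_subset)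
  have "cum_prob k Q j y = (\<Sum>i\<in>{1..j}. measure (mode_law y) {k i})"
    by (simp add: cum_prob_def measure_mode_law)
  also have "\<dots> = measure (mode_law y) (\<Union>i\<in>{1..j}. {k i})"
    using inj by (intro m.finite_measure_finite_Union[symmetric])
      (auto simp: sets_mode_law disjoint_family_on_def dest: inj_onD)
  finally show ?thesis by simp
qed

lemma select_mode_unique:
  assumes "i \<in> mode_indices N" "cum_prob k Q (i - 1) y < u" "u \<le> cum_prob k Q i y"
    and "j \<in> mode_indices N" "cum_prob k Q (j - 1) y < u" "u \<le> cum_prob k Q j y"
  shows "i = j"
proof (rule ccontr)
  assume "i \<noteq> j"
  then consider "i \<le> j - 1" | "j \<le> i - 1" by linarith
  then show False
    using cum_prob_mono[of i "j - 1" y] cum_prob_mono[of j "i - 1" y] assms by cases auto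
qed

lemma select_mode_eq:
  assumes "i \<in> mode_indices N" "cum_prob k Q (i - 1) y < u" "u \<le> cum_prob k Q i y"
  shows "select_mode k N Q y u = k i"
proof -
  have "(THE i. i \<in> mode_indices N \<and> cum_prob k Q (i - 1) y < u \<and> u \<le> cum_prob k Q i y) = i"
    by (rule the_equality) (use assms select_mode_unique in blast)+
  then show ?thesis using assms unfolding select_mode_def Let_def by auto
qed

text \<open>Each selecting condition is measurable and at most one index satisfies it, which is what
  makes \<open>THE\<close> measurable.\<close>

lemma select_mode_measurable:
  "(\<lambda>z. select_mode k N Q (fst z) (snd z)) \<in> state_space \<Otimes>\<^sub>M borel \<rightarrow>\<^sub>M count_space UNIV"
proof -
  let ?P = "\<lambda>i z. i \<in> mode_indices N \<and> cum_prob k Q (i - 1) (fst z) < snd z \<and> snd z \<le> cum_prob k Q i (fst z)"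
  have [measurable]: "(\<lambda>y. mode_prob Q y A) \<in> borel_measurable state_space" for A
    by (rule mode_prob_measurable)
  have [measurable]: "(\<lambda>y. cum_prob k Q i y) \<in> borel_measurable state_space" for i
    unfolding cum_prob_def by measurable
  have [measurable]: "Measurable.pred (state_space \<Otimes>\<^sub>M borel) (?P i)" for i
    by measurable
  have "(\<lambda>z. THE i. ?P i z) \<in> state_space \<Otimes>\<^sub>M borel \<rightarrow>\<^sub>M count_space UNIV"
    by (rule measurable_THE[where I=UNIV]) (auto intro: select_mode_unique)
  then have [measurable]: "(\<lambda>z. k (THE i. ?P i z)) \<in> state_space \<Otimes>\<^sub>M borel \<rightarrow>\<^sub>M count_space UNIV"
    by (rule measurable_compose) simp
  show ?thesis unfolding select_mode_def Let_def by measurable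
qed

lemma select_mode_measurable_mark: "select_mode k N Q y \<in> unif \<rightarrow>\<^sub>M count_space UNIV"
proof -
  have "(\<lambda>u. (y, u)) \<in> borel \<rightarrow>\<^sub>M state_space \<Otimes>\<^sub>M borel"
    by (intro measurable_Pair measurable_const) (auto simp: space_state_space)
  from measurable_compose[OF this select_mode_measurable] show ?thesis by simp
qed

text \<open>The preimage of \<open>k i\<close> contains the interval between consecutive cumulative
  sums, whose length is the mass of \<open>k i\<close>. This one-sided estimate suffices by
  \<open>measure_eqI_countable_prob\<close>; in particular the dummy value \<open>k 1\<close> cannot
  add mass.\<close>

lemma distr_select_mode: "distr unif (count_space UNIV) (select_mode k N Q y) = mode_law y"
proof (rule measure_eqI_countable_prob[symmetric])
  interpret u: prob_space unif by (rule prob_space_unif)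
  interpret m: prob_space "mode_law y" by (rule prob_space_mode_law)
  note sel = select_mode_measurable_mark
  show "prob_space (distr unif (count_space UNIV) (select_mode k N Q y))"
    by (rule u.prob_space_distr[OF sel])
  show "emeasure (mode_law y) {a} \<le> emeasure (distr unif (count_space UNIV) (select_mode k N Q y)) {a}" for a
  proof -
    obtain i where i: "i \<in> mode_indices N" "a = k i"
      using modes by (metis UNIV_I bij_betw_imp_surj_on image_iff)
    let ?I = "{cum_prob k Q (i - 1) y <.. cum_prob k Q i y}"
    have "1 \<le> i" using i by (simp add: mode_indices_def)
    then obtain i' where i': "i = Suc i'" by (cases i) auto
    have I: "?I \<subseteq> {0..1}"
    proof -
      have "0 \<le> cum_prob k Q (i - 1) y" unfolding cum_prob_def mode_prob_def by (intro sum_nonneg) auto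
      with cum_prob_le_1[OF i(1), of y] show ?thesis by auto
    qed
    have "emeasure (mode_law y) {a} = ennreal (mode_prob Q y {a})"
      by (simp add: m.emeasure_eq_measure measure_mode_law)
    also have "mode_prob Q y {a} = cum_prob k Q i y - cum_prob k Q (i - 1) y"
      by (simp add: cum_prob_def i' i)
    also have "ennreal \<dots> = emeasure lborel ?I"
      using cum_prob_mono[of "i - 1" i y] by simp
    also have "\<dots> = emeasure unif ?I"
      using I by (subst emeasure_unif) (auto simp: Int_absorb1)
    also have "\<dots> \<le> emeasure unif (select_mode k N Q y -` {a} \<inter> space unif)"
    proof (rule emeasure_mono)
      show "?I \<subseteq> select_mode k N Q y -` {a} \<inter> space unif"
        using select_mode_eq[OF i(1), of y] i(2) by (auto simp del: One_nat_def)
      show "select_mode k N Q y -` {a} \<inter> space unif \<in> u.events"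
        by (rule measurable_sets[OF sel]) simp
    qed
    also have "\<dots> = emeasure (distr unif (count_space UNIV) (select_mode k N Q y)) {a}"
      by (rule emeasure_distr[OF sel, symmetric]) auto
    finally show ?thesis .
  qed
qed (simp_all add: prob_space_mode_law sets_mode_law)

text \<open>The link from uniform marks to the kernel: averaging over the mark while keeping the
  position \<open>snd y\<close> reproduces integration against \<open>Q y\<close>.\<close>

lemma integral_select_mode:
  fixes g :: "'k \<times> real \<Rightarrow> real"
  assumes "g \<in> borel_measurable state_space"
  shows "(\<integral>u. g (select_mode k N Q y u, snd y) \<partial>unif) = (\<integral>z. g z \<partial>Q y)"
proof -
  note sel = select_mode_measurable_mark
  have "(\<integral>z. g z \<partial>Q y) = (\<integral>a. g (a, snd y) \<partial>mode_law y)"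
    using integral_Q_eq[OF assms, of "fst y" "snd y"] by simp
  also have "\<dots> = (\<integral>u. g (select_mode k N Q y u, snd y) \<partial>unif)"
    unfolding distr_select_mode[symmetric] by (rule integral_distr[OF sel]) simp
  finally show ?thesis by simp
qed

end

section \<open>Driving noise as a product measure\<close>

abbreviation seq_measure :: "real measure \<Rightarrow> (nat \<Rightarrow> real) measure" where
  "seq_measure D \<equiv> \<Pi>\<^sub>M i\<in>UNIV. D"

text \<open>Gaps are stored instead of jump times, so that all coordinates are independent. Indices
  start at 0: entry \<open>j\<close> belongs to proposal \<open>j + 1\<close>, and for the third
  sequence to acceptance \<open>j + 1\<close>.\<close>

definition noise_measure :: "real \<Rightarrow> ((nat \<Rightarrow> real) \<times> (nat \<Rightarrow> real) \<times> (nat \<Rightarrow> real)) measure" where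
  "noise_measure r = seq_measure (density lborel (exponential_density r)) \<Otimes>\<^sub>M (seq_measure unif \<Otimes>\<^sub>M seq_measure unif)"

abbreviation (input) noise_space :: "((nat \<Rightarrow> real) \<times> (nat \<Rightarrow> real) \<times> (nat \<Rightarrow> real)) measure" where
  "noise_space \<equiv> (\<Pi>\<^sub>M i\<in>UNIV. borel) \<Otimes>\<^sub>M ((\<Pi>\<^sub>M i\<in>UNIV. borel) \<Otimes>\<^sub>M (\<Pi>\<^sub>M i\<in>UNIV. borel))"

lemma sets_noise_measure [measurable_cong]: "sets (noise_measure r) = sets noise_space"
  unfolding noise_measure_def by (intro sets_pair_measure_cong sets_PiM_cong) auto

lemma space_seq [simp]: "space (\<Pi>\<^sub>M i\<in>UNIV. (borel :: real measure)) = UNIV"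
  by (simp add: space_PiM)

lemma prob_space_noise: assumes "0 < r" shows "prob_space (noise_measure r)"
proof -
  interpret A: prob_space "seq_measure (density lborel (exponential_density r))"
    by (intro prob_space_PiM prob_space_exponential_density assms)
  interpret B: prob_space "seq_measure unif" by (intro prob_space_PiM prob_space_unif)
  interpret BB: pair_prob_space "seq_measure unif" "seq_measure unif" ..
  interpret ABB: pair_prob_space "seq_measure (density lborel (exponential_density r))" "seq_measure unif \<Otimes>\<^sub>M seq_measure unif" ..
  show ?thesis unfolding noise_measure_def by (rule ABB.prob_space_axioms)
qed

text \<open>An independent draw put in front of an i.i.d. sequence gives a sequence of the same law.
  Nonnegative integrals allow exchanging the order without integrability.\<close>

lemma nn_integral_seq_Suc:
  assumes "prob_space D" and f: "f \<in> borel_measurable (seq_measure D)"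
  shows "(\<integral>\<^sup>+d. f d \<partial>seq_measure D) = (\<integral>\<^sup>+a. \<integral>\<^sup>+d. f (case_nat a d) \<partial>seq_measure D \<partial>D)"
proof -
  interpret prob_space D by fact
  interpret product_prob_space "\<lambda>_. D" "UNIV :: nat set" by unfold_locales
  interpret S: sequence_space D ..
  have [measurable]: "(\<lambda>(s, \<omega>). case_nat s \<omega>) \<in> D \<Otimes>\<^sub>M seq_measure D \<rightarrow>\<^sub>M seq_measure D"
    unfolding case_prod_beta' by (rule measurable_case_nat') measurable
  have "(\<integral>\<^sup>+d. f d \<partial>seq_measure D) = (\<integral>\<^sup>+z. f (case z of (s, \<omega>) \<Rightarrow> case_nat s \<omega>) \<partial>(D \<Otimes>\<^sub>M seq_measure D))"
    by (subst S.PiM_iter[symmetric], subst nn_integral_distr) (use f in auto)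
  also have "\<dots> = (\<integral>\<^sup>+a. \<integral>\<^sup>+d. f (case_nat a d) \<partial>seq_measure D \<partial>D)"
    by (subst P.nn_integral_fst[symmetric]) (use f in \<open>auto simp: case_prod_beta'\<close>)
  finally show ?thesis .
qed

text \<open>The joint family of the noise is indexed by a sum type; an injective reindexing turns
  the chosen subfamily into a sequence over all natural numbers.\<close>

lemma iid_sequence_distr:
  fixes X :: "'i \<Rightarrow> 'w \<Rightarrow> real" and f :: "nat \<Rightarrow> 'i"
  assumes "prob_space M" "prob_space.indep_vars M (\<lambda>_. borel) X I" and f: "inj f" "range f \<subseteq> I"
    and D: "\<And>j. distr M borel (X (f j)) = D"
  shows "distr M (\<Pi>\<^sub>M j\<in>UNIV. borel) (\<lambda>\<omega> j. X (f j) \<omega>) = seq_measure D"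
proof -
  interpret prob_space M by fact
  have ind: "indep_vars (\<lambda>_. borel) X (range f)" by (rule indep_vars_subset[OF assms(2) f(2)])
  have rv [measurable]: "X i \<in> borel_measurable M" if "i \<in> range f" for i
    using ind that by (auto simp: indep_vars_def)
  have pD: "prob_space D" using D[of 0, symmetric] by (auto intro!: prob_space_distr)
  have setsD: "sets D = sets borel" using D[of 0, symmetric] by simp
  have 1: "distr M (\<Pi>\<^sub>M i\<in>range f. borel) (\<lambda>\<omega>. \<lambda>i\<in>range f. X i \<omega>) = (\<Pi>\<^sub>M i\<in>range f. D)"
    using indep_vars_iff_distr_eq_PiM'[of "range f" X "\<lambda>_. borel"] ind D
    by (auto intro!: PiM_cong)
  have 2: "distr (\<Pi>\<^sub>M i\<in>range f. D) (seq_measure D) (\<lambda>\<omega>. \<lambda>n\<in>UNIV. \<omega> (f n)) = seq_measure D"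
    using distr_PiM_reindex[of "range f" "\<lambda>_. D" f UNIV] pD f by auto
  have "seq_measure D = distr (distr M (\<Pi>\<^sub>M i\<in>range f. borel) (\<lambda>\<omega>. \<lambda>i\<in>range f. X i \<omega>)) (\<Pi>\<^sub>M i\<in>UNIV. borel) (\<lambda>\<omega> n. \<omega> (f n))"
    unfolding 1 by (subst (1) 2[symmetric]) (auto simp: setsD intro!: distr_cong sets_PiM_cong)
  also have "\<dots> = distr M (\<Pi>\<^sub>M j\<in>UNIV. borel) (\<lambda>\<omega> j. X (f j) \<omega>)"
    by (subst distr_distr) (auto intro!: distr_cong measurable_restrict measurable_PiM_single' measurable_component_singleton simp: o_def)
  finally show ?thesis ..
qed

lemma integral_pair_bounded:
  fixes g :: "'a \<times> 'b \<Rightarrow> real"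
  assumes "prob_space A" "prob_space B" and g: "g \<in> borel_measurable (A \<Otimes>\<^sub>M B)" and "\<And>z. \<bar>g z\<bar> \<le> c"
  shows "(\<integral>z. g z \<partial>(A \<Otimes>\<^sub>M B)) = (\<integral>a. \<integral>b. g (a, b) \<partial>B \<partial>A)"
proof -
  interpret A: prob_space A by fact
  interpret B: prob_space B by fact
  interpret pair_prob_space A B ..
  have "integrable (A \<Otimes>\<^sub>M B) g"
    by (rule integrable_const_bound[of _ c]) (use assms in auto)
  from integral_fst'[OF this] show ?thesis by simp
qed

lemma measurable_case_nat_seq [measurable]:
  "a \<in> borel_measurable M \<Longrightarrow> d \<in> M \<rightarrow>\<^sub>M (\<Pi>\<^sub>M i\<in>UNIV. borel) \<Longrightarrow>
    (\<lambda>\<omega>. case_nat (a \<omega>) (d \<omega>)) \<in> M \<rightarrow>\<^sub>M (\<Pi>\<^sub>M i\<in>UNIV. borel :: real measure)"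
  by (rule measurable_case_nat') auto

lemma nn_integral_noise:
  assumes "0 < r" and [measurable]: "f \<in> borel_measurable noise_space"
  shows "(\<integral>\<^sup>+z. f z \<partial>noise_measure r)
    = (\<integral>\<^sup>+d. \<integral>\<^sup>+u. \<integral>\<^sup>+v. f (d, u, v) \<partial>seq_measure unif \<partial>seq_measure unif \<partial>seq_measure (density lborel (exponential_density r)))"
proof -
  let ?D = "density lborel (exponential_density r)"
  interpret A: prob_space "seq_measure ?D"
    by (intro prob_space_PiM prob_space_exponential_density assms)
  interpret B: prob_space "seq_measure unif" by (intro prob_space_PiM prob_space_unif)
  interpret BB: pair_prob_space "seq_measure unif" "seq_measure unif" ..
  have [measurable_cong]: "sets (seq_measure ?D) = sets (\<Pi>\<^sub>M i\<in>UNIV. borel)"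
    "sets (seq_measure unif) = sets (\<Pi>\<^sub>M i\<in>UNIV. borel)"
    by (auto intro!: sets_PiM_cong)
  have f: "f \<in> borel_measurable (seq_measure ?D \<Otimes>\<^sub>M (seq_measure unif \<Otimes>\<^sub>M seq_measure unif))"
    by measurable
  have slice: "(\<lambda>z. f (d, z)) \<in> borel_measurable (seq_measure unif \<Otimes>\<^sub>M seq_measure unif)" for d
    by (rule measurable_compose[OF measurable_Pair1' f]) (simp add: space_PiM)
  have "(\<integral>\<^sup>+z. f z \<partial>noise_measure r)
      = (\<integral>\<^sup>+d. \<integral>\<^sup>+z. f (d, z) \<partial>(seq_measure unif \<Otimes>\<^sub>M seq_measure unif) \<partial>seq_measure ?D)"
    unfolding noise_measure_def by (rule BB.nn_integral_fst[symmetric, OF f])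
  also have "\<dots> = (\<integral>\<^sup>+d. \<integral>\<^sup>+u. \<integral>\<^sup>+v. f (d, u, v) \<partial>seq_measure unif \<partial>seq_measure unif \<partial>seq_measure ?D)"
    by (intro nn_integral_cong B.nn_integral_fst[symmetric] slice)
  finally show ?thesis .
qed

text \<open>Every proposal consumes one gap and one intensity mark, so these two are split off
  together while the mode marks stay untouched. The laws are compared on measurable sets, where
  Fubini moves each fresh coordinate next to its own sequence.\<close>

lemma noise_shift_intensities:
  assumes "0 < r"
  shows "noise_measure r = distr (density lborel (exponential_density r) \<Otimes>\<^sub>M (unif \<Otimes>\<^sub>M noise_measure r)) noise_space
    (\<lambda>z. (case_nat (fst z) (fst (snd (snd z))), case_nat (fst (snd z)) (fst (snd (snd (snd z)))), snd (snd (snd (snd z)))))"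
    (is "_ = distr ?P _ ?g")
proof (rule measure_eqI)
  let ?D = "density lborel (exponential_density r)"
  interpret D: prob_space ?D by (intro prob_space_exponential_density assms)
  interpret U: prob_space unif by (rule prob_space_unif)
  interpret A: prob_space "seq_measure ?D"
    by (intro prob_space_PiM D.prob_space_axioms)
  interpret B: prob_space "seq_measure unif" by (intro prob_space_PiM prob_space_unif)
  interpret N: prob_space "noise_measure r" by (rule prob_space_noise) fact
  interpret UN: pair_prob_space unif "noise_measure r" ..
  interpret AU: pair_sigma_finite "seq_measure ?D" unif ..
  have [measurable_cong]: "sets (seq_measure ?D) = sets (\<Pi>\<^sub>M i\<in>UNIV. borel)"
    "sets (seq_measure unif) = sets (\<Pi>\<^sub>M i\<in>UNIV. borel)"
    by (auto intro!: sets_PiM_cong)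
  have g [measurable]: "?g \<in> ?P \<rightarrow>\<^sub>M noise_space" by measurable
  fix S assume "S \<in> sets (noise_measure r)"
  then have [measurable]: "S \<in> sets noise_space" by (simp add: sets_noise_measure)
  have "emeasure (distr ?P noise_space ?g) S = (\<integral>\<^sup>+z. indicator S (?g z) \<partial>?P)"
    using nn_integral_indicator[of S "distr ?P noise_space ?g"] nn_integral_distr[OF g, of "indicator S"] by simp
  also have "\<dots> = (\<integral>\<^sup>+a. \<integral>\<^sup>+b. \<integral>\<^sup>+z. indicator S (?g (a, b, z)) \<partial>noise_measure r \<partial>unif \<partial>?D)"
  proof -
    have S: "indicator S \<in> borel_measurable noise_space" by measurable
    have "(\<lambda>z. ?g (a, z)) \<in> unif \<Otimes>\<^sub>M noise_measure r \<rightarrow>\<^sub>M noise_space" for a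
      unfolding fst_conv snd_conv by measurable
    from measurable_compose[OF this S]
    have "(\<integral>\<^sup>+z. indicator S (?g (a, z)) \<partial>(unif \<Otimes>\<^sub>M noise_measure r))
      = (\<integral>\<^sup>+b. \<integral>\<^sup>+z. indicator S (?g (a, b, z)) \<partial>noise_measure r \<partial>unif)" for a
      by (rule N.nn_integral_fst[symmetric])
    then show ?thesis
      using UN.nn_integral_fst[OF measurable_compose[OF g S], symmetric] by simp
  qed
  also have "\<dots> = (\<integral>\<^sup>+a. \<integral>\<^sup>+b. \<integral>\<^sup>+d. \<integral>\<^sup>+u. \<integral>\<^sup>+v. indicator S (case_nat a d, case_nat b u, v)
      \<partial>seq_measure unif \<partial>seq_measure unif \<partial>seq_measure ?D \<partial>unif \<partial>?D)"
    by (intro nn_integral_cong, subst nn_integral_noise[OF assms]) auto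
  also have "\<dots> = (\<integral>\<^sup>+a. \<integral>\<^sup>+d. \<integral>\<^sup>+b. \<integral>\<^sup>+u. \<integral>\<^sup>+v. indicator S (case_nat a d, case_nat b u, v)
      \<partial>seq_measure unif \<partial>seq_measure unif \<partial>unif \<partial>seq_measure ?D \<partial>?D)"
    by (intro nn_integral_cong AU.Fubini') measurable
  also have "\<dots> = (\<integral>\<^sup>+a. \<integral>\<^sup>+d. \<integral>\<^sup>+u. \<integral>\<^sup>+v. indicator S (case_nat a d, u, v)
      \<partial>seq_measure unif \<partial>seq_measure unif \<partial>seq_measure ?D \<partial>?D)"
    by (intro nn_integral_cong nn_integral_seq_Suc[symmetric, OF prob_space_unif]) measurable
  also have "\<dots> = (\<integral>\<^sup>+d. \<integral>\<^sup>+u. \<integral>\<^sup>+v. indicator S (d, u, v)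
      \<partial>seq_measure unif \<partial>seq_measure unif \<partial>seq_measure ?D)"
    by (rule nn_integral_seq_Suc[symmetric, OF D.prob_space_axioms]) measurable
  also have "\<dots> = emeasure (noise_measure r) S"
    by (subst nn_integral_noise[symmetric, OF assms]) auto
  finally show "emeasure (noise_measure r) S = emeasure (distr ?P noise_space ?g) S" ..
qed (simp add: sets_noise_measure)

text \<open>A mode mark is consumed only by an accepted proposal, hence a separate splitting,
  applied after acceptance has been decided.\<close>

lemma noise_shift_modes:
  assumes "0 < r"
  shows "noise_measure r = distr (unif \<Otimes>\<^sub>M noise_measure r) noise_space
    (\<lambda>z. (fst (snd z), fst (snd (snd z)), case_nat (fst z) (snd (snd (snd z)))))"
    (is "_ = distr ?P _ ?g")
proof (rule measure_eqI)
  let ?D = "density lborel (exponential_density r)"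
  interpret D: prob_space ?D by (intro prob_space_exponential_density assms)
  interpret U: prob_space unif by (rule prob_space_unif)
  interpret A: prob_space "seq_measure ?D"
    by (intro prob_space_PiM D.prob_space_axioms)
  interpret B: prob_space "seq_measure unif" by (intro prob_space_PiM prob_space_unif)
  interpret N: prob_space "noise_measure r" by (rule prob_space_noise) fact
  interpret AU: pair_sigma_finite "seq_measure ?D" unif ..
  interpret BU: pair_sigma_finite "seq_measure unif" unif ..
  have [measurable_cong]: "sets (seq_measure ?D) = sets (\<Pi>\<^sub>M i\<in>UNIV. borel)"
    "sets (seq_measure unif) = sets (\<Pi>\<^sub>M i\<in>UNIV. borel)"
    by (auto intro!: sets_PiM_cong)
  have g [measurable]: "?g \<in> ?P \<rightarrow>\<^sub>M noise_space" by measurable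
  fix S assume "S \<in> sets (noise_measure r)"
  then have [measurable]: "S \<in> sets noise_space" by (simp add: sets_noise_measure)
  have "emeasure (distr ?P noise_space ?g) S = (\<integral>\<^sup>+z. indicator S (?g z) \<partial>?P)"
    using nn_integral_indicator[of S "distr ?P noise_space ?g"] nn_integral_distr[OF g, of "indicator S"] by simp
  also have "\<dots> = (\<integral>\<^sup>+c. \<integral>\<^sup>+z. indicator S (?g (c, z)) \<partial>noise_measure r \<partial>unif)"
    by (subst N.nn_integral_fst[symmetric]) auto
  also have "\<dots> = (\<integral>\<^sup>+c. \<integral>\<^sup>+d. \<integral>\<^sup>+u. \<integral>\<^sup>+v. indicator S (d, u, case_nat c v)
      \<partial>seq_measure unif \<partial>seq_measure unif \<partial>seq_measure ?D \<partial>unif)"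
    by (intro nn_integral_cong, subst nn_integral_noise[OF assms]) auto
  also have "\<dots> = (\<integral>\<^sup>+d. \<integral>\<^sup>+c. \<integral>\<^sup>+u. \<integral>\<^sup>+v. indicator S (d, u, case_nat c v)
      \<partial>seq_measure unif \<partial>seq_measure unif \<partial>unif \<partial>seq_measure ?D)"
    by (intro AU.Fubini') measurable
  also have "\<dots> = (\<integral>\<^sup>+d. \<integral>\<^sup>+u. \<integral>\<^sup>+c. \<integral>\<^sup>+v. indicator S (d, u, case_nat c v)
      \<partial>seq_measure unif \<partial>unif \<partial>seq_measure unif \<partial>seq_measure ?D)"
    by (intro nn_integral_cong BU.Fubini') measurable
  also have "\<dots> = (\<integral>\<^sup>+d. \<integral>\<^sup>+u. \<integral>\<^sup>+v. indicator S (d, u, v)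
      \<partial>seq_measure unif \<partial>seq_measure unif \<partial>seq_measure ?D)"
    by (intro nn_integral_cong nn_integral_seq_Suc[symmetric, OF prob_space_unif]) measurable
  also have "\<dots> = emeasure (noise_measure r) S"
    by (subst nn_integral_noise[symmetric, OF assms]) auto
  finally show "emeasure (noise_measure r) S = emeasure (distr ?P noise_space ?g) S" ..
qed (simp add: sets_noise_measure)

lemma integral_noise_shift_intensities:
  fixes g :: "(nat \<Rightarrow> real) \<times> (nat \<Rightarrow> real) \<times> (nat \<Rightarrow> real) \<Rightarrow> real"
  assumes "0 < r" and g [measurable]: "g \<in> borel_measurable noise_space" and bd: "\<And>z. \<bar>g z\<bar> \<le> c"
  shows "(\<integral>z. g z \<partial>noise_measure r) = (\<integral>a. \<integral>b. \<integral>(d, u, v). g (case_nat a d, case_nat b u, v)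
     \<partial>noise_measure r \<partial>unif \<partial>density lborel (exponential_density r))"
proof -
  let ?D = "density lborel (exponential_density r)"
  let ?h = "\<lambda>z. (case_nat (fst z) (fst (snd (snd z))), case_nat (fst (snd z)) (fst (snd (snd (snd z)))), snd (snd (snd (snd z))))"
  interpret D: prob_space ?D by (intro prob_space_exponential_density assms)
  interpret U: prob_space unif by (rule prob_space_unif)
  interpret N: prob_space "noise_measure r" by (rule prob_space_noise) fact
  interpret UN: pair_prob_space unif "noise_measure r" ..
  have "(\<integral>z. g z \<partial>noise_measure r) = (\<integral>z. g (?h z) \<partial>(?D \<Otimes>\<^sub>M (unif \<Otimes>\<^sub>M noise_measure r)))"
    by (subst noise_shift_intensities[OF assms(1)], subst integral_distr) auto
  also have "\<dots> = (\<integral>a. \<integral>z. g (?h (a, z)) \<partial>(unif \<Otimes>\<^sub>M noise_measure r) \<partial>?D)"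
    by (rule integral_pair_bounded[OF D.prob_space_axioms UN.prob_space_axioms, where c=c]) (use bd in auto)
  also have "\<dots> = (\<integral>a. \<integral>b. \<integral>z. g (?h (a, b, z)) \<partial>noise_measure r \<partial>unif \<partial>?D)"
    by (intro Bochner_Integration.integral_cong[OF refl]
        integral_pair_bounded[OF U.prob_space_axioms N.prob_space_axioms, where c=c]) (use bd in auto)
  finally show ?thesis by (simp add: case_prod_beta')
qed

lemma integral_noise_shift_modes:
  fixes g :: "(nat \<Rightarrow> real) \<times> (nat \<Rightarrow> real) \<times> (nat \<Rightarrow> real) \<Rightarrow> real"
  assumes "0 < r" and g [measurable]: "g \<in> borel_measurable noise_space" and bd: "\<And>z. \<bar>g z\<bar> \<le> c"
  shows "(\<integral>z. g z \<partial>noise_measure r) = (\<integral>b. \<integral>(d, u, v). g (d, u, case_nat b v) \<partial>noise_measure r \<partial>unif)"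
proof -
  let ?h = "\<lambda>z. (fst (snd z), fst (snd (snd z)), case_nat (fst z) (snd (snd (snd z))))"
  interpret U: prob_space unif by (rule prob_space_unif)
  interpret N: prob_space "noise_measure r" by (rule prob_space_noise) fact
  have "(\<integral>z. g z \<partial>noise_measure r) = (\<integral>z. g (?h z) \<partial>(unif \<Otimes>\<^sub>M noise_measure r))"
    by (subst noise_shift_modes[OF assms(1)], subst integral_distr) auto
  also have "\<dots> = (\<integral>b. \<integral>z. g (?h (b, z)) \<partial>noise_measure r \<partial>unif)"
    by (rule integral_pair_bounded[OF U.prob_space_axioms N.prob_space_axioms, where c=c]) (use bd in auto)
  finally show ?thesis by (simp add: case_prod_beta')
qed


text \<open>Each sequence has its i.i.d. law by reindexing. The product structure is obtained in two
  stages, intensity marks against mode marks and then gaps against that pair, by grouping the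
  independent family into disjoint blocks.\<close>

lemma noise_law:
  assumes "prob_space M" and noise: "thinning_data M r Np Ts U V"
  shows "distr M noise_space (\<lambda>\<omega>. (\<lambda>j. Ts (Suc j) \<omega> - Ts j \<omega>, \<lambda>j. U (Suc j) \<omega>, \<lambda>j. V (Suc j) \<omega>)) = noise_measure r"
    and "(\<lambda>\<omega>. (\<lambda>j. Ts (Suc j) \<omega> - Ts j \<omega>, \<lambda>j. U (Suc j) \<omega>, \<lambda>j. V (Suc j) \<omega>)) \<in> M \<rightarrow>\<^sub>M noise_space"
proof -
  interpret prob_space M by fact
  define X where "X = (\<lambda>i. case i of Inl k \<Rightarrow> (\<lambda>\<omega>. Ts k \<omega> - Ts (k - 1) \<omega>)
      | Inr (Inl k) \<Rightarrow> U k | Inr (Inr k) \<Rightarrow> V k)"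
  define I :: "(nat + nat + nat) set" where "I = {1..} <+> ({1..} <+> {1..})"
  define seqs where "seqs = (\<Pi>\<^sub>M i\<in>UNIV::nat set. borel :: real measure)"
  let ?A = "Inl ` {1..} :: (nat + nat + nat) set"
  let ?B = "(Inr \<circ> Inl) ` {1..} :: (nat + nat + nat) set"
  let ?C = "(Inr \<circ> Inr) ` {1..} :: (nat + nat + nat) set"
  have ind: "indep_vars (\<lambda>_. borel) X I"
    using noise unfolding thinning_data_def X_def I_def by blast
  have sub: "?A \<subseteq> I" "?B \<subseteq> I" "?C \<subseteq> I" "?B \<union> ?C \<subseteq> I" by (auto simp: I_def)
  have seq: "distr M seqs (\<lambda>\<omega> j. X (f j) \<omega>) = seq_measure D" "(\<lambda>\<omega> j. X (f j) \<omega>) \<in> M \<rightarrow>\<^sub>M seqs"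
    if "inj f" "range f \<subseteq> I" "\<And>j. distr M borel (X (f j)) = D" for f :: "nat \<Rightarrow> _" and D
  proof -
    show "distr M seqs (\<lambda>\<omega> j. X (f j) \<omega>) = seq_measure D"
      unfolding seqs_def by (rule iid_sequence_distr[OF assms(1) ind that])
    have "X (f j) \<in> borel_measurable M" for j
      using ind that by (auto simp: indep_vars_def)
    then show "(\<lambda>\<omega> j. X (f j) \<omega>) \<in> M \<rightarrow>\<^sub>M seqs"
      unfolding seqs_def by (intro measurable_PiM_single') auto
  qed
  have Ts: "distr M borel (\<lambda>\<omega>. Ts (Suc j) \<omega> - Ts j \<omega>) = density lborel (exponential_density r)" for j
  proof -
    have "distributed M lborel (\<lambda>\<omega>. Ts (Suc j) \<omega> - Ts (Suc j - 1) \<omega>) (exponential_density r)"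
      using noise unfolding thinning_data_def poisson_process_def by (metis One_nat_def le_add1 plus_1_eq_Suc)
    then show ?thesis by (simp add: distributed_def cong: distr_cong)
  qed
  let ?d = "\<lambda>\<omega> j. Ts (Suc j) \<omega> - Ts j \<omega>" and ?u = "\<lambda>\<omega> j. U (Suc j) \<omega>" and ?v = "\<lambda>\<omega> j. V (Suc j) \<omega>"
  have d: "distr M seqs ?d = seq_measure (density lborel (exponential_density r))" "?d \<in> M \<rightarrow>\<^sub>M seqs"
    using seq[of "\<lambda>j. Inl (Suc j)"] Ts by (auto simp: X_def I_def inj_def)
  have u: "distr M seqs ?u = seq_measure unif" "?u \<in> M \<rightarrow>\<^sub>M seqs"
    using seq[of "\<lambda>j. Inr (Inl (Suc j))"] noise by (auto simp: X_def I_def inj_def thinning_data_def)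
  have v: "distr M seqs ?v = seq_measure unif" "?v \<in> M \<rightarrow>\<^sub>M seqs"
    using seq[of "\<lambda>j. Inr (Inr (Suc j))"] noise by (auto simp: X_def I_def inj_def thinning_data_def)
  have shift: "(\<lambda>x j. x (f (Suc j))) \<in> (\<Pi>\<^sub>M i\<in>K. borel) \<rightarrow>\<^sub>M seqs" if "\<And>j. f (Suc j) \<in> K" for f :: "nat \<Rightarrow> nat + nat + nat" and K
    unfolding seqs_def using that by (intro measurable_PiM_single' measurable_component_singleton) auto
  \<comment> \<open>Independence of the two restricted blocks is transported along the maps that
    forget the sum-type index.\<close>
  have ind_uv: "indep_var seqs ?u seqs ?v"
  proof -
    have "indep_var (\<Pi>\<^sub>M i\<in>?B. borel) (\<lambda>\<omega>. restrict (\<lambda>i. X i \<omega>) ?B) (\<Pi>\<^sub>M i\<in>?C. borel) (\<lambda>\<omega>. restrict (\<lambda>i. X i \<omega>) ?C)"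
      using sub by (intro indep_var_restrict[OF ind]) auto
    from indep_var_compose[OF this shift[of "\<lambda>j. Inr (Inl j)"] shift[of "\<lambda>j. Inr (Inr j)"]]
    show ?thesis by (simp add: o_def X_def image_iff)
  qed
  have d_uv: "distr M (seqs \<Otimes>\<^sub>M (seqs \<Otimes>\<^sub>M seqs)) (\<lambda>\<omega>. (?d \<omega>, ?u \<omega>, ?v \<omega>))
     = distr M seqs ?d \<Otimes>\<^sub>M distr M (seqs \<Otimes>\<^sub>M seqs) (\<lambda>\<omega>. (?u \<omega>, ?v \<omega>))"
  proof -
    let ?P = "\<Pi>\<^sub>M i\<in>?A. borel :: real measure" and ?R = "\<Pi>\<^sub>M i\<in>?B \<union> ?C. borel :: real measure"
    let ?f = "\<lambda>\<omega>. restrict (\<lambda>i. X i \<omega>) ?A" and ?g = "\<lambda>\<omega>. restrict (\<lambda>i. X i \<omega>) (?B \<union> ?C)"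
    let ?p = "\<lambda>x j. x (Inl (Suc j)) :: real" and ?q = "\<lambda>x. (\<lambda>j. x (Inr (Inl (Suc j))), \<lambda>j. x (Inr (Inr (Suc j)))) :: (nat \<Rightarrow> real) \<times> (nat \<Rightarrow> real)"
    have "indep_var ?P ?f ?R ?g"
      using sub by (intro indep_var_restrict[OF ind]) auto
    then have f: "?f \<in> M \<rightarrow>\<^sub>M ?P" and g: "?g \<in> M \<rightarrow>\<^sub>M ?R"
      and fg: "distr M ?P ?f \<Otimes>\<^sub>M distr M ?R ?g = distr M (?P \<Otimes>\<^sub>M ?R) (\<lambda>\<omega>. (?f \<omega>, ?g \<omega>))"
      by (auto simp: indep_var_distribution_eq)
    have p: "?p \<in> ?P \<rightarrow>\<^sub>M seqs" by (rule shift) auto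
    have q: "?q \<in> ?R \<rightarrow>\<^sub>M seqs \<Otimes>\<^sub>M seqs" by (intro measurable_Pair shift) auto
    have dp: "distr M seqs ?d = distr (distr M ?P ?f) seqs ?p"
      by (subst distr_distr[OF p f]) (simp add: o_def X_def)
    have uvq: "distr M (seqs \<Otimes>\<^sub>M seqs) (\<lambda>\<omega>. (?u \<omega>, ?v \<omega>)) = distr (distr M ?R ?g) (seqs \<Otimes>\<^sub>M seqs) ?q"
      by (subst distr_distr[OF q g]) (simp add: o_def X_def image_iff)
    have pq: "(\<lambda>(x, y). (?p x, ?q y)) \<in> ?P \<Otimes>\<^sub>M ?R \<rightarrow>\<^sub>M seqs \<Otimes>\<^sub>M (seqs \<Otimes>\<^sub>M seqs)"
      unfolding case_prod_beta'
      by (intro measurable_Pair measurable_compose[OF measurable_fst p] measurable_compose[OF measurable_snd q, simplified]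
          measurable_compose[OF measurable_snd shift]) auto
    have sf: "sigma_finite_measure (distr (distr M ?R ?g) (seqs \<Otimes>\<^sub>M seqs) ?q)"
      unfolding uvq[symmetric]
      by (intro prob_space_imp_sigma_finite prob_space_distr measurable_Pair u v)
    have "distr M seqs ?d \<Otimes>\<^sub>M distr M (seqs \<Otimes>\<^sub>M seqs) (\<lambda>\<omega>. (?u \<omega>, ?v \<omega>))
      = distr (distr M ?P ?f \<Otimes>\<^sub>M distr M ?R ?g) (seqs \<Otimes>\<^sub>M (seqs \<Otimes>\<^sub>M seqs)) (\<lambda>(x, y). (?p x, ?q y))"
      unfolding dp uvq using p q by (intro pair_measure_distr sf) auto
    also have "\<dots> = distr M (seqs \<Otimes>\<^sub>M (seqs \<Otimes>\<^sub>M seqs)) ((\<lambda>(x, y). (?p x, ?q y)) \<circ> (\<lambda>\<omega>. (?f \<omega>, ?g \<omega>)))"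
      unfolding fg by (rule distr_distr[OF pq]) (intro measurable_Pair f g)
    finally show ?thesis by (simp add: o_def X_def image_iff)
  qed
  have "distr M (seqs \<Otimes>\<^sub>M (seqs \<Otimes>\<^sub>M seqs)) (\<lambda>\<omega>. (?d \<omega>, ?u \<omega>, ?v \<omega>))
     = distr M seqs ?d \<Otimes>\<^sub>M (distr M seqs ?u \<Otimes>\<^sub>M distr M seqs ?v)"
    using ind_uv unfolding d_uv by (simp add: indep_var_distribution_eq)
  then show "distr M noise_space (\<lambda>\<omega>. (?d \<omega>, ?u \<omega>, ?v \<omega>)) = noise_measure r"
    unfolding noise_measure_def d u v by (simp add: seqs_def)
  show "(\<lambda>\<omega>. (?d \<omega>, ?u \<omega>, ?v \<omega>)) \<in> M \<rightarrow>\<^sub>M noise_space"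
    using d(2) u(2) v(2) unfolding seqs_def by (intro measurable_Pair)
qed

lemma measurable_shift_seq:
  assumes "d \<in> M \<rightarrow>\<^sub>M (\<Pi>\<^sub>M i\<in>UNIV. borel)"
  shows "(\<lambda>\<omega> j. d \<omega> (Suc j)) \<in> M \<rightarrow>\<^sub>M (\<Pi>\<^sub>M i\<in>UNIV::nat set. borel :: real measure)"
proof (rule measurable_PiM_single')
  show "(\<lambda>\<omega>. d \<omega> (Suc j)) \<in> M \<rightarrow>\<^sub>M borel" for j
    by (rule measurable_compose[OF assms measurable_component_singleton]) simp
qed auto

section \<open>The thinning construction\<close>

context pdmp_modes begin

text \<open>The value at time \<open>t\<close> of the thinned process if fewer than \<open>n\<close> proposals occur before \<open>t\<close>, and \<open>0\<close>
  otherwise. A rejected proposal consumes no mark \<open>v\<close>.\<close>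

primrec thinned_value :: "('k \<Rightarrow> real \<Rightarrow> real \<Rightarrow> real) \<Rightarrow> ('k \<times> real \<Rightarrow> real) \<Rightarrow> nat \<Rightarrow> real \<Rightarrow> real \<Rightarrow> 'k \<times> real \<Rightarrow>
   (nat \<Rightarrow> real) \<Rightarrow> (nat \<Rightarrow> real) \<Rightarrow> (nat \<Rightarrow> real) \<Rightarrow> real" where
  "thinned_value \<Phi> F 0 t s x d u v = 0"
| "thinned_value \<Phi> F (Suc n) t s x d u v =
     (if t < d 0 then F (flow_map \<Phi> (s + t) x)
      else if u 0 * lamstar \<le> lam (flow_map \<Phi> (s + d 0) x)
      then thinned_value \<Phi> F n (t - d 0) 0
             (select_mode k N Q (flow_map \<Phi> (s + d 0) x) (v 0), snd (flow_map \<Phi> (s + d 0) x))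
             (\<lambda>j. d (Suc j)) (\<lambda>j. u (Suc j)) (\<lambda>j. v (Suc j))
      else thinned_value \<Phi> F n (t - d 0) (s + d 0) x (\<lambda>j. d (Suc j)) (\<lambda>j. u (Suc j)) v)"

lemma select_mode_measurable' [measurable]:
  "f \<in> M \<rightarrow>\<^sub>M state_space \<Longrightarrow> g \<in> borel_measurable M \<Longrightarrow>
    (\<lambda>\<omega>. select_mode k N Q (f \<omega>) (g \<omega>)) \<in> M \<rightarrow>\<^sub>M count_space UNIV"
  by (drule (1) measurable_Pair, drule measurable_compose[OF _ select_mode_measurable]) (simp only: fst_conv snd_conv)

lemma thinned_value_bound:
  assumes "\<And>y. \<bar>F y\<bar> \<le> b"
  shows "\<bar>thinned_value \<Phi> F n t s x d u v\<bar> \<le> b"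
proof -
  have "0 \<le> b" using assms[of undefined] by linarith
  then show ?thesis by (induction n arbitrary: t s x d u v) (simp_all add: assms)
qed

lemma thinned_value_measurable:
  assumes \<Phi>: "measurable_flow \<Phi>" and F [measurable]: "F \<in> borel_measurable state_space"
    and "a \<in> borel_measurable M" "b \<in> borel_measurable M" "X \<in> M \<rightarrow>\<^sub>M state_space"
    and "d \<in> M \<rightarrow>\<^sub>M (\<Pi>\<^sub>M i\<in>UNIV. borel)" "u \<in> M \<rightarrow>\<^sub>M (\<Pi>\<^sub>M i\<in>UNIV. borel)" "v \<in> M \<rightarrow>\<^sub>M (\<Pi>\<^sub>M i\<in>UNIV. borel)"
  shows "(\<lambda>\<omega>. thinned_value \<Phi> F n (a \<omega>) (b \<omega>) (X \<omega>) (d \<omega>) (u \<omega>) (v \<omega>)) \<in> borel_measurable M"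
  using assms(3-)
proof (induction n arbitrary: a b X d u v)
  case (Suc n)
  note [measurable] = Suc.prems
  have c: "(\<lambda>\<omega>. w \<omega> 0) \<in> borel_measurable M" if "w \<in> M \<rightarrow>\<^sub>M (\<Pi>\<^sub>M i\<in>UNIV. borel)" for w :: "_ \<Rightarrow> nat \<Rightarrow> real"
    by (rule measurable_compose[OF that measurable_component_singleton]) simp
  note [measurable] = measurable_shift_seq[OF Suc.prems(4)] measurable_shift_seq[OF Suc.prems(5)] measurable_shift_seq[OF Suc.prems(6)]
  note [measurable] = c[OF Suc.prems(4)] c[OF Suc.prems(5)] c[OF Suc.prems(6)]
  have [measurable]: "(\<lambda>\<omega>. flow_map \<Phi> (b \<omega> + a \<omega>) (X \<omega>)) \<in> M \<rightarrow>\<^sub>M state_space"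
     "(\<lambda>\<omega>. flow_map \<Phi> (b \<omega> + d \<omega> 0) (X \<omega>)) \<in> M \<rightarrow>\<^sub>M state_space"
    by (rule measurable_flow_map[OF \<Phi>]; measurable)+
  have [measurable]: "(\<lambda>\<omega>. thinned_value \<Phi> F n (a \<omega> - d \<omega> 0) 0
             (select_mode k N Q (flow_map \<Phi> (b \<omega> + d \<omega> 0) (X \<omega>)) (v \<omega> 0), snd (flow_map \<Phi> (b \<omega> + d \<omega> 0) (X \<omega>)))
             (\<lambda>j. d \<omega> (Suc j)) (\<lambda>j. u \<omega> (Suc j)) (\<lambda>j. v \<omega> (Suc j))) \<in> borel_measurable M"
    "(\<lambda>\<omega>. thinned_value \<Phi> F n (a \<omega> - d \<omega> 0) (b \<omega> + d \<omega> 0) (X \<omega>)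
             (\<lambda>j. d \<omega> (Suc j)) (\<lambda>j. u \<omega> (Suc j)) (v \<omega>)) \<in> borel_measurable M"
    by (rule Suc.IH; measurable)+
  show ?case unfolding thinned_value.simps by measurable
qed simp

text \<open>A uniform mark accepts with probability \<open>lam y / lamstar\<close>, a number in
  [0,1] because \<open>lamstar\<close> dominates \<open>lam\<close>.\<close>

lemma integral_acceptance:
  fixes A B :: real
  shows "(\<integral>w. (if w * lamstar \<le> lam y then A else B) \<partial>unif) = (lam y * A + (lamstar - lam y) * B) / lamstar"
proof -
  interpret U: prob_space unif by (rule prob_space_unif)
  let ?p = "lam y / lamstar"
  have p: "0 \<le> ?p" "?p \<le> 1" using lam_bounds[of y] lamstar_pos by (auto simp: divide_simps)
  have iff: "w * lamstar \<le> lam y \<longleftrightarrow> w \<in> {..?p}" for w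
    using lamstar_pos by (simp add: field_simps)
  have "emeasure unif {..?p} = emeasure lborel {0..?p}"
    using p by (subst emeasure_unif) (auto intro!: arg_cong2[where f=emeasure])
  then have m: "measure unif {..?p} = ?p" using p by (simp add: measure_def)
  have "(\<integral>w. (if w * lamstar \<le> lam y then A else B) \<partial>unif) = (\<integral>w. B + indicator {..?p} w * (A - B) \<partial>unif)"
    unfolding iff by (intro Bochner_Integration.integral_cong) (auto simp: indicator_def)
  also have "\<dots> = B + ?p * (A - B)"
  proof -
    have "integrable unif (indicator {..?p} :: real \<Rightarrow> real)"
      by (rule U.integrable_const_bound[of _ 1]) (auto simp: indicator_def)
    then show ?thesis using m by (simp add: U.prob_space del: divide_const_simps)
  qed
  finally show ?thesis using lamstar_pos by (simp add: field_simps)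
qed

text \<open>For a proposal at time \<open>a\<close> the density
  \<open>lamstar * exp (- lamstar * a)\<close>, the factor \<open>exp (- lamstar * (t - a))\<close>
  and the division by \<open>lamstar\<close> multiply to \<open>exp (- lamstar * t)\<close>,
  independently of \<open>a\<close>. Thus the discount turns the exponential average into a plain
  integral.\<close>

lemma integral_first_proposal:
  assumes "0 \<le> t" and h: "set_integrable lborel {0..t} h"
    and m: "h \<in> borel_measurable borel"
  shows "(\<integral>a. (if t < a then c else exp (- lamstar * (t - a)) * h a / lamstar) \<partial>density lborel (exponential_density lamstar))
     = exp (- lamstar * t) * (c + (LINT a:{0..t}|lborel. h a))"
proof -
  let ?D = "density lborel (exponential_density lamstar)"
  let ?g = "\<lambda>a. if t < a then c else exp (- lamstar * (t - a)) * h a / lamstar"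
  interpret D: prob_space ?D by (intro prob_space_exponential_density lamstar_pos)
  have "distributed ?D lborel (\<lambda>x. x) (exponential_density lamstar)"
    unfolding distributed_def by (auto simp: distr_id2 intro!: exponential_density_nonneg lamstar_pos)
  from D.exponential_distributedD_gt[OF this assms(1)]
  have P: "measure ?D {t<..} = exp (- lamstar * t)"
    by (simp add: greaterThan_def mult.commute lamstar_pos)
  have int1: "integrable ?D (indicator {t<..} :: real \<Rightarrow> real)"
    by (rule D.integrable_const_bound[of _ 1]) (auto simp: indicator_def)
  have e: "exponential_density lamstar a * (indicator {..t} a * (exp (- lamstar * (t - a)) * h a / lamstar))
     = exp (- lamstar * t) * (indicator {0..t} a *\<^sub>R h a)" for a
    using lamstar_pos assms(1)
    by (auto simp: exponential_density_def indicator_def right_diff_distrib exp_diff exp_minus field_simps)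
  have int2: "integrable ?D (\<lambda>a. indicator {..t} a * (exp (- lamstar * (t - a)) * h a / lamstar))"
  proof (subst integrable_density)
    show "integrable lborel (\<lambda>a. exponential_density lamstar a *\<^sub>R (indicator {..t} a * (exp (- lamstar * (t - a)) * h a / lamstar)))"
      unfolding real_scaleR_def e using h by (auto simp: set_integrable_def)
  qed (use m exponential_density_nonneg[OF lamstar_pos] in auto)
  have "(\<integral>a. ?g a \<partial>?D) = (\<integral>a. indicator {t<..} a * c + indicator {..t} a * (exp (- lamstar * (t - a)) * h a / lamstar) \<partial>?D)"
    by (intro Bochner_Integration.integral_cong) (auto simp: indicator_def)
  also have "\<dots> = exp (- lamstar * t) * c + (\<integral>a. indicator {..t} a * (exp (- lamstar * (t - a)) * h a / lamstar) \<partial>?D)"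
    using int1 int2 P by (subst Bochner_Integration.integral_add) auto
  also have "(\<integral>a. indicator {..t} a * (exp (- lamstar * (t - a)) * h a / lamstar) \<partial>?D)
      = exp (- lamstar * t) * (LINT a:{0..t}|lborel. h a)"
  proof (subst integral_density)
    show "(\<integral>a. exponential_density lamstar a *\<^sub>R (indicator {..t} a * (exp (- lamstar * (t - a)) * h a / lamstar)) \<partial>lborel)
       = exp (- lamstar * t) * (LINT a:{0..t}|lborel. h a)"
      unfolding real_scaleR_def e by (simp add: set_lebesgue_integral_def)
  qed (use m exponential_density_nonneg[OF lamstar_pos] in auto)
  finally show ?thesis by (simp add: distrib_left)
qed

text \<open>Conditioning on the first gap and intensity mark reproduces the recursion of
  \<open>picard\<close>. Time, age and state are generalized, since a rejection changes the first
  two and an acceptance all three.\<close>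

lemma integral_thinned_value:
  assumes \<Phi>: "measurable_flow \<Phi>" and F: "F \<in> borel_measurable state_space" "\<And>y. \<bar>F y\<bar> \<le> b"
    and "0 \<le> t" "0 \<le> s"
  shows "(\<integral>(d, u, v). thinned_value \<Phi> F n t s x d u v \<partial>noise_measure lamstar)
     = exp (- lamstar * t) * picard \<Phi> (terminal_weight \<Phi> F) n t s x"
  using assms(4-)
proof (induction n arbitrary: t s x)
  case (Suc n)
  let ?W = "noise_measure lamstar" and ?D = "density lborel (exponential_density lamstar)"
  let ?P = "picard \<Phi> (terminal_weight \<Phi> F) n"
  interpret W: prob_space ?W by (rule prob_space_noise[OF lamstar_pos])
  interpret U: prob_space unif by (rule prob_space_unif)
  have tw: "measurable_weight (terminal_weight \<Phi> F)" "weight_bounded t b (terminal_weight \<Phi> F)"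
    using terminal_weight_measurable[OF \<Phi> F(1)] F(2) by (auto simp: weight_bounded_def terminal_weight_def)
  note P = picard_measurable[OF \<Phi> tw(1), of n] picard_weight_bounded[OF \<Phi> tw, of n]
  note meas = thinned_value_measurable[OF \<Phi> F(1)]
  let ?y = "\<lambda>a. flow_map \<Phi> (s + a) x"
  \<comment> \<open>After an acceptance the mark \<open>v 0\<close> is split off; with the new mode
    fixed the induction hypothesis applies to the remaining noise, and averaging over the mark gives
    \<open>Q\<close>.\<close>
  have acc: "(\<integral>(d, u, v). thinned_value \<Phi> F n (t - a) 0 (select_mode k N Q (?y a) (v 0), snd (?y a)) d u (\<lambda>j. v (Suc j)) \<partial>?W)
    = exp (- lamstar * (t - a)) * (\<integral>z. ?P (t - a) 0 z \<partial>Q (?y a))" if "a \<le> t" for a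
  proof -
    have m: "(\<lambda>(d, u, v). thinned_value \<Phi> F n (t - a) 0 (select_mode k N Q (?y a) (v 0), snd (?y a)) d u (\<lambda>j. v (Suc j))) \<in> borel_measurable noise_space"
    proof -
      note [measurable] = measurable_shift_seq[of "\<lambda>z. snd (snd z)" noise_space]
      have [measurable]: "(\<lambda>z. snd (snd z) 0) \<in> borel_measurable noise_space"
        by (intro measurable_compose[OF measurable_snd] measurable_compose[OF measurable_snd measurable_component_singleton]) simp
      have [measurable]: "(\<lambda>z. flow_map \<Phi> (s + a) x) \<in> noise_space \<rightarrow>\<^sub>M state_space"
        by (rule measurable_const) (simp add: space_state_space)
      show ?thesis unfolding case_prod_beta'
        by (rule meas; measurable)
    qed
    have "(\<integral>(d, u, v). thinned_value \<Phi> F n (t - a) 0 (select_mode k N Q (?y a) (v 0), snd (?y a)) d u (\<lambda>j. v (Suc j)) \<partial>?W)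
      = (\<integral>w. \<integral>(d, u, v). thinned_value \<Phi> F n (t - a) 0 (select_mode k N Q (?y a) w, snd (?y a)) d u v \<partial>?W \<partial>unif)"
      by (subst integral_noise_shift_modes[OF lamstar_pos m, where c=b])
         (auto simp: thinned_value_bound[OF F(2)])
    also have "\<dots> = (\<integral>w. exp (- lamstar * (t - a)) * ?P (t - a) 0 (select_mode k N Q (?y a) w, snd (?y a)) \<partial>unif)"
      using that by (subst Suc.IH) auto
    also have "\<dots> = exp (- lamstar * (t - a)) * (\<integral>z. ?P (t - a) 0 z \<partial>Q (?y a))"
      by (simp, subst integral_select_mode[symmetric])
        (auto intro!: measurable_weightD[OF P(1)])
    finally show ?thesis .
  qed
  have "(\<integral>(d, u, v). thinned_value \<Phi> F (Suc n) t s x d u v \<partial>?W)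
    = (\<integral>a. \<integral>w. \<integral>(d, u, v). thinned_value \<Phi> F (Suc n) t s x (case_nat a d) (case_nat w u) v \<partial>?W \<partial>unif \<partial>?D)"
    by (subst integral_noise_shift_intensities[OF lamstar_pos, where c=b])
       (auto simp: case_prod_beta' thinned_value_bound[OF F(2)] space_state_space simp del: thinned_value.simps intro!: meas)
  also have "\<dots> = (\<integral>a. (if t < a then F (?y t) else exp (- lamstar * (t - a)) * jump_integrand \<Phi> ?P t s x a / lamstar) \<partial>?D)"
  proof (rule integral_cong_AE)
    show "AE a in ?D. (\<integral>w. \<integral>(d, u, v). thinned_value \<Phi> F (Suc n) t s x (case_nat a d) (case_nat w u) v \<partial>?W \<partial>unif) =
      (if t < a then F (?y t) else exp (- lamstar * (t - a)) * jump_integrand \<Phi> ?P t s x a / lamstar)"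
    proof -
      \<comment> \<open>The density vanishes on negative gaps; only for \<open>0 \<le> a\<close> is
        the age \<open>s + a\<close> known to be nonnegative, as the induction hypothesis
        requires.\<close>
      have "AE a in ?D. 0 \<le> a"
        by (subst AE_density) (auto simp: exponential_density_def)
      then show ?thesis
      proof eventually_elim
        case (elim a)
        show ?case
        proof (cases "t < a")
          case True
          then show ?thesis by (simp add: case_prod_beta' W.prob_space U.prob_space)
        next
          case False
          have "(\<integral>w. \<integral>(d, u, v). thinned_value \<Phi> F (Suc n) t s x (case_nat a d) (case_nat w u) v \<partial>?W \<partial>unif)
            = (\<integral>w. (if w * lamstar \<le> lam (?y a) then exp (- lamstar * (t - a)) * (\<integral>z. ?P (t - a) 0 z \<partial>Q (?y a))
                else exp (- lamstar * (t - a)) * ?P (t - a) (s + a) x) \<partial>unif)"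
          proof (intro Bochner_Integration.integral_cong refl)
            fix w
            show "(\<integral>(d, u, v). thinned_value \<Phi> F (Suc n) t s x (case_nat a d) (case_nat w u) v \<partial>?W)
              = (if w * lamstar \<le> lam (?y a) then exp (- lamstar * (t - a)) * (\<integral>z. ?P (t - a) 0 z \<partial>Q (?y a))
                else exp (- lamstar * (t - a)) * ?P (t - a) (s + a) x)"
              using False acc[of a] Suc.IH[of "t - a" "s + a" x] elim Suc.prems by simp
          qed
          also have "\<dots> = exp (- lamstar * (t - a)) * jump_integrand \<Phi> ?P t s x a / lamstar"
            by (subst integral_acceptance) (simp add: jump_integrand_def algebra_simps)
          finally show ?thesis using False by simp
        qed
      qed
    qed
    have D_sets [measurable_cong]: "sets ?D = sets borel" by simp
    show "(\<lambda>a. if t < a then F (?y t) else exp (- lamstar * (t - a)) * jump_integrand \<Phi> ?P t s x a / lamstar) \<in> borel_measurable ?D"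
    proof -
      have [measurable]: "(\<lambda>a. jump_integrand \<Phi> ?P t s x a) \<in> borel_measurable borel"
        by (rule jump_integrand_measurable[OF \<Phi> P(1)]) (simp_all add: space_state_space)
      show ?thesis by measurable
    qed
    have "(\<lambda>z. thinned_value \<Phi> F (Suc n) t s x (case_nat (fst (fst z)) (fst (snd z))) (case_nat (snd (fst z)) (fst (snd (snd z)))) (snd (snd (snd z))))
       \<in> borel_measurable ((?D \<Otimes>\<^sub>M unif) \<Otimes>\<^sub>M ?W)"
    proof -
      have [measurable]: "(\<lambda>z. x) \<in> ((?D \<Otimes>\<^sub>M unif) \<Otimes>\<^sub>M ?W) \<rightarrow>\<^sub>M state_space"
        by (rule measurable_const) (simp add: space_state_space)
      show ?thesis by (rule meas; measurable)
    qed
    then have "(\<lambda>z. \<integral>(d, u, v). thinned_value \<Phi> F (Suc n) t s x (case_nat (fst z) d) (case_nat (snd z) u) v \<partial>?W) \<in> borel_measurable (?D \<Otimes>\<^sub>M unif)"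
      using W.borel_measurable_lebesgue_integral[of "\<lambda>z w. thinned_value \<Phi> F (Suc n) t s x (case_nat (fst z) (fst w)) (case_nat (snd z) (fst (snd w))) (snd (snd w))" "?D \<Otimes>\<^sub>M unif"]
      unfolding case_prod_beta' by simp
    then show "(\<lambda>a. \<integral>w. \<integral>(d, u, v). thinned_value \<Phi> F (Suc n) t s x (case_nat a d) (case_nat w u) v \<partial>?W \<partial>unif) \<in> borel_measurable ?D"
      using U.borel_measurable_lebesgue_integral[of "\<lambda>a w. \<integral>(d, u, v). thinned_value \<Phi> F (Suc n) t s x (case_nat a d) (case_nat w u) v \<partial>?W" ?D]
      unfolding case_prod_beta' by simp
  qed
  also have "\<dots> = exp (- lamstar * t) * (F (?y t) + (LINT a:{0..t}|lborel. jump_integrand \<Phi> ?P t s x a))"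
  proof (rule integral_first_proposal)
    show "set_integrable lborel {0..t} (jump_integrand \<Phi> ?P t s x)"
      by (rule jump_integrand_integrable[OF \<Phi> P]) (use Suc.prems in auto)
    show "jump_integrand \<Phi> ?P t s x \<in> borel_measurable borel"
      by (rule jump_integrand_measurable[OF \<Phi> P(1)]) (simp_all add: space_state_space)
  qed fact
  also have "\<dots> = exp (- lamstar * t) * picard \<Phi> (terminal_weight \<Phi> F) (Suc n) t s x"
    by (simp add: jump_op_def terminal_weight_def)
  finally show ?case .
qed (simp add: case_prod_beta')

end


section \<open>Identification of the truncated value with the thinned path\<close>

context pdmp_modes begin

context
  fixes \<Phi> :: "'k \<Rightarrow> real \<Rightarrow> real \<Rightarrow> real" and x :: "'k \<times> real" and Ts U V :: "nat \<Rightarrow> real"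
begin

text \<open>The state after \<open>j\<close> proposals: the number of accepted ones, the index of the last accepted one, and
  the state reached by it.\<close>

primrec after_proposals :: "nat \<Rightarrow> nat \<times> nat \<times> ('k \<times> real)" where
  "after_proposals 0 = (0, 0, x)"
| "after_proposals (Suc j) =
     (let (m, i, y) = after_proposals j; z = flow_map \<Phi> (Ts (Suc j) - Ts i) y
      in if U (Suc j) * lamstar \<le> lam z
         then (Suc m, Suc j, (select_mode k N Q z (V (Suc m)), snd z)) else (m, i, y))"

abbreviation thinned :: "nat \<Rightarrow> enat \<times> 'k \<times> real" where
  "thinned \<equiv> thinning k N Q lam lamstar \<Phi> x Ts U V"

lemma fst_thinning_Suc:
  "fst (thinned (Suc n)) = (let (\<tau>, y) = thinned n in
     Inf {enat j |j. \<tau> < enat j \<and> U j * lamstar \<le> lam (flow_map \<Phi> (Ts j - Ts (the_enat \<tau>)) y)})"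
  by (simp add: Let_def flow_map_def case_prod_beta)

lemma thinning_mono: "m \<le> n \<Longrightarrow> fst (thinned m) \<le> fst (thinned n)"
proof (rule lift_Suc_mono_le)
  show "fst (thinned n) \<le> fst (thinned (Suc n))" for n
    unfolding fst_thinning_Suc by (auto simp: Let_def case_prod_beta intro!: Inf_greatest)
qed

text \<open>The invariant linking the recursion over acceptances with the one over proposals. Its
  last part, that all proposals since the last accepted one were rejected, locates the next infimum
  in \<open>thinning\<close>.\<close>

lemma thinning_after_proposals:
  "after_proposals j = (m, i, y) \<Longrightarrow> i \<le> j \<and> thinned m = (enat i, y) \<and>
    (\<forall>l. i < l \<and> l \<le> j \<longrightarrow> \<not> U l * lamstar \<le> lam (flow_map \<Phi> (Ts l - Ts i) y))"
proof (induction j arbitrary: m i y)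
  case 0
  then show ?case by (auto simp: zero_enat_def)
next
  case (Suc j)
  obtain m0 i0 y0 where eq: "after_proposals j = (m0, i0, y0)" by (cases "after_proposals j")
  note IH = Suc.IH[OF eq]
  let ?z = "flow_map \<Phi> (Ts (Suc j) - Ts i0) y0"
  show ?case
  proof (cases "U (Suc j) * lamstar \<le> lam ?z")
    case False
    then have "m = m0" "i = i0" "y = y0" using Suc.prems eq by (auto simp: Let_def)
    with IH False show ?thesis by (auto simp: le_Suc_eq)
  next
    case True
    then have e: "m = Suc m0" "i = Suc j" "y = (select_mode k N Q ?z (V (Suc m0)), snd ?z)"
      using Suc.prems eq by (auto simp: Let_def)
    \<comment> \<open>The infimum is attained at \<open>Suc j\<close>: this index passes the test,
      and by the invariant none between \<open>i0\<close> and \<open>j\<close> does.\<close>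
    have I: "Inf {enat l |l. enat i0 < enat l \<and> U l * lamstar \<le> lam (fst y0, \<Phi> (fst y0) (Ts l - Ts i0) (snd y0))} = enat (Suc j)"
    proof (rule antisym)
      show "Inf {enat l |l. enat i0 < enat l \<and> U l * lamstar \<le> lam (fst y0, \<Phi> (fst y0) (Ts l - Ts i0) (snd y0))} \<le> enat (Suc j)"
        using True IH by (intro Inf_lower) (auto simp: flow_map_def)
      show "enat (Suc j) \<le> Inf {enat l |l. enat i0 < enat l \<and> U l * lamstar \<le> lam (fst y0, \<Phi> (fst y0) (Ts l - Ts i0) (snd y0))}"
        using IH by (intro Inf_greatest) (auto simp: flow_map_def not_less_eq_eq[symmetric])
    qed
    have "thinned m = (enat i, y)"
      unfolding e using IH I by (simp add: Let_def case_prod_beta flow_map_def)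
    then show ?thesis using e by auto
  qed
qed

lemma jump_time_mono: "mono Ts \<Longrightarrow> \<tau> \<le> \<tau>' \<Longrightarrow> jump_time Ts \<tau> \<le> jump_time Ts \<tau>'"
  by (cases \<tau>; cases \<tau>') (auto simp: jump_time_def dest: monoD)

text \<open>If \<open>J\<close> proposals occur up to \<open>t\<close>, the number of jumps up to
  \<open>t\<close> is the number \<open>m\<close> of acceptances among them; monotonicity of the
  accepted indices excludes every smaller candidate.\<close>

lemma thinning_path_eq:
  assumes "mono Ts" "Ts J \<le> t" "t < Ts (Suc J)" and eq: "after_proposals J = (m, i, y)"
  shows "thinning_path k N Q lam lamstar \<Phi> x Ts U V t = flow_map \<Phi> (t - Ts i) y"
proof -
  note A = thinning_after_proposals[OF eq]
  have 1: "jump_time Ts (fst (thinned m)) \<le> ereal t"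
    using A monoD[OF assms(1), of i J] assms(2) by (auto simp: jump_time_def)
  \<comment> \<open>The next acceptance comes after \<open>J\<close> or never; in the latter case
    its index and its jump time are infinite.\<close>
  have "enat (Suc J) \<le> fst (thinned (Suc m))"
    using A unfolding fst_thinning_Suc
    by (auto simp: Let_def not_less_eq_eq[symmetric] intro!: Inf_greatest)
  from jump_time_mono[OF assms(1) this]
  have 2: "ereal t < jump_time Ts (fst (thinned (Suc m)))"
    using assms(3) by (auto simp: jump_time_def elim: less_le_trans[rotated])
  have "(LEAST n. jump_time Ts (fst (thinned n)) \<le> ereal t \<and> ereal t < jump_time Ts (fst (thinned (Suc n)))) = m"
  proof (rule Least_equality)
    show "m \<le> n" if n: "jump_time Ts (fst (thinned n)) \<le> ereal t \<and> ereal t < jump_time Ts (fst (thinned (Suc n)))" for n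
    proof (rule ccontr)
      assume "\<not> m \<le> n"
      then have "jump_time Ts (fst (thinned (Suc n))) \<le> jump_time Ts (fst (thinned m))"
        by (intro jump_time_mono[OF assms(1)] thinning_mono) auto
      with n 1 show False by (meson leD order_trans)
    qed
  qed (use 1 2 in blast)
  then show ?thesis
    unfolding thinning_path_def Let_def using A by (simp add: flow_map_def case_prod_beta)
qed

text \<open>The arguments describe a restart after \<open>j\<close> proposals: the age is
  \<open>Ts j - Ts i\<close>, gaps and intensity marks are shifted by \<open>j\<close>, but mode
  marks by the number \<open>m\<close> of acceptances. The condition \<open>J - j < n\<close> keeps
  the truncation from being reached.\<close>

lemma thinned_value_after_proposals:
  assumes "strict_mono Ts" "Ts J \<le> t" "t < Ts (Suc J)" "j \<le> J" "J - j < n" "after_proposals j = (m, i, y)"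
    "after_proposals J = (m', i', y')"
  shows "thinned_value \<Phi> F n (t - Ts j) (Ts j - Ts i) y (\<lambda>l. Ts (Suc (j + l)) - Ts (j + l)) (\<lambda>l. U (Suc (j + l))) (\<lambda>l. V (Suc (m + l)))
     = F (flow_map \<Phi> (t - Ts i') y')"
  using assms(4-6)
proof (induction n arbitrary: j m i y)
  case (Suc n)
  have *: "(\<lambda>l. g (j + Suc l)) = (\<lambda>l. g (Suc j + l))" for g :: "nat \<Rightarrow> real" by simp
  show ?case
  proof (cases "j = J")
    case True
    then show ?thesis using assms(3,7) Suc.prems by (auto simp: algebra_simps)
  next
    case False
    then have jJ: "Suc j \<le> J" using Suc.prems by simp
    have le: "Ts (Suc j) \<le> t" using strict_mono_less_eq[OF assms(1), of "Suc j" J] jJ assms(2) by linarith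
    let ?z = "flow_map \<Phi> (Ts (Suc j) - Ts i) y"
    have n: "J - Suc j < n" using jJ Suc.prems by simp
    note IH = Suc.IH[OF jJ n]
    show ?thesis
    proof (cases "U (Suc j) * lamstar \<le> lam ?z")
      case True
      then have a: "after_proposals (Suc j) = (Suc m, Suc j, (select_mode k N Q ?z (V (Suc m)), snd ?z))"
        using Suc.prems by (simp add: Let_def)
      show ?thesis using IH[OF a] le True Suc.prems by (simp add: algebra_simps)
    next
      case False
      then have a: "after_proposals (Suc j) = (m, i, y)"
        using Suc.prems by (simp add: Let_def)
      show ?thesis using IH[OF a] le False Suc.prems by (simp add: algebra_simps)
    qed
  qed
qed simp

text \<open>For one noise path with diverging jump times only finitely many proposals,
  \<open>J\<close> of them, precede \<open>t\<close>; once \<open>n\<close> exceeds \<open>J\<close>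
  the truncation has no effect.\<close>

lemma thinned_value_eventually_path:
  assumes "strict_mono Ts" "Ts 0 = 0" "filterlim Ts at_top sequentially" "0 \<le> t"
  shows "\<forall>\<^sub>F n in sequentially. thinned_value \<Phi> F n t 0 x (\<lambda>j. Ts (Suc j) - Ts j) (\<lambda>j. U (Suc j)) (\<lambda>j. V (Suc j))
     = F (thinning_path k N Q lam lamstar \<Phi> x Ts U V t)"
proof -
  obtain n where n: "t < Ts n"
    using assms(3) by (auto simp: filterlim_at_top_dense eventually_sequentially)
  define J where "J = (GREATEST j. Ts j \<le> t)"
  have bd: "Ts j \<le> t \<Longrightarrow> j \<le> n" for j
    using n strict_mono_less_eq[OF assms(1), of n j] by (meson le_cases less_le_trans not_less)
  have J: "Ts J \<le> t" unfolding J_def by (rule GreatestI_nat[of _ 0 n]) (use assms bd in auto)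
  have J': "t < Ts (Suc J)"
  proof (rule ccontr)
    assume "\<not> t < Ts (Suc J)"
    then have "Suc J \<le> J" unfolding J_def using bd by (intro Greatest_le_nat[of _ _ n]) (auto simp: J_def)
    then show False by simp
  qed
  obtain m i y where eq: "after_proposals J = (m, i, y)" by (cases "after_proposals J")
  have "thinned_value \<Phi> F n t 0 x (\<lambda>j. Ts (Suc j) - Ts j) (\<lambda>j. U (Suc j)) (\<lambda>j. V (Suc j))
     = F (thinning_path k N Q lam lamstar \<Phi> x Ts U V t)" if "J < n" for n
    using thinned_value_after_proposals[OF assms(1) J J' _ _ _ eq, of 0 n 0 0 x F] that assms(2)
      thinning_path_eq[OF strict_mono_mono[OF assms(1)] J J' eq] by simp
  then show ?thesis by (auto simp: eventually_sequentially intro!: exI[of _ "Suc J"])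
qed

end

text \<open>Rewrites the infimum through \<open>LEAST\<close>, which preserves measurability; the
  empty set of candidates yields \<infinity>.\<close>

lemma Inf_enat_eq_Least:
  "Inf {enat j |j. P j} = (if \<exists>j. P j then enat (LEAST j. P j) else \<infinity>)"
proof (cases "\<exists>j. P j")
  case True
  then have "Inf {enat j |j. P j} = enat (LEAST j. P j)"
    by (intro antisym Inf_lower Inf_greatest) (auto intro: LeastI2 Least_le simp: LeastI_ex)
  with True show ?thesis by simp
next
  case False
  then have "{enat j |j. P j} = {}" by auto
  then show ?thesis using False by (simp only: Inf_empty top_enat_def if_False)
qed

lemma measurable_Inf_enat:
  assumes [measurable]: "\<And>j. Measurable.pred M (\<lambda>\<omega>. P \<omega> j)"
  shows "(\<lambda>\<omega>. Inf {enat j |j. P \<omega> j}) \<in> M \<rightarrow>\<^sub>M count_space UNIV"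
  unfolding Inf_enat_eq_Least by measurable

lemma thinning_measurable:
  fixes x :: "'k \<times> real"
  assumes \<Phi>: "measurable_flow \<Phi>"
    and Ts: "\<And>j. (\<lambda>\<omega>. Ts j \<omega>) \<in> borel_measurable M"
    and U: "\<And>j. (\<lambda>\<omega>. U (Suc j) \<omega>) \<in> borel_measurable M" and V: "\<And>j. (\<lambda>\<omega>. V (Suc j) \<omega>) \<in> borel_measurable M"
  defines "th \<equiv> \<lambda>n \<omega>. thinning k N Q lam lamstar \<Phi> x (\<lambda>j. Ts j \<omega>) (\<lambda>j. U j \<omega>) (\<lambda>j. V j \<omega>) n"
  shows "(\<lambda>\<omega>. fst (th n \<omega>)) \<in> M \<rightarrow>\<^sub>M count_space UNIV" "(\<lambda>\<omega>. snd (th n \<omega>)) \<in> M \<rightarrow>\<^sub>M state_space"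
proof (induction n)
  case 0
  { case 1 show ?case by (simp add: th_def) }
  { case 2 show ?case by (simp add: th_def space_state_space) }
next
  case (Suc n)
  have [measurable]: "(\<lambda>\<omega>. fst (th n \<omega>)) \<in> M \<rightarrow>\<^sub>M count_space UNIV" "(\<lambda>\<omega>. snd (th n \<omega>)) \<in> M \<rightarrow>\<^sub>M state_space"
    by fact+
  note [measurable] = Ts U V
  have TsA: "(\<lambda>\<omega>. Ts (the_enat (g \<omega>)) \<omega>) \<in> borel_measurable M" if [measurable]: "g \<in> M \<rightarrow>\<^sub>M count_space UNIV" for g
    by (rule measurable_compose_countable[OF Ts]) measurable
  let ?P = "\<lambda>\<omega> j. fst (th n \<omega>) < enat j \<and> U j \<omega> * lamstar \<le> lam (flow_map \<Phi> (Ts j \<omega> - Ts (the_enat (fst (th n \<omega>))) \<omega>) (snd (th n \<omega>)))"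
  have [measurable]: "(\<lambda>\<omega>. flow_map \<Phi> (Ts j \<omega> - Ts (the_enat (fst (th n \<omega>))) \<omega>) (snd (th n \<omega>))) \<in> M \<rightarrow>\<^sub>M state_space" for j
    by (rule measurable_flow_map[OF \<Phi>], rule borel_measurable_diff[OF Ts TsA]) measurable
  have P: "Measurable.pred M (\<lambda>\<omega>. ?P \<omega> j)" for j
  \<comment> \<open>Measurability is known for \<open>U (Suc l)\<close> but not for
    \<open>U 0\<close>; the index 0 is never a candidate, since no index lies below it.\<close>
  proof (cases j)
    case (Suc l)
    show ?thesis unfolding Suc by measurable
  qed (simp add: enat_0)
  have "fst (th (Suc n) \<omega>) = Inf {enat j |j. ?P \<omega> j}" for \<omega>
    unfolding th_def fst_thinning_Suc by (simp add: Let_def case_prod_beta)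
  then have first [measurable]: "(\<lambda>\<omega>. fst (th (Suc n) \<omega>)) \<in> M \<rightarrow>\<^sub>M count_space UNIV"
    using measurable_Inf_enat[of ?P M, OF P] by simp
  let ?z = "\<lambda>\<omega>. flow_map \<Phi> (Ts (the_enat (fst (th (Suc n) \<omega>))) \<omega> - Ts (the_enat (fst (th n \<omega>))) \<omega>) (snd (th n \<omega>))"
  have [measurable]: "?z \<in> M \<rightarrow>\<^sub>M state_space"
    by (rule measurable_flow_map[OF \<Phi>], rule borel_measurable_diff[OF TsA TsA]) measurable
  have snd_eq: "snd (th (Suc n) \<omega>) = (select_mode k N Q (?z \<omega>) (V (Suc n) \<omega>), snd (?z \<omega>))" for \<omega>
    by (simp add: th_def Let_def case_prod_beta flow_map_def)
  { case 1 show ?case by (rule first) }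
  { case 2 show ?case unfolding snd_eq by measurable }
qed

lemma thinning_path_measurable:
  assumes \<Phi>: "measurable_flow \<Phi>"
    and Ts: "\<And>j. (\<lambda>\<omega>. Ts j \<omega>) \<in> borel_measurable M"
    and U: "\<And>j. (\<lambda>\<omega>. U (Suc j) \<omega>) \<in> borel_measurable M" and V: "\<And>j. (\<lambda>\<omega>. V (Suc j) \<omega>) \<in> borel_measurable M"
  shows "(\<lambda>\<omega>. thinning_path k N Q lam lamstar \<Phi> x (\<lambda>j. Ts j \<omega>) (\<lambda>j. U j \<omega>) (\<lambda>j. V j \<omega>) t) \<in> M \<rightarrow>\<^sub>M state_space"
proof -
  define th where "th n \<omega> = thinning k N Q lam lamstar \<Phi> x (\<lambda>j. Ts j \<omega>) (\<lambda>j. U j \<omega>) (\<lambda>j. V j \<omega>) n" for n \<omega>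
  have th [measurable]: "(\<lambda>\<omega>. fst (th n \<omega>)) \<in> M \<rightarrow>\<^sub>M count_space UNIV" "(\<lambda>\<omega>. snd (th n \<omega>)) \<in> M \<rightarrow>\<^sub>M state_space" for n
    unfolding th_def by (rule thinning_measurable; fact assms)+
  note [measurable] = Ts
  have TsA: "(\<lambda>\<omega>. Ts (the_enat (g \<omega>)) \<omega>) \<in> borel_measurable M" if [measurable]: "g \<in> M \<rightarrow>\<^sub>M count_space UNIV" for g
    by (rule measurable_compose_countable[OF Ts]) measurable
  have jt [measurable]: "(\<lambda>\<omega>. jump_time (\<lambda>j. Ts j \<omega>) (fst (th n \<omega>))) \<in> borel_measurable M" for n
    unfolding jump_time_def by measurable
  define n where "n \<omega> = (LEAST n. jump_time (\<lambda>j. Ts j \<omega>) (fst (th n \<omega>)) \<le> ereal t \<and> ereal t < jump_time (\<lambda>j. Ts j \<omega>) (fst (th (Suc n) \<omega>)))" for \<omega>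
  have n: "n \<in> M \<rightarrow>\<^sub>M count_space UNIV" unfolding n_def by measurable
  have "thinning_path k N Q lam lamstar \<Phi> x (\<lambda>j. Ts j \<omega>) (\<lambda>j. U j \<omega>) (\<lambda>j. V j \<omega>) t
     = flow_map \<Phi> (t - Ts (the_enat (fst (th (n \<omega>) \<omega>))) \<omega>) (snd (th (n \<omega>) \<omega>))" for \<omega>
    unfolding thinning_path_def Let_def th_def n_def by (simp add: case_prod_beta flow_map_def)
  moreover have "(\<lambda>\<omega>. flow_map \<Phi> (t - Ts (the_enat (fst (th (n \<omega>) \<omega>))) \<omega>) (snd (th (n \<omega>) \<omega>))) \<in> M \<rightarrow>\<^sub>M state_space"
  proof (rule measurable_compose_countable[OF _ n, where f="\<lambda>n \<omega>. flow_map \<Phi> (t - Ts (the_enat (fst (th n \<omega>))) \<omega>) (snd (th n \<omega>))"])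
    show "(\<lambda>\<omega>. flow_map \<Phi> (t - Ts (the_enat (fst (th i \<omega>))) \<omega>) (snd (th i \<omega>))) \<in> M \<rightarrow>\<^sub>M state_space" for i
      by (rule measurable_flow_map[OF \<Phi>], rule borel_measurable_diff[OF _ TsA]) measurable
  qed
  ultimately show ?thesis by simp
qed

end

text \<open>The absolute value keeps the exponential bounded by 1 everywhere, although
  \<open>X\<close> is positive only almost surely. Strictness comes from this positivity.\<close>

lemma exponential_laplace_less_1:
  assumes "0 < r" "prob_space M" and X: "distributed M lborel X (exponential_density r)"
  shows "(\<integral>\<omega>. exp (- \<bar>X \<omega>\<bar>) \<partial>M) < 1" "AE \<omega> in M. 0 < X \<omega>"
proof -
  interpret prob_space M by fact
  have [measurable]: "X \<in> borel_measurable M" using distributed_measurable[OF X] by simp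
  have "AE a in density lborel (exponential_density r). 0 < a"
  proof (subst AE_density)
    have "AE a in lborel. a \<noteq> (0::real)" by (rule AE_lborel_singleton)
    then show "AE a in lborel. 0 < ennreal (exponential_density r a) \<longrightarrow> 0 < a"
      by eventually_elim (auto simp: exponential_density_def)
  qed simp
  then have "AE a in distr M lborel X. 0 < a" using X unfolding distributed_def by metis
  then show pos: "AE \<omega> in M. 0 < X \<omega>" by (subst (asm) AE_distr_iff) auto
  have "(\<integral>\<omega>. exp (- \<bar>X \<omega>\<bar>) \<partial>M) < (\<integral>\<omega>. 1 \<partial>M)"
  proof (rule integral_less_AE_space)
    show "integrable M (\<lambda>\<omega>. exp (- \<bar>X \<omega>\<bar>))" by (rule integrable_const_bound[of _ 1]) auto
    show "AE \<omega> in M. exp (- \<bar>X \<omega>\<bar>) < 1" using pos by eventually_elim auto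
    show "emeasure M (space M) \<noteq> 0" by (simp add: emeasure_space_1)
  qed auto
  then show "(\<integral>\<omega>. exp (- \<bar>X \<omega>\<bar>) \<partial>M) < 1" by (simp add: prob_space)
qed

text \<open>All gaps are positive almost surely, which gives strict monotonicity. Divergence follows
  since the Laplace transform of the sum of \<open>n\<close> independent gaps is
  \<open>c ^ n\<close> with \<open>c < 1\<close>.\<close>

lemma poisson_jump_times_AE:
  assumes "0 < r" and pM: "prob_space M" and P: "poisson_process M r Np Ts"
  shows "AE \<omega> in M. strict_mono (\<lambda>j. Ts j \<omega>) \<and> Ts 0 \<omega> = 0 \<and> filterlim (\<lambda>j. Ts j \<omega>) at_top sequentially"
proof -
  interpret prob_space M by fact
  define X where "X j \<omega> = Ts (Suc j) \<omega> - Ts j \<omega>" for j \<omega>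
  have dist: "distributed M lborel (X j) (exponential_density r)" for j
  proof -
    have "distributed M lborel (\<lambda>\<omega>. Ts (Suc j) \<omega> - Ts (Suc j - 1) \<omega>) (exponential_density r)"
      using P unfolding poisson_process_def by (metis One_nat_def le_add1 plus_1_eq_Suc)
    then show ?thesis by (simp add: X_def[abs_def])
  qed
  have [measurable]: "X j \<in> borel_measurable M" for j using distributed_measurable[OF dist, of j] by simp
  define c where "c = (\<integral>\<omega>. exp (- \<bar>X 0 \<omega>\<bar>) \<partial>M)"
  have c: "(\<integral>\<omega>. exp (- \<bar>X j \<omega>\<bar>) \<partial>M) = c" for j
  proof -
    have "distr M lborel (X j) = distr M lborel (X 0)" using dist by (simp add: distributed_def)
    then have "integral\<^sup>L (distr M lborel (X j)) (\<lambda>a. exp (- \<bar>a\<bar>)) = integral\<^sup>L (distr M lborel (X 0)) (\<lambda>a. exp (- \<bar>a\<bar>))" by simp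
    then show ?thesis unfolding c_def by (subst (asm) (1 2) integral_distr) auto
  qed
  have c01: "0 \<le> c" "c < 1"
    using exponential_laplace_less_1(1)[OF assms(1,2) dist[of 0]] by (auto simp: c_def)
  have ind: "indep_vars (\<lambda>_. borel) (\<lambda>k \<omega>. exp (- \<bar>X (k - 1) \<omega>\<bar>)) {1..}"
  proof -
    have "indep_vars (\<lambda>_. borel) (\<lambda>k \<omega>. Ts k \<omega> - Ts (k - 1) \<omega>) {1..}"
      using P by (simp add: poisson_process_def)
    then have "indep_vars (\<lambda>_. borel) (\<lambda>k \<omega>. exp (- \<bar>Ts k \<omega> - Ts (k - 1) \<omega>\<bar>)) {1..}"
      by (rule indep_vars_compose2) auto
    then show ?thesis
      by (rule indep_vars_cong[THEN iffD1, rotated -1]) (auto simp: X_def)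
  qed
  have prodc: "(\<integral>\<omega>. (\<Prod>k=1..n. exp (- \<bar>X (k - 1) \<omega>\<bar>)) \<partial>M) = c ^ n" and
    prodi: "integrable M (\<lambda>\<omega>. (\<Prod>k=1..n. exp (- \<bar>X (k - 1) \<omega>\<bar>)))" for n
  proof -
    have i: "integrable M (\<lambda>\<omega>. exp (- \<bar>X j \<omega>\<bar>))" for j by (rule integrable_const_bound[of _ 1]) auto
    have "indep_vars (\<lambda>_. borel) (\<lambda>k \<omega>. exp (- \<bar>X (k - 1) \<omega>\<bar>)) {1..n}"
      by (rule indep_vars_subset[OF ind]) auto
    from indep_vars_lebesgue_integral[OF _ this i] indep_vars_integrable[OF _ this i]
    show "(\<integral>\<omega>. (\<Prod>k=1..n. exp (- \<bar>X (k - 1) \<omega>\<bar>)) \<partial>M) = c ^ n"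
      "integrable M (\<lambda>\<omega>. (\<Prod>k=1..n. exp (- \<bar>X (k - 1) \<omega>\<bar>)))" by (auto simp: c)
  qed
  have pos: "AE \<omega> in M. \<forall>j. 0 < X j \<omega>"
    using exponential_laplace_less_1(2)[OF assms(1,2) dist] by (simp add: AE_all_countable)
  have "AE \<omega> in M. \<exists>n. real B < (\<Sum>k=1..n. \<bar>X (k - 1) \<omega>\<bar>)" for B :: nat
  proof -
    define A where "A = {\<omega> \<in> space M. \<forall>n. (\<Sum>k=1..n. \<bar>X (k - 1) \<omega>\<bar>) \<le> real B}"
    have [measurable]: "A \<in> events" unfolding A_def by measurable
    \<comment> \<open>Chernoff's bound: on \<open>A\<close> every partial sum is at most
      \<open>B\<close>, so \<open>exp B\<close> times the product of the factors is at least 1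
      there. Letting \<open>n\<close> grow gives probability 0.\<close>
    have "prob A \<le> exp B * c ^ n" for n
    proof -
      have "prob A = (\<integral>\<omega>. indicator A \<omega> \<partial>M)" by simp
      also have "\<dots> \<le> (\<integral>\<omega>. exp B * (\<Prod>k=1..n. exp (- \<bar>X (k - 1) \<omega>\<bar>)) \<partial>M)"
      proof (rule integral_mono)
        show "integrable M (indicator A :: _ \<Rightarrow> real)" by (rule integrable_const_bound[of _ 1]) (auto simp: indicator_def)
        show "integrable M (\<lambda>\<omega>. exp (real B) * (\<Prod>k=1..n. exp (- \<bar>X (k - 1) \<omega>\<bar>)))" using prodi by simp
        fix \<omega> assume "\<omega> \<in> space M"
        have "exp B * (\<Prod>k=1..n. exp (- \<bar>X (k - 1) \<omega>\<bar>)) = exp (B - (\<Sum>k=1..n. \<bar>X (k - 1) \<omega>\<bar>))"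
          by (simp add: exp_diff exp_sum sum_negf exp_minus divide_inverse prod_inversef[symmetric])
        then show "indicator A \<omega> \<le> exp B * (\<Prod>k=1..n. exp (- \<bar>X (k - 1) \<omega>\<bar>))"
          by (auto simp: indicator_def A_def)
      qed
      finally show ?thesis using prodc by simp
    qed
    moreover have "(\<lambda>n. exp B * c ^ n) \<longlonglongrightarrow> exp B * 0"
      using c01 by (intro tendsto_intros LIMSEQ_realpow_zero)
    ultimately have "prob A \<le> 0"
      by (intro LIMSEQ_le_const[of "\<lambda>n. exp B * c ^ n"]) auto
    then have "prob A = 0" using measure_nonneg[of M A] by linarith
    then have "AE \<omega> in M. \<omega> \<notin> A" by (simp add: AE_iff_null prob_eq_0 AE_not_in null_setsI emeasure_eq_measure)
    then show ?thesis
      by (rule AE_mp) (auto simp: A_def not_le intro!: AE_I2)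
  qed
  then have "AE \<omega> in M. \<forall>B::nat. \<exists>n. real B < (\<Sum>k=1..n. \<bar>X (k - 1) \<omega>\<bar>)"
    by (simp add: AE_all_countable)
  with pos show ?thesis
  proof (rule AE_mp[OF _ AE_mp[OF _ AE_I2]], intro impI)
    fix \<omega> assume \<omega>: "\<omega> \<in> space M" and inf: "\<forall>B::nat. \<exists>n. real B < (\<Sum>k=1..n. \<bar>X (k - 1) \<omega>\<bar>)" and p: "\<forall>j. 0 < X j \<omega>"
    have sm: "strict_mono (\<lambda>j. Ts j \<omega>)" using p by (intro strict_monoI_Suc) (auto simp: X_def)
    have T0: "Ts 0 \<omega> = 0" using P \<omega> by (auto simp: poisson_process_def)
    \<comment> \<open>Positive gaps make the absolute values harmless, and the sum telescopes from
      \<open>Ts 0 \<omega> = 0\<close>.\<close>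
    have S: "(\<Sum>k=1..n. \<bar>X (k - 1) \<omega>\<bar>) = Ts n \<omega>" for n
    proof (induction n)
      case (Suc n)
      then show ?case using p[rule_format, of n] by (simp add: X_def)
    qed (simp add: T0)
    have "filterlim (\<lambda>j. Ts j \<omega>) at_top sequentially"
      unfolding filterlim_at_top eventually_sequentially
    proof
      fix Z :: real
      obtain n where "real (nat \<lceil>Z\<rceil>) < Ts n \<omega>" using inf S by metis
      then have "Z \<le> Ts n \<omega>" by linarith
      then have "\<forall>m\<ge>n. Z \<le> Ts m \<omega>" using strict_mono_less_eq[OF sm] by (meson order_trans)
      then show "\<exists>N. \<forall>n\<ge>N. Z \<le> Ts n \<omega>" by blast
    qed
    with sm T0 show "strict_mono (\<lambda>j. Ts j \<omega>) \<and> Ts 0 \<omega> = 0 \<and> filterlim (\<lambda>j. Ts j \<omega>) at_top sequentially" by simp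
  qed
qed

text \<open>Truncated expectations are Picard iterates, and truncated values agree with the path
  value for large \<open>n\<close> almost surely; the bound of \<open>F\<close> dominates
  them.\<close>

lemma (in pdmp_modes) expectation_thinning_path:
  assumes \<Phi>: "measurable_flow \<Phi>" and F: "F \<in> borel_measurable state_space" "\<And>y. \<bar>F y\<bar> \<le> b"
    and pM: "prob_space M" and noise: "thinning_data M lamstar Np Ts U V" and "0 \<le> t"
  shows "(\<lambda>n. exp (- lamstar * t) * picard \<Phi> (terminal_weight \<Phi> F) n t 0 x) \<longlonglongrightarrow>
    (\<integral>\<omega>. F (thinning_path k N Q lam lamstar \<Phi> x (\<lambda>j. Ts j \<omega>) (\<lambda>j. U j \<omega>) (\<lambda>j. V j \<omega>) t) \<partial>M)"
proof -
  interpret prob_space M by fact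
  let ?X = "\<lambda>\<omega>. (\<lambda>j. Ts (Suc j) \<omega> - Ts j \<omega>, \<lambda>j. U (Suc j) \<omega>, \<lambda>j. V (Suc j) \<omega>)"
  let ?g = "\<lambda>n \<omega>. thinned_value \<Phi> F n t 0 x (\<lambda>j. Ts (Suc j) \<omega> - Ts j \<omega>) (\<lambda>j. U (Suc j) \<omega>) (\<lambda>j. V (Suc j) \<omega>)"
  note X = noise_law[OF pM noise]
  have P: "poisson_process M lamstar Np Ts" using noise by (simp add: thinning_data_def)
  have comp: "(\<lambda>\<omega>. U (Suc j) \<omega>) \<in> borel_measurable M" "(\<lambda>\<omega>. V (Suc j) \<omega>) \<in> borel_measurable M"
    "(\<lambda>\<omega>. Ts (Suc j) \<omega> - Ts j \<omega>) \<in> borel_measurable M" for j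
  proof -
    have s: "(\<lambda>w. w j) \<in> (\<Pi>\<^sub>M i\<in>UNIV. borel) \<rightarrow>\<^sub>M (borel :: real measure)"
      by (rule measurable_component_singleton) simp
    show "(\<lambda>\<omega>. U (Suc j) \<omega>) \<in> borel_measurable M"
      using measurable_compose[OF X(2) measurable_compose[OF measurable_snd measurable_compose[OF measurable_fst s]]] by simp
    show "(\<lambda>\<omega>. V (Suc j) \<omega>) \<in> borel_measurable M"
      using measurable_compose[OF X(2) measurable_compose[OF measurable_snd measurable_compose[OF measurable_snd s]]] by simp
    show "(\<lambda>\<omega>. Ts (Suc j) \<omega> - Ts j \<omega>) \<in> borel_measurable M"
      using measurable_compose[OF X(2) measurable_compose[OF measurable_fst s]] by simp
  qed
  have Tsm: "(\<lambda>\<omega>. Ts j \<omega>) \<in> borel_measurable M" for j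
  proof (induction j)
    case 0
    have "(\<lambda>\<omega>. 0 :: real) \<in> borel_measurable M" by simp
    then show ?case
      by (rule measurable_cong[THEN iffD1, rotated]) (use P in \<open>auto simp: poisson_process_def\<close>)
  next
    case (Suc j)
    from borel_measurable_add[OF this comp(3)[of j]] show ?case by simp
  qed
  have tv: "(\<lambda>(d, u, v). thinned_value \<Phi> F n t 0 x d u v) \<in> borel_measurable noise_space" for n
  proof -
    have [measurable]: "(\<lambda>z. x) \<in> noise_space \<rightarrow>\<^sub>M state_space"
      by (rule measurable_const) (simp add: space_state_space)
    show ?thesis unfolding case_prod_beta'
      by (rule thinned_value_measurable[OF \<Phi> F(1)]; measurable)
  qed
  have eq: "(\<integral>\<omega>. ?g n \<omega> \<partial>M) = exp (- lamstar * t) * picard \<Phi> (terminal_weight \<Phi> F) n t 0 x" for n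
    using integral_distr[OF X(2) tv[of n]] integral_thinned_value[OF \<Phi> F \<open>0 \<le> t\<close>, of 0 n x]
    unfolding X(1) by simp
  have "(\<lambda>n. \<integral>\<omega>. ?g n \<omega> \<partial>M) \<longlonglongrightarrow>
    (\<integral>\<omega>. F (thinning_path k N Q lam lamstar \<Phi> x (\<lambda>j. Ts j \<omega>) (\<lambda>j. U j \<omega>) (\<lambda>j. V j \<omega>) t) \<partial>M)"
  proof (rule integral_dominated_convergence[where w="\<lambda>_. b"])
    show "?g n \<in> borel_measurable M" for n
      using measurable_compose[OF X(2) tv[of n]] by simp
    show "(\<lambda>\<omega>. F (thinning_path k N Q lam lamstar \<Phi> x (\<lambda>j. Ts j \<omega>) (\<lambda>j. U j \<omega>) (\<lambda>j. V j \<omega>) t)) \<in> borel_measurable M"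
      by (rule measurable_compose[OF thinning_path_measurable F(1)]; fact \<Phi> Tsm comp)
    show "AE \<omega> in M. (\<lambda>n. ?g n \<omega>) \<longlonglongrightarrow> F (thinning_path k N Q lam lamstar \<Phi> x (\<lambda>j. Ts j \<omega>) (\<lambda>j. U j \<omega>) (\<lambda>j. V j \<omega>) t)"
      using poisson_jump_times_AE[OF lamstar_pos pM P]
    proof eventually_elim
      case (elim \<omega>)
      then show ?case
        using thinned_value_eventually_path[of "\<lambda>j. Ts j \<omega>" t \<Phi> F x "\<lambda>j. U j \<omega>" "\<lambda>j. V j \<omega>"] \<open>0 \<le> t\<close>
        by (intro tendsto_eventually) auto
    qed
  qed (use thinned_value_bound[OF F(2)] in auto)
  then show ?thesis by (simp only: eq)
qed


section \<open>Gronwall estimates and total variation\<close>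

lemma gronwall:
  fixes g :: "real \<Rightarrow> real"
  assumes cont: "continuous_on {0..T} g" and "0 \<le> L"
    and le: "\<And>t. 0 \<le> t \<Longrightarrow> t \<le> T \<Longrightarrow> g t \<le> a + L * integral {0..t} g"
    and t: "0 \<le> t" "t \<le> T"
  shows "g t \<le> a * exp (L * t)"
proof -
  \<comment> \<open>\<open>I\<close> majorizes \<open>g\<close>, hence its derivative
    \<open>L * g\<close> is at most \<open>L * I\<close>, and \<open>I t * exp (- L * t)\<close>
    cannot increase.\<close>
  define I where "I t = a + L * integral {0..t} g" for t
  have dI: "((\<lambda>t. I t * exp (- L * t)) has_real_derivative L * (g r - I r) * exp (- L * r)) (at r within {0..T})"
    if "r \<in> {0..T}" for r
  proof -
    have "((\<lambda>t. integral {0..t} g) has_real_derivative g r) (at r within {0..T})"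
      using integral_has_real_derivative[OF cont that] .
    then show ?thesis unfolding I_def
      by (auto intro!: derivative_eq_intros simp: algebra_simps)
  qed
  have "I t * exp (- L * t) \<le> I 0 * exp (- L * 0)"
  proof (rule DERIV_nonpos_imp_decreasing_open[OF t(1)])
    fix r assume r: "0 < r" "r < t"
    then have "at r within {0..T} = at r" using t by (intro at_within_interior) (simp add: interior_atLeastAtMost_real)
    with dI[of r] r t have "((\<lambda>t. I t * exp (- L * t)) has_real_derivative L * (g r - I r) * exp (- L * r)) (at r)" by simp
    moreover have "L * (g r - I r) * exp (- L * r) \<le> 0"
      using le[of r] r t \<open>0 \<le> L\<close> by (auto simp: I_def mult_le_0_iff intro!: mult_nonneg_nonpos)
    ultimately show "\<exists>y. ((\<lambda>t. I t * exp (- L * t)) has_real_derivative y) (at r) \<and> y \<le> 0" by blast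
  next
    have "continuous_on {0..T} (\<lambda>t. I t * exp (- L * t))"
      unfolding continuous_on_eq_continuous_within using dI DERIV_continuous by blast
    then show "continuous_on {0..t} (\<lambda>t. I t * exp (- L * t))"
      by (rule continuous_on_subset) (use t in auto)
  qed
  then have "I t \<le> a * exp (L * t)"
    by (simp add: I_def exp_minus field_simps)
  with le[OF t] show ?thesis by (simp add: I_def)
qed

text \<open>The finite set \<open>S\<close> is there for the corners of an Euler polygon, and
  \<open>\<epsilon>\<close> for its slope defect. The estimate is Gronwall's inequality for the
  distance of the trajectories.\<close>

lemma trajectory_stability:
  fixes y z :: "real \<Rightarrow> real"
  assumes S: "finite S" and L: "0 \<le> L" "0 \<le> \<epsilon>"
    and cont: "continuous_on {0..T} y" "continuous_on {0..T} z"
    and y: "\<And>r. 0 < r \<Longrightarrow> r < T \<Longrightarrow> r \<notin> S \<Longrightarrow> (y has_real_derivative y' r) (at r)"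
    and z: "\<And>r. 0 < r \<Longrightarrow> r < T \<Longrightarrow> r \<notin> S \<Longrightarrow> (z has_real_derivative z' r) (at r)"
    and le: "\<And>r. 0 < r \<Longrightarrow> r < T \<Longrightarrow> r \<notin> S \<Longrightarrow> \<bar>y' r - z' r\<bar> \<le> L * \<bar>y r - z r\<bar> + \<epsilon>"
    and t: "0 \<le> t" "t \<le> T"
  shows "\<bar>y t - z t\<bar> \<le> (\<bar>y 0 - z 0\<bar> + \<epsilon> * T) * exp (L * t)"
proof (rule gronwall[where T=T])
  show c: "continuous_on {0..T} (\<lambda>r. \<bar>y r - z r\<bar>)"
    by (intro continuous_intros cont)
  fix t assume t: "0 \<le> t" "t \<le> T"
  let ?S = "insert 0 (insert t S)"
  \<comment> \<open>Setting the integrand to 0 at the exceptional points leaves the integral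
    unchanged and makes the bound valid at every point.\<close>
  define k where "k r = (if r \<in> ?S then 0 else y' r - z' r)" for r
  have c': "continuous_on {0..t} (\<lambda>r. \<bar>y r - z r\<bar>)"
    by (rule continuous_on_subset[OF c]) (use t in auto)
  have "((\<lambda>r. y' r - z' r) has_integral ((y t - z t) - (y 0 - z 0))) {0..t}"
  proof (rule fundamental_theorem_of_calculus_interior_strong[OF S t(1)])
    show "((\<lambda>r. y r - z r) has_vector_derivative y' r - z' r) (at r)" if "r \<in> {0<..<t} - S" for r
      using y[of r] z[of r] that t
      by (auto simp: has_real_derivative_iff_has_vector_derivative[symmetric] intro!: derivative_intros)
    have "continuous_on {0..T} (\<lambda>r. y r - z r)" by (intro continuous_intros cont)
    then show "continuous_on {0..t} (\<lambda>r. y r - z r)" by (rule continuous_on_subset) (use t in auto)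
  qed
  then have k: "(k has_integral ((y t - z t) - (y 0 - z 0))) {0..t}"
    by (rule has_integral_spike_finite[where S="?S", rotated 2]) (auto simp: S k_def)
  have "norm (integral {0..t} k) \<le> integral {0..t} (\<lambda>r. L * \<bar>y r - z r\<bar> + \<epsilon>)"
  proof (rule integral_norm_bound_integral)
    show "k integrable_on {0..t}" using k by blast
    show "(\<lambda>r. L * \<bar>y r - z r\<bar> + \<epsilon>) integrable_on {0..t}"
      by (intro integrable_continuous_interval continuous_intros c')
    show "norm (k r) \<le> L * \<bar>y r - z r\<bar> + \<epsilon>" if "r \<in> {0..t}" for r
    proof (cases "r \<in> ?S")
      case True
      then show ?thesis using L by (simp add: k_def)
    next
      case False
      then show ?thesis using le[of r] that t by (auto simp: k_def)
    qed
  qed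
  also have "integral {0..t} (\<lambda>r. L * \<bar>y r - z r\<bar> + \<epsilon>) = L * integral {0..t} (\<lambda>r. \<bar>y r - z r\<bar>) + \<epsilon> * t"
    by (subst integral_add) (auto intro!: integrable_continuous_interval continuous_intros c' simp: t)
  finally have "\<bar>(y t - z t) - (y 0 - z 0)\<bar> \<le> L * integral {0..t} (\<lambda>r. \<bar>y r - z r\<bar>) + \<epsilon> * t"
    using integral_unique[OF k] by simp
  moreover have "\<epsilon> * t \<le> \<epsilon> * T" using L t by (intro mult_left_mono) auto
  ultimately show "\<bar>y t - z t\<bar> \<le> (\<bar>y 0 - z 0\<bar> + \<epsilon> * T) + L * integral {0..t} (\<lambda>r. \<bar>y r - z r\<bar>)"
    by linarith
qed (use t L in auto)

text \<open>Both measures have densities with respect to counting measure, so the difference of the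
  integrals is at most \<open>b\<close> times the l1 distance of the point masses, and that distance
  is at most \<open>2 * \<epsilon>\<close>.\<close>

lemma abs_diff_integral_le_total_variation:
  fixes \<mu> \<mu>' :: "'a::countable measure" and g :: "'a \<Rightarrow> real"
  assumes P: "prob_space \<mu>" "prob_space \<mu>'" and sets: "sets \<mu> = UNIV" "sets \<mu>' = UNIV"
    and tv: "\<And>A. \<bar>measure \<mu> A - measure \<mu>' A\<bar> \<le> \<epsilon>" and g: "\<And>a. \<bar>g a\<bar> \<le> b"
  shows "\<bar>(\<integral>a. g a \<partial>\<mu>) - (\<integral>a. g a \<partial>\<mu>')\<bar> \<le> 2 * b * \<epsilon>"
proof -
  have b: "0 \<le> b" using g[of undefined] by linarith
  have dens: "\<mu> = density (count_space UNIV) (\<lambda>a. ennreal (measure \<mu> {a}))"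
    if "prob_space \<mu>" "sets \<mu> = UNIV" for \<mu> :: "'a measure"
  proof (rule measure_eqI_countable)
    interpret prob_space \<mu> by fact
    show "emeasure \<mu> {a} = emeasure (density (count_space UNIV) (\<lambda>a. ennreal (measure \<mu> {a}))) {a}" for a
      by (subst emeasure_density)
        (auto simp: emeasure_eq_measure nn_integral_count_space_indicator[symmetric] nn_integral_count_space_finite)
  qed (use that in auto)
  have 1: "integrable (count_space UNIV) (\<lambda>a. measure \<mu> {a} * g a)"
      "(\<integral>a. g a \<partial>\<mu>) = (\<integral>a. measure \<mu> {a} * g a \<partial>count_space UNIV)"
    if \<mu>: "prob_space \<mu>" "sets \<mu> = UNIV" and g: "\<And>a. \<bar>g a\<bar> \<le> b" for \<mu> :: "'a measure" and g :: "'a \<Rightarrow> real" and b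
  proof -
    interpret prob_space \<mu> by fact
    have m: "f \<in> borel_measurable \<mu>" for f :: "'a \<Rightarrow> real"
      using \<mu>(2) by (simp add: measurable_def space_borel sets_eq_imp_space_eq[of \<mu> "count_space UNIV"])
    have "integrable \<mu> g" by (rule integrable_const_bound[of _ b]) (use g m in auto)
    then have "integrable (density (count_space UNIV) (\<lambda>a. ennreal (measure \<mu> {a}))) g" using dens[OF \<mu>] by simp
    then show "integrable (count_space UNIV) (\<lambda>a. measure \<mu> {a} * g a)"
      by (subst (asm) integrable_density) auto
    have "(\<integral>a. g a \<partial>\<mu>) = (\<integral>a. g a \<partial>density (count_space UNIV) (\<lambda>a. ennreal (measure \<mu> {a})))" using dens[OF \<mu>] by simp
    also have "\<dots> = (\<integral>a. measure \<mu> {a} * g a \<partial>count_space UNIV)"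
      by (subst integral_density) auto
    finally show "(\<integral>a. g a \<partial>\<mu>) = (\<integral>a. measure \<mu> {a} * g a \<partial>count_space UNIV)" .
  qed
  define \<delta> where "\<delta> a = measure \<mu> {a} - measure \<mu>' {a}" for a
  \<comment> \<open>The positive set of the signed difference: testing it and its complement
    recovers the sum of the absolute values.\<close>
  define D where "D = {a. 0 \<le> \<delta> a}"
  have ind: "(\<integral>a. \<delta> a * indicator A a \<partial>count_space UNIV) = measure \<mu> A - measure \<mu>' A"
    and indI: "integrable (count_space UNIV) (\<lambda>a. \<delta> a * indicator A a)" for A
  proof -
    note i = 1[OF P(1) sets(1), of "indicator A" 1] 1[OF P(2) sets(2), of "indicator A" 1]
    show "integrable (count_space UNIV) (\<lambda>a. \<delta> a * indicator A a)"
      using Bochner_Integration.integrable_diff[OF i(1) i(3)] by (simp add: \<delta>_def left_diff_distrib indicator_def)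
    have sp: "space \<mu> = UNIV" "space \<mu>' = UNIV"
      using sets sets_eq_imp_space_eq[of \<mu> "count_space UNIV"] sets_eq_imp_space_eq[of \<mu>' "count_space UNIV"] by auto
    have "(\<integral>a. \<delta> a * indicator A a \<partial>count_space UNIV)
      = (\<integral>a. indicator A a \<partial>\<mu>) - (\<integral>a. indicator A a \<partial>\<mu>')"
      using i by (simp add: \<delta>_def left_diff_distrib indicator_def)
    then show "(\<integral>a. \<delta> a * indicator A a \<partial>count_space UNIV) = measure \<mu> A - measure \<mu>' A"
      by (simp add: sp)
  qed
  note ig = 1[OF P(1) sets(1) g] 1[OF P(2) sets(2) g]
  have abs_eq: "\<bar>\<delta> a\<bar> * b = b * (\<delta> a * indicator D a - \<delta> a * indicator (- D) a)" for a
    by (auto simp: D_def indicator_def)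
  have "(\<integral>a. g a \<partial>\<mu>) - (\<integral>a. g a \<partial>\<mu>') = (\<integral>a. \<delta> a * g a \<partial>count_space UNIV)"
    using ig by (simp add: \<delta>_def left_diff_distrib)
  also have "\<bar>\<dots>\<bar> \<le> (\<integral>a. \<bar>\<delta> a * g a\<bar> \<partial>count_space UNIV)"
    by (rule integral_abs_bound)
  also have "\<dots> \<le> (\<integral>a. b * (\<delta> a * indicator D a - \<delta> a * indicator (- D) a) \<partial>count_space UNIV)"
  proof (rule integral_mono)
    have "integrable (count_space UNIV) (\<lambda>a. \<delta> a * g a)"
      using Bochner_Integration.integrable_diff[OF ig(1) ig(3)] by (simp add: \<delta>_def left_diff_distrib)
    then show "integrable (count_space UNIV) (\<lambda>a. \<bar>\<delta> a * g a\<bar>)" by (rule integrable_abs)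
    show "\<bar>\<delta> a * g a\<bar> \<le> b * (\<delta> a * indicator D a - \<delta> a * indicator (- D) a)" for a
      unfolding abs_eq[symmetric] abs_mult by (intro mult_left_mono g) auto
  qed (use indI in auto)
  also have "\<dots> = b * ((measure \<mu> D - measure \<mu>' D) - (measure \<mu> (- D) - measure \<mu>' (- D)))"
    using ind indI by simp
  also have "\<dots> \<le> b * (\<epsilon> + \<epsilon>)"
    using tv[of D] tv[of "- D"] b by (intro mult_left_mono) auto
  finally show ?thesis by simp
qed

section \<open>Euler polygons\<close>

text \<open>The cell may be closed on the right: there the floor already selects the next node,
  whose value is the same.\<close>

lemma euler_flow_cell:
  assumes "0 < h" "real i * h \<le> a" "a \<le> real (Suc i) * h"
  shows "euler_flow f h \<theta> a \<nu> = euler_node f h \<theta> \<nu> i + (a - real i * h) * f \<theta> (euler_node f h \<theta> \<nu> i)"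
proof (cases "a = real (Suc i) * h")
  case True
  then have "nat \<lfloor>a / h\<rfloor> = Suc i" using assms(1) by (simp add: nat_eq_iff)
  then show ?thesis unfolding euler_flow_def by (simp add: True algebra_simps)
next
  case False
  then have "\<lfloor>a / h\<rfloor> = int i" using assms by (intro floor_unique) (auto simp: field_simps)
  then show ?thesis unfolding euler_flow_def by (simp add: Let_def)
qed

lemma cell_exists:
  assumes "0 < h" "0 \<le> a" obtains i where "real i * h \<le> a" "a < real (Suc i) * h"
proof -
  have "0 \<le> \<lfloor>a / h\<rfloor>" using assms by simp
  then have "real (nat \<lfloor>a / h\<rfloor>) \<le> a / h" "a / h < real (Suc (nat \<lfloor>a / h\<rfloor>))" by linarith+
  then have "real (nat \<lfloor>a / h\<rfloor>) * h \<le> a" "a < real (Suc (nat \<lfloor>a / h\<rfloor>)) * h"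
    using assms by (simp_all only: pos_le_divide_eq pos_divide_less_eq)
  then show ?thesis by (rule that)
qed

lemma euler_flow_0 [simp]: "0 < h \<Longrightarrow> euler_flow f h \<theta> 0 \<nu> = \<nu>"
  using euler_flow_cell[of h 0 0 f \<theta> \<nu>] by simp

lemma euler_flow_node: "0 < h \<Longrightarrow> euler_flow f h \<theta> (real i * h) \<nu> = euler_node f h \<theta> \<nu> i"
  using euler_flow_cell[of h i "real i * h" f \<theta> \<nu>] by (simp add: field_simps)

lemma euler_node_diff:
  assumes "\<And>\<nu>. \<bar>f \<theta> \<nu>\<bar> \<le> C" "0 < h" "i \<le> j"
  shows "\<bar>euler_node f h \<theta> \<nu> j - euler_node f h \<theta> \<nu> i\<bar> \<le> C * (real j * h - real i * h)"
  using assms(3)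
proof (induction rule: dec_induct)
  case (step j)
  have "\<bar>h * f \<theta> (euler_node f h \<theta> \<nu> j)\<bar> \<le> h * C"
    unfolding abs_mult using assms by (intro mult_mono) auto
  with step.IH show ?case by (simp add: algebra_simps)
qed simp

lemma euler_flow_lipschitz_time:
  assumes C: "\<And>\<nu>. \<bar>f \<theta> \<nu>\<bar> \<le> C" and h: "0 < h" and ab: "0 \<le> a" "a \<le> b"
  shows "\<bar>euler_flow f h \<theta> b \<nu> - euler_flow f h \<theta> a \<nu>\<bar> \<le> C * (b - a)"
proof -
  let ?n = "euler_node f h \<theta> \<nu>"
  have le: "\<bar>d * f \<theta> \<nu>\<bar> \<le> C * d" if "0 \<le> d" for d \<nu>
    using mult_left_mono[OF C[of \<nu>] that] that by (simp add: abs_mult mult.commute)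
  obtain i where i: "real i * h \<le> a" "a < real (Suc i) * h" using cell_exists[OF h ab(1)] .
  obtain j where j: "real j * h \<le> b" "b < real (Suc j) * h" using cell_exists[OF h, of b] ab by auto
  have a: "euler_flow f h \<theta> a \<nu> = ?n i + (a - real i * h) * f \<theta> (?n i)"
    by (rule euler_flow_cell[OF h]) (use i in auto)
  have b: "euler_flow f h \<theta> b \<nu> = ?n j + (b - real j * h) * f \<theta> (?n j)"
    by (rule euler_flow_cell[OF h]) (use j in auto)
  show ?thesis
  proof (cases "i = j")
    case True
    then show ?thesis using le[of "b - a" "?n i"] ab unfolding a b by (simp add: algebra_simps)
  next
    case False
    have "real i * h < real (Suc j) * h" using i j ab by linarith
    then have "i < Suc j" using h by simp
    with False have ij: "Suc i \<le> j" by simp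
    have 1: "\<bar>(b - real j * h) * f \<theta> (?n j)\<bar> \<le> C * (b - real j * h)"
      by (rule le) (use j in auto)
    have 2: "\<bar>?n j - ?n (Suc i)\<bar> \<le> C * (real j * h - real (Suc i) * h)"
      by (rule euler_node_diff[where f=f and \<theta>=\<theta>, OF C h ij])
    have 3: "\<bar>(real (Suc i) * h - a) * f \<theta> (?n i)\<bar> \<le> C * (real (Suc i) * h - a)"
      by (rule le) (use i in auto)
    have "euler_flow f h \<theta> b \<nu> - euler_flow f h \<theta> a \<nu>
      = (b - real j * h) * f \<theta> (?n j) + (?n j - ?n (Suc i)) + (real (Suc i) * h - a) * f \<theta> (?n i)"
      unfolding a b by (simp add: algebra_simps)
    with 1 2 3 show ?thesis by (simp add: algebra_simps abs_le_iff)
  qed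
qed

lemma euler_flow_continuous:
  assumes C: "\<And>\<nu>. \<bar>f \<theta> \<nu>\<bar> \<le> C" and h: "0 < h"
  shows "continuous_on {0..} (\<lambda>a. euler_flow f h \<theta> a \<nu>)"
proof -
  have "0 \<le> C" using C[of 0] by linarith
  then have "C-lipschitz_on {0..} (\<lambda>a. euler_flow f h \<theta> a \<nu>)"
  proof (intro lipschitz_onI)
    fix x y :: real assume "x \<in> {0..}" "y \<in> {0..}"
    then show "dist (euler_flow f h \<theta> x \<nu>) (euler_flow f h \<theta> y \<nu>) \<le> C * dist x y"
      using euler_flow_lipschitz_time[where f=f and \<theta>=\<theta>, OF C h, of x y \<nu>] euler_flow_lipschitz_time[where f=f and \<theta>=\<theta>, OF C h, of y x \<nu>]
      by (cases "x \<le> y") (auto simp: dist_real_def abs_minus_commute)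
  qed
  then show ?thesis by (rule lipschitz_on_continuous_on)
qed

text \<open>For \<open>0 \<le> a\<close> the last grid time not after \<open>a\<close>. It is always
  applied to the age, because the grid restarts at each jump.\<close>

definition grid :: "real \<Rightarrow> real \<Rightarrow> real" where "grid h a = real (nat \<lfloor>a / h\<rfloor>) * h"

definition on_grid :: "real \<Rightarrow> real \<Rightarrow> bool" where "on_grid h a \<longleftrightarrow> (\<exists>i::nat. a = real i * h)"

lemma grid_cell:
  assumes "0 < h" "real i * h \<le> a" "a < real (Suc i) * h" shows "grid h a = real i * h"
proof -
  have "\<lfloor>a / h\<rfloor> = int i" using assms by (intro floor_unique) (auto simp: field_simps)
  then show ?thesis by (simp add: grid_def)
qed

lemma grid_bounds: assumes "0 < h" "0 \<le> a" shows "0 \<le> grid h a" "grid h a \<le> a" "a - grid h a \<le> h"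
proof -
  obtain i where i: "real i * h \<le> a" "a < real (Suc i) * h" using cell_exists[OF assms] .
  with grid_cell[OF assms(1) i] assms show "0 \<le> grid h a" "grid h a \<le> a" "a - grid h a \<le> h"
    by (auto simp: algebra_simps)
qed

lemma off_grid_cell:
  assumes "0 < h" "0 < a" "\<not> on_grid h a"
  obtains i where "real i * h < a" "a < real (Suc i) * h"
proof -
  obtain i where i: "real i * h \<le> a" "a < real (Suc i) * h" using cell_exists[OF assms(1)] assms(2) by (metis less_imp_le)
  with assms(3) have "real i * h \<noteq> a" by (auto simp: on_grid_def)
  with i have "real i * h < a" by simp
  with i(2) show ?thesis using that by blast
qed

text \<open>These are the corners of the polygon seen from a process of age \<open>s\<close>; they
  form the exceptional set in the fundamental theorem of calculus.\<close>

lemma finite_on_grid: assumes "0 < h" shows "finite {r. 0 \<le> r \<and> r \<le> t \<and> on_grid h (s + r)}"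
proof (rule finite_subset)
  show "{r. 0 \<le> r \<and> r \<le> t \<and> on_grid h (s + r)} \<subseteq> (\<lambda>i::nat. real i * h - s) ` {..nat \<lceil>(s + t) / h\<rceil>}"
  proof
    fix r assume r: "r \<in> {r. 0 \<le> r \<and> r \<le> t \<and> on_grid h (s + r)}"
    then obtain i :: nat where i: "s + r = real i * h" by (auto simp: on_grid_def)
    then have "real i = (s + r) / h" using assms by (simp add: field_simps)
    also have "\<dots> \<le> (s + t) / h" using r assms by (intro divide_right_mono) auto
    finally have "i \<le> nat \<lceil>(s + t) / h\<rceil>" by linarith
    then show "r \<in> (\<lambda>i::nat. real i * h - s) ` {..nat \<lceil>(s + t) / h\<rceil>}" using i by (intro image_eqI[of _ _ i]) auto
  qed
qed auto

lemma euler_flow_derivative: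
  assumes "0 < h" "0 < a" "\<not> on_grid h a"
  shows "((\<lambda>a. euler_flow f h \<theta> a \<nu>) has_real_derivative f \<theta> (euler_flow f h \<theta> (grid h a) \<nu>)) (at a)"
proof -
  obtain i where i: "real i * h < a" "a < real (Suc i) * h" using off_grid_cell[OF assms] .
  let ?y = "euler_node f h \<theta> \<nu> i"
  have "((\<lambda>a. ?y + (a - real i * h) * f \<theta> ?y) has_real_derivative f \<theta> ?y) (at a)"
    by (auto intro!: derivative_eq_intros)
  then have "((\<lambda>a. euler_flow f h \<theta> a \<nu>) has_real_derivative f \<theta> ?y) (at a)"
  proof (rule has_field_derivative_transform_within_open)
    show "open {real i * h<..<real (Suc i) * h}" "a \<in> {real i * h<..<real (Suc i) * h}" using i by auto
    show "?y + (x - real i * h) * f \<theta> ?y = euler_flow f h \<theta> x \<nu>" if "x \<in> {real i * h<..<real (Suc i) * h}" for x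
      using euler_flow_cell[OF assms(1), of i x f \<theta> \<nu>] that by auto
  qed
  moreover have "grid h a = real i * h" by (rule grid_cell) (use assms i in auto)
  ultimately show ?thesis by (simp add: euler_flow_node[OF assms(1)])
qed

lemma euler_flow_grid:
  assumes h: "0 < h" and "0 \<le> a"
  shows "euler_flow f h \<theta> a \<nu> = euler_flow f h \<theta> (grid h a) \<nu> + (a - grid h a) * f \<theta> (euler_flow f h \<theta> (grid h a) \<nu>)"
proof -
  obtain i where i: "real i * h \<le> a" "a < real (Suc i) * h" using cell_exists[OF assms] .
  show ?thesis using euler_flow_cell[OF h i(1), of f \<theta> \<nu>] i by (simp add: grid_cell[OF h i] euler_flow_node[OF h])
qed

text \<open>On each of countably many time cells the polygon is a finite composition of measurable
  maps; the cell number is measurable in time.\<close>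

lemma measurable_flow_euler:
  assumes "\<And>\<theta>. f \<theta> \<in> borel_measurable borel"
  shows "measurable_flow (euler_flow f h)"
  unfolding measurable_flow_def
proof
  fix \<theta>
  note [measurable] = assms[of \<theta>]
  have node [measurable]: "(\<lambda>\<nu>. euler_node f h \<theta> \<nu> i) \<in> borel_measurable borel" for i
    by (induction i) auto
  have "(\<lambda>z. euler_node f h \<theta> (snd z) i + (fst z - real i * h) * f \<theta> (euler_node f h \<theta> (snd z) i)) \<in> borel_measurable (borel \<Otimes>\<^sub>M borel)" for i
    by measurable
  moreover have "(\<lambda>z::real \<times> real. nat \<lfloor>fst z / h\<rfloor>) \<in> borel \<Otimes>\<^sub>M borel \<rightarrow>\<^sub>M count_space UNIV"
    by measurable
  ultimately have "(\<lambda>z. euler_node f h \<theta> (snd z) (nat \<lfloor>fst z / h\<rfloor>) + (fst z - real (nat \<lfloor>fst z / h\<rfloor>) * h) * f \<theta> (euler_node f h \<theta> (snd z) (nat \<lfloor>fst z / h\<rfloor>))) \<in> borel_measurable (borel \<Otimes>\<^sub>M borel)"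
    by (rule measurable_compose_countable)
  then show "(\<lambda>(t, \<nu>). euler_flow f h \<theta> t \<nu>) \<in> borel_measurable (borel \<Otimes>\<^sub>M borel)"
    by (simp add: euler_flow_def case_prod_beta' Let_def)
qed

section \<open>Comparison of flows\<close>

text \<open>Negative times are reached by the sign \<open>\<sigma>\<close>: reversing time negates
  the field and keeps its Lipschitz constant. They are included because joint measurability is
  stated on the whole plane.\<close>

lemma flow_lipschitz_space:
  assumes flow: "is_flow f \<phi>" and L: "\<And>\<nu> \<nu>'. \<bar>f \<theta> \<nu> - f \<theta> \<nu>'\<bar> \<le> C * \<bar>\<nu> - \<nu>'\<bar>" and "0 \<le> C"
  shows "\<bar>\<phi> \<theta> t \<nu> - \<phi> \<theta> t \<nu>'\<bar> \<le> \<bar>\<nu> - \<nu>'\<bar> * exp (C * \<bar>t\<bar>)"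
proof -
  define \<sigma> :: real where "\<sigma> = (if 0 \<le> t then 1 else -1)"
  have d: "((\<lambda>r. \<phi> \<theta> (\<sigma> * r) \<nu>) has_real_derivative \<sigma> * f \<theta> (\<phi> \<theta> (\<sigma> * r) \<nu>)) (at r)" for r \<nu>
  proof -
    have "((\<lambda>s. \<phi> \<theta> s \<nu>) has_real_derivative f \<theta> (\<phi> \<theta> (\<sigma> * r) \<nu>)) (at (\<sigma> * r))"
      using flow by (simp add: is_flow_def)
    from DERIV_chain2[where g="\<lambda>r. \<sigma> * r", OF this DERIV_cmult_Id] show ?thesis
      by (simp only: mult.commute)
  qed
  have "\<bar>\<phi> \<theta> (\<sigma> * \<bar>t\<bar>) \<nu> - \<phi> \<theta> (\<sigma> * \<bar>t\<bar>) \<nu>'\<bar> \<le> (\<bar>\<phi> \<theta> (\<sigma> * 0) \<nu> - \<phi> \<theta> (\<sigma> * 0) \<nu>'\<bar> + 0 * \<bar>t\<bar>) * exp (C * \<bar>t\<bar>)"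
  proof (rule trajectory_stability[where S="{}", OF _ \<open>0 \<le> C\<close>])
    show "continuous_on {0..\<bar>t\<bar>} (\<lambda>r. \<phi> \<theta> (\<sigma> * r) \<nu>)" "continuous_on {0..\<bar>t\<bar>} (\<lambda>r. \<phi> \<theta> (\<sigma> * r) \<nu>')"
      by (rule DERIV_atLeastAtMost_imp_continuous_on; use d in blast)+
    show "\<bar>\<sigma> * f \<theta> (\<phi> \<theta> (\<sigma> * r) \<nu>) - \<sigma> * f \<theta> (\<phi> \<theta> (\<sigma> * r) \<nu>')\<bar> \<le> C * \<bar>\<phi> \<theta> (\<sigma> * r) \<nu> - \<phi> \<theta> (\<sigma> * r) \<nu>'\<bar> + 0" for r
      using L[of "\<phi> \<theta> (\<sigma> * r) \<nu>" "\<phi> \<theta> (\<sigma> * r) \<nu>'"] by (auto simp: \<sigma>_def abs_minus_commute)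
  qed (use d in auto)
  moreover have "\<sigma> * \<bar>t\<bar> = t" by (auto simp: \<sigma>_def)
  moreover have "\<phi> \<theta> 0 \<nu> = \<nu>" "\<phi> \<theta> 0 \<nu>' = \<nu>'" using flow by (auto simp: is_flow_def)
  ultimately show ?thesis by simp
qed

lemma measurable_flow_exact:
  assumes flow: "is_flow f \<phi>" and L: "\<And>\<theta> \<nu> \<nu>'. \<bar>f \<theta> \<nu> - f \<theta> \<nu>'\<bar> \<le> C * \<bar>\<nu> - \<nu>'\<bar>" and "0 \<le> C"
  shows "measurable_flow \<phi>"
  unfolding measurable_flow_def
proof
  fix \<theta>
  have c: "isCont (\<lambda>s. \<phi> \<theta> s \<nu>) t" for t \<nu>
    using flow by (auto simp: is_flow_def intro: DERIV_isCont)
  have "continuous_on UNIV (\<lambda>z. \<phi> \<theta> (fst z) (snd z))"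
  proof (rule continuous_at_imp_continuous_on, rule ballI)
    fix z0 :: "real \<times> real"
    let ?d = "\<lambda>z. \<bar>snd z - snd z0\<bar> * exp (C * \<bar>fst z\<bar>) + \<bar>\<phi> \<theta> (fst z) (snd z0) - \<phi> \<theta> (fst z0) (snd z0)\<bar>"
    have "(?d \<longlongrightarrow> \<bar>snd z0 - snd z0\<bar> * exp (C * \<bar>fst z0\<bar>) + \<bar>\<phi> \<theta> (fst z0) (snd z0) - \<phi> \<theta> (fst z0) (snd z0)\<bar>) (at z0)"
      by (intro tendsto_intros isCont_tendsto_compose[OF c])
    then have d0: "(?d \<longlongrightarrow> 0) (at z0)" by simp
    have "((\<lambda>z. \<phi> \<theta> (fst z) (snd z) - \<phi> \<theta> (fst z0) (snd z0)) \<longlongrightarrow> 0) (at z0)"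
    proof (rule Lim_null_comparison[OF _ d0], rule always_eventually, rule allI)
      fix z :: "real \<times> real"
      show "norm (\<phi> \<theta> (fst z) (snd z) - \<phi> \<theta> (fst z0) (snd z0)) \<le> ?d z"
        using flow_lipschitz_space[OF flow L \<open>0 \<le> C\<close>, of \<theta> "fst z" "snd z" "snd z0"] by simp
    qed
    then show "isCont (\<lambda>z. \<phi> \<theta> (fst z) (snd z)) z0"
      by (simp add: isCont_def LIM_zero_iff)
  qed
  then show "(\<lambda>(t, \<nu>). \<phi> \<theta> t \<nu>) \<in> borel_measurable (borel \<Otimes>\<^sub>M borel)"
    by (simp add: case_prod_beta' borel_prod borel_measurable_continuous_onI)
qed

text \<open>The polygon uses the slope at the last grid point, at most \<open>C * h\<close> away, so
  its slope defect is at most \<open>C * C * h\<close>. Different starting points are allowed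
  because the processes may have separated before a jump.\<close>

lemma euler_flow_error:
  assumes flow: "is_flow f \<phi>" and L: "\<And>\<nu> \<nu>'. \<bar>f \<theta> \<nu> - f \<theta> \<nu>'\<bar> \<le> C * \<bar>\<nu> - \<nu>'\<bar>"
    and C: "\<And>\<nu>. \<bar>f \<theta> \<nu>\<bar> \<le> C" and h: "0 < h" and t: "0 \<le> t" "t \<le> T"
  shows "\<bar>euler_flow f h \<theta> t \<nu> - \<phi> \<theta> t \<nu>'\<bar> \<le> (\<bar>\<nu> - \<nu>'\<bar> + C * C * h * T) * exp (C * t)"
proof -
  have "0 \<le> C" using C[of 0] by linarith
  let ?y = "\<lambda>r. euler_flow f h \<theta> r \<nu>"
  have d: "((\<lambda>s. \<phi> \<theta> s \<nu>') has_real_derivative f \<theta> (\<phi> \<theta> r \<nu>')) (at r)" for r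
    using flow by (simp add: is_flow_def)
  have "\<bar>?y t - \<phi> \<theta> t \<nu>'\<bar> \<le> (\<bar>?y 0 - \<phi> \<theta> 0 \<nu>'\<bar> + C * C * h * T) * exp (C * t)"
  proof (rule trajectory_stability[where S="{r. 0 \<le> r \<and> r \<le> T \<and> on_grid h (0 + r)}" and T=T, OF _ \<open>0 \<le> C\<close>])
    show "finite {r. 0 \<le> r \<and> r \<le> T \<and> on_grid h (0 + r)}" by (rule finite_on_grid[OF h])
    show "continuous_on {0..T} ?y"
      by (rule continuous_on_subset[OF euler_flow_continuous[where f=f and \<theta>=\<theta>, OF C h]]) auto
    show "continuous_on {0..T} (\<lambda>s. \<phi> \<theta> s \<nu>')"
      by (rule DERIV_atLeastAtMost_imp_continuous_on) (use d in blast)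
    show "(?y has_real_derivative f \<theta> (?y (grid h r))) (at r)"
      if "0 < r" "r < T" "r \<notin> {r. 0 \<le> r \<and> r \<le> T \<and> on_grid h (0 + r)}" for r
      by (rule euler_flow_derivative[OF h]) (use that in auto)
    show "\<bar>f \<theta> (?y (grid h r)) - f \<theta> (\<phi> \<theta> r \<nu>')\<bar> \<le> C * \<bar>?y r - \<phi> \<theta> r \<nu>'\<bar> + C * C * h" if r: "0 < r" for r
    proof -
      have g: "0 \<le> grid h r" "grid h r \<le> r" "r - grid h r \<le> h" using grid_bounds[OF h, of r] r by auto
      have "\<bar>?y r - ?y (grid h r)\<bar> \<le> C * (r - grid h r)"
        by (rule euler_flow_lipschitz_time[where f=f and \<theta>=\<theta>, OF C h g(1,2)])
      also have "\<dots> \<le> C * h" using g \<open>0 \<le> C\<close> by (intro mult_left_mono) auto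
      finally have "C * \<bar>?y (grid h r) - ?y r\<bar> \<le> C * (C * h)" using \<open>0 \<le> C\<close> by (intro mult_left_mono) auto
      then show ?thesis using L[of "?y (grid h r)" "?y r"] L[of "?y r" "\<phi> \<theta> r \<nu>'"] by (simp add: mult.assoc)
    qed
  qed (use d t h \<open>0 \<le> C\<close> in auto)
  then show ?thesis using flow h by (simp add: is_flow_def)
qed

section \<open>Running costs and the comparison of two flows\<close>

context pdmp_kernel begin

text \<open>The first argument of \<open>\<psi>\<close> is the remaining time, and
  \<open>\<psi>\<close> carries the discount itself. As a source of the fixed-point equation this is
  a running cost collected until the next proposal.\<close>

definition running_weight :: "(real \<Rightarrow> 'k \<times> real \<Rightarrow> real) \<Rightarrow> ('k \<Rightarrow> real \<Rightarrow> real \<Rightarrow> real) \<Rightarrow> 'k weight" where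
  "running_weight \<psi> \<Phi> t s x = (LINT r:{0..t}|lborel. \<psi> (t - r) (flow_map \<Phi> (s + r) x))"

context
  fixes \<psi> :: "real \<Rightarrow> 'k \<times> real \<Rightarrow> real"
  assumes \<psi>: "(\<lambda>(q, y). \<psi> q y) \<in> borel_measurable (borel \<Otimes>\<^sub>M state_space)"
begin

lemma running_integrand_measurable:
  assumes \<Phi>: "measurable_flow \<Phi>"
    and [measurable]: "a \<in> borel_measurable M" "b \<in> borel_measurable M" "X \<in> M \<rightarrow>\<^sub>M state_space" "c \<in> borel_measurable M"
  shows "(\<lambda>\<omega>. \<psi> (a \<omega> - c \<omega>) (flow_map \<Phi> (b \<omega> + c \<omega>) (X \<omega>))) \<in> borel_measurable M"
proof -
  have "(\<lambda>\<omega>. flow_map \<Phi> (b \<omega> + c \<omega>) (X \<omega>)) \<in> M \<rightarrow>\<^sub>M state_space"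
    by (rule measurable_flow_map[OF \<Phi>]) measurable
  from measurable_compose[OF measurable_Pair[OF borel_measurable_diff[OF assms(2) assms(5)] this] \<psi>]
  show ?thesis by simp
qed

lemma running_integrand_measurable_time:
  assumes \<Phi>: "measurable_flow \<Phi>"
  shows "(\<lambda>r. \<psi> (t - r) (flow_map \<Phi> (s + r) x)) \<in> borel_measurable borel"
  by (rule running_integrand_measurable[OF \<Phi>]) (simp_all add: space_state_space)

lemma running_weight_measurable:
  assumes \<Phi>: "measurable_flow \<Phi>"
  shows "measurable_weight (running_weight \<psi> \<Phi>)"
proof (rule measurable_weightI)
  let ?g = "\<lambda>z r. \<psi> (fst z - r) (flow_map \<Phi> (fst (snd z) + r) (snd (snd z)))"
  have [measurable]: "(\<lambda>(z, r). ?g z r)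
      \<in> borel_measurable ((borel \<Otimes>\<^sub>M (borel \<Otimes>\<^sub>M state_space)) \<Otimes>\<^sub>M lborel)"
    unfolding case_prod_beta' by (rule running_integrand_measurable[OF \<Phi>]) measurable
  have "(\<lambda>z. \<integral>r. (if 0 \<le> r \<and> r \<le> fst z then ?g z r else 0) \<partial>lborel)
      \<in> borel_measurable (borel \<Otimes>\<^sub>M (borel \<Otimes>\<^sub>M (state_space :: ('k \<times> real) measure)))"
    by measurable
  also have "(\<lambda>z. \<integral>r. (if 0 \<le> r \<and> r \<le> fst z then ?g z r else 0) \<partial>lborel)
     = (\<lambda>z. running_weight \<psi> \<Phi> (fst z) (fst (snd z)) (snd (snd z)))"
    unfolding running_weight_def set_lebesgue_integral_def by (intro ext Bochner_Integration.integral_cong) auto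
  finally show "(\<lambda>z. running_weight \<psi> \<Phi> (fst z) (fst (snd z)) (snd (snd z)))
    \<in> borel_measurable (borel \<Otimes>\<^sub>M (borel \<Otimes>\<^sub>M state_space))" .
qed

lemma running_integrand_integrable:
  assumes \<Phi>: "measurable_flow \<Phi>" and B: "\<And>q y. 0 \<le> q \<Longrightarrow> q \<le> T \<Longrightarrow> \<bar>\<psi> q y\<bar> \<le> B" and "t \<le> T"
  shows "set_integrable lborel {0..t} (\<lambda>r. \<psi> (t - r) (flow_map \<Phi> (s + r) x))"
  by (rule set_integrable_bounded_borel[where c=B])
     (use running_integrand_measurable_time[OF \<Phi>] B assms(3) in auto)

lemma running_weight_bounded:
  assumes \<Phi>: "measurable_flow \<Phi>" and B: "\<And>q y. 0 \<le> q \<Longrightarrow> q \<le> T \<Longrightarrow> \<bar>\<psi> q y\<bar> \<le> B"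
  shows "weight_bounded T (B * T) (running_weight \<psi> \<Phi>)"
proof (rule weight_boundedI)
  fix t s :: real and x assume t: "0 \<le> t" "t \<le> T" "0 \<le> s"
  have "0 \<le> B" using B[of 0 x] t by linarith
  have "\<bar>running_weight \<psi> \<Phi> t s x\<bar> \<le> B * (t - 0)"
    unfolding running_weight_def
    by (rule set_integral_abs_le_const) (use t B running_integrand_integrable[OF \<Phi> B] in auto)
  also have "\<dots> \<le> B * T" using t \<open>0 \<le> B\<close> by (intro mult_left_mono) auto
  finally show "\<bar>running_weight \<psi> \<Phi> t s x\<bar> \<le> B * T" .
qed

end

text \<open>First the integrand is changed under one mode law, costing \<open>\<eta>\<close>; then
  the mode law is changed for a fixed integrand bounded by \<open>b\<close>, costing the total
  variation term.\<close>

lemma Q_integral_compare: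
  assumes C: "\<And>A. \<bar>mode_prob Q (\<theta>, \<nu>) A - mode_prob Q (\<theta>, \<nu>') A\<bar> \<le> \<epsilon>"
    and H: "H \<in> borel_measurable state_space" "H' \<in> borel_measurable state_space"
    and b: "\<And>z. \<bar>H z\<bar> \<le> b'" "\<And>z. \<bar>H' z\<bar> \<le> b"
    and le: "\<And>a. \<bar>H (a, \<nu>) - H' (a, \<nu>')\<bar> \<le> \<eta>"
  shows "\<bar>(\<integral>z. H z \<partial>Q (\<theta>, \<nu>)) - (\<integral>z. H' z \<partial>Q (\<theta>, \<nu>'))\<bar> \<le> \<eta> + 2 * b * \<epsilon>"
proof -
  interpret m: prob_space "mode_law (\<theta>, \<nu>)" by (rule prob_space_mode_law)
  have sp: "space (mode_law y) = UNIV" for y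
    using sets_eq_imp_space_eq[of "mode_law y" "count_space UNIV"] sets_mode_law by simp
  have meas: "g \<in> borel_measurable (mode_law y)" for g :: "'k \<Rightarrow> real" and y
    by (simp add: measurable_def sets_mode_law sp)
  have int: "integrable (mode_law (\<theta>, \<nu>)) g" if "\<And>a. \<bar>g a\<bar> \<le> c" for g :: "'k \<Rightarrow> real" and c
    by (rule m.integrable_const_bound[of _ c]) (use that meas in auto)
  have "(\<integral>a. H (a, \<nu>) \<partial>mode_law (\<theta>, \<nu>)) - (\<integral>a. H' (a, \<nu>') \<partial>mode_law (\<theta>, \<nu>))
    = (\<integral>a. H (a, \<nu>) - H' (a, \<nu>') \<partial>mode_law (\<theta>, \<nu>))"
    by (subst Bochner_Integration.integral_diff) (use int[of "\<lambda>a. H (a, \<nu>)", OF b(1)] int[of "\<lambda>a. H' (a, \<nu>')", OF b(2)] in auto)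
  moreover have "\<bar>\<integral>a. H (a, \<nu>) - H' (a, \<nu>') \<partial>mode_law (\<theta>, \<nu>)\<bar> \<le> \<eta>"
    by (rule m.abs_expectation_le) (rule le)
  moreover have "\<bar>(\<integral>a. H' (a, \<nu>') \<partial>mode_law (\<theta>, \<nu>)) - (\<integral>a. H' (a, \<nu>') \<partial>mode_law (\<theta>, \<nu>'))\<bar> \<le> 2 * b * \<epsilon>"
    by (rule abs_diff_integral_le_total_variation)
       (use C b in \<open>auto simp: prob_space_mode_law sets_mode_law measure_mode_law\<close>)
  ultimately show ?thesis by (simp add: integral_Q_eq[OF H(1)] integral_Q_eq[OF H(2)])
qed

text \<open>The discrepancy \<open>\<delta>\<close> between the two trajectories is multiplied by \<open>M\<^sub>0\<close> at each jump; since the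
  \<open>n\<close>-jump contributions decay like \<open>1/n!\<close>, the sum over all jumps stays of order \<open>\<delta>\<close>.\<close>

lemma picard_compare:
  assumes \<Phi>: "measurable_flow \<Phi>" and \<Psi>: "measurable_flow \<Psi>"
    and \<psi>: "(\<lambda>(q, y). \<psi> q y) \<in> borel_measurable (borel \<Otimes>\<^sub>M state_space)"
    and B: "\<And>q y. 0 \<le> q \<Longrightarrow> q \<le> T \<Longrightarrow> \<bar>\<psi> q y\<bar> \<le> B"
    and B_lip: "\<And>q \<theta> \<nu> \<nu>'. 0 \<le> q \<Longrightarrow> q \<le> T \<Longrightarrow> \<bar>\<psi> q (\<theta>, \<nu>) - \<psi> q (\<theta>, \<nu>')\<bar> \<le> B * \<bar>\<nu> - \<nu>'\<bar>"
    and lam_lip: "\<And>\<theta> \<nu> \<nu>'. \<bar>lam (\<theta>, \<nu>) - lam (\<theta>, \<nu>')\<bar> \<le> C * \<bar>\<nu> - \<nu>'\<bar>"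
    and Q_lip: "\<And>\<theta> \<nu> \<nu>' A. \<bar>mode_prob Q (\<theta>, \<nu>) A - mode_prob Q (\<theta>, \<nu>') A\<bar> \<le> C * \<bar>\<nu> - \<nu>'\<bar>"
    and close: "\<And>\<theta> \<nu> \<nu>' \<delta> r. h \<le> \<delta> \<Longrightarrow> \<bar>\<nu> - \<nu>'\<bar> \<le> \<delta> \<Longrightarrow> 0 \<le> r \<Longrightarrow> r \<le> T \<Longrightarrow> \<bar>\<Phi> \<theta> r \<nu> - \<Psi> \<theta> r \<nu>'\<bar> \<le> M\<^sub>0 * \<delta>"
    and M0: "1 \<le> M\<^sub>0" and "0 \<le> h" "0 \<le> C"
  defines "b \<equiv> B * T * exp (lamstar * T)"
  defines "A \<equiv> B * T + 2 * C * b * (1 + lamstar) * T"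
  defines "M \<equiv> lamstar * (1 + M\<^sub>0)"
  assumes "h \<le> \<delta>" "0 \<le> t" "t \<le> T" "0 \<le> s" "0 \<le> s'"
    and "\<And>r. 0 \<le> r \<Longrightarrow> r \<le> t \<Longrightarrow> \<bar>\<Phi> \<theta> (s + r) \<nu> - \<Psi> \<theta> (s' + r) \<nu>'\<bar> \<le> \<delta>"
  shows "\<bar>picard \<Phi> (running_weight \<psi> \<Phi>) n t s (\<theta>, \<nu>) - picard \<Psi> (running_weight \<psi> \<Psi>) n t s' (\<theta>, \<nu>')\<bar>
    \<le> \<delta> * A * exp (M * t)"
  using assms(15-)
proof (induction n arbitrary: t s s' \<theta> \<nu> \<nu>' \<delta>)
  case 0
  have "0 \<le> B" using B[of 0 undefined] 0 by force
  then have "0 \<le> A" "0 \<le> \<delta>" using 0 lamstar_pos \<open>0 \<le> C\<close> \<open>0 \<le> h\<close> by (auto simp: A_def b_def)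
  then show ?case by simp
next
  case (Suc n)
  note prem = Suc.prems
  have T: "0 \<le> T" using prem by simp
  have B0: "0 \<le> B" using B[of 0 undefined] T by force
  have A0: "0 \<le> A" and b0: "0 \<le> b" and \<delta>0: "0 \<le> \<delta>" and M: "0 < M"
    using B0 T prem lamstar_pos \<open>0 \<le> C\<close> \<open>0 \<le> h\<close> M0 by (auto simp: A_def b_def M_def)
  let ?y = "\<lambda>r. \<Phi> \<theta> (s + r) \<nu>" and ?y' = "\<lambda>r. \<Psi> \<theta> (s' + r) \<nu>'"
  let ?r = "running_weight \<psi> \<Phi>" and ?r' = "running_weight \<psi> \<Psi>"
  let ?P = "picard \<Phi> ?r n" and ?P' = "picard \<Psi> ?r' n"
  let ?J = "jump_integrand \<Phi> ?P t s (\<theta>, \<nu>)" and ?J' = "jump_integrand \<Psi> ?P' t s' (\<theta>, \<nu>')"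
  have "weight_bounded T (B * T) ?r" "weight_bounded T (B * T) ?r'"
    by (rule running_weight_bounded[OF \<psi>]; fact \<Phi> \<Psi> B)+
  note r = running_weight_measurable[OF \<psi> \<Phi>] this(1)
  note r' = running_weight_measurable[OF \<psi> \<Psi>] \<open>weight_bounded T (B * T) ?r'\<close>
  note P = picard_measurable[OF \<Phi> r(1), of n] picard_weight_bounded[OF \<Phi> r, of n, folded b_def]
  note P' = picard_measurable[OF \<Psi> r'(1), of n] picard_weight_bounded[OF \<Psi> r', of n, folded b_def]
  note iJ = jump_integrand_integrable[OF \<Phi> P prem(3,4), of "(\<theta>, \<nu>)"] jump_integrand_integrable[OF \<Psi> P' prem(3,5), of "(\<theta>, \<nu>')"]
  have ir: "set_integrable lborel {0..t} (\<lambda>r. \<psi> (t - r) (flow_map \<Phi> (s + r) (\<theta>, \<nu>)))"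
    "set_integrable lborel {0..t} (\<lambda>r. \<psi> (t - r) (flow_map \<Psi> (s' + r) (\<theta>, \<nu>')))"
    by (rule running_integrand_integrable[OF \<psi>, where T=T and B=B]; fact \<Phi> \<Psi> B prem)+
  have src: "\<bar>?r t s (\<theta>, \<nu>) - ?r' t s' (\<theta>, \<nu>')\<bar> \<le> \<delta> * (B * T)"
  proof -
    have "?r t s (\<theta>, \<nu>) - ?r' t s' (\<theta>, \<nu>')
      = (LINT r:{0..t}|lborel. \<psi> (t - r) (flow_map \<Phi> (s + r) (\<theta>, \<nu>)) - \<psi> (t - r) (flow_map \<Psi> (s' + r) (\<theta>, \<nu>')))"
      unfolding running_weight_def using set_integral_diff(2)[OF ir] by simp
    also have "\<bar>\<dots>\<bar> \<le> (B * \<delta>) * (t - 0)"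
    proof (rule set_integral_abs_le_const[OF prem(2) set_integral_diff(1)[OF ir]])
      fix r assume "0 \<le> r" "r \<le> t"
      then have "\<bar>\<psi> (t - r) (\<theta>, ?y r) - \<psi> (t - r) (\<theta>, ?y' r)\<bar> \<le> B * \<bar>?y r - ?y' r\<bar>"
        using prem by (intro B_lip) auto
      also have "\<dots> \<le> B * \<delta>" using prem(6) \<open>0 \<le> r\<close> \<open>r \<le> t\<close> B0 by (intro mult_left_mono) auto
      finally show "\<bar>\<psi> (t - r) (flow_map \<Phi> (s + r) (\<theta>, \<nu>)) - \<psi> (t - r) (flow_map \<Psi> (s' + r) (\<theta>, \<nu>'))\<bar> \<le> B * \<delta>"
        by (simp add: flow_map_def)
    qed
    also have "\<dots> \<le> (B * \<delta>) * T" using B0 \<delta>0 prem by (intro mult_left_mono) auto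
    finally show ?thesis by (simp add: mult_ac)
  qed
  have int: "\<bar>?J r - ?J' r\<bar> \<le> \<delta> * (A * M * exp (M * (t - r)) + 2 * C * b * (1 + lamstar))"
    if r: "0 \<le> r" "r \<le> t" for r
  proof -
    let ?l = "lam (\<theta>, ?y r)" and ?l' = "lam (\<theta>, ?y' r)"
    let ?H = "?P (t - r) (s + r) (\<theta>, \<nu>)" and ?H' = "?P' (t - r) (s' + r) (\<theta>, \<nu>')"
    let ?I = "\<integral>z. ?P (t - r) 0 z \<partial>Q (\<theta>, ?y r)" and ?I' = "\<integral>z. ?P' (t - r) 0 z \<partial>Q (\<theta>, ?y' r)"
    let ?e = "\<delta> * A * exp (M * (t - r))"
    have d: "\<bar>?y r - ?y' r\<bar> \<le> \<delta>" using prem(6) r by auto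
    have tr: "0 \<le> t - r" "t - r \<le> T" using r prem by auto
    have l: "\<bar>?l - ?l'\<bar> \<le> C * \<delta>"
      using lam_lip[of \<theta> "?y r" "?y' r"] mult_left_mono[OF d \<open>0 \<le> C\<close>] by linarith
    have q: "\<bar>mode_prob Q (\<theta>, ?y r) A - mode_prob Q (\<theta>, ?y' r) A\<bar> \<le> C * \<delta>" for A
      using Q_lip[of \<theta> "?y r" A "?y' r"] mult_left_mono[OF d \<open>0 \<le> C\<close>] by linarith
    have H: "\<bar>?H - ?H'\<bar> \<le> ?e"
    proof (rule Suc.IH)
      show "\<bar>\<Phi> \<theta> (s + r + q) \<nu> - \<Psi> \<theta> (s' + r + q) \<nu>'\<bar> \<le> \<delta>" if "0 \<le> q" "q \<le> t - r" for q
        using prem(6)[of "r + q"] that r by (simp add: add.assoc)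
    qed (use prem r in auto)
    have b': "\<bar>?P (t - r) 0 z\<bar> \<le> b" "\<bar>?P' (t - r) 0 z\<bar> \<le> b" for z
      using weight_boundedD[OF P(2) tr] weight_boundedD[OF P'(2) tr] by auto
    have H'b: "\<bar>?H'\<bar> \<le> b" using weight_boundedD[OF P'(2) tr] prem r by auto
    have I: "\<bar>?I - ?I'\<bar> \<le> M\<^sub>0 * ?e + 2 * b * (C * \<delta>)"
    proof (rule Q_integral_compare[OF q _ _ b'])
      show "?P (t - r) 0 \<in> borel_measurable state_space" "?P' (t - r) 0 \<in> borel_measurable state_space"
        by (rule measurable_weightD[OF P(1)] measurable_weightD[OF P'(1)]; simp)+
      \<comment> \<open>After a jump both processes start at age 0 in the same mode with positions
        \<open>\<delta>\<close> apart. By \<open>close\<close> they stay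
        \<open>M\<^sub>0 * \<delta>\<close> apart, so the induction hypothesis is used with this
        larger discrepancy.\<close>
      fix a
      have "\<delta> \<le> M\<^sub>0 * \<delta>" using M0 \<delta>0 by (simp add: mult_le_cancel_right1)
      have "\<bar>?P (t - r) 0 (a, ?y r) - ?P' (t - r) 0 (a, ?y' r)\<bar> \<le> (M\<^sub>0 * \<delta>) * A * exp (M * (t - r))"
        by (rule Suc.IH) (use tr prem d \<open>\<delta> \<le> M\<^sub>0 * \<delta>\<close> close[OF prem(1) d] in auto)
      then show "\<bar>?P (t - r) 0 (a, ?y r) - ?P' (t - r) 0 (a, ?y' r)\<bar> \<le> M\<^sub>0 * ?e"
        by (simp add: mult_ac)
    qed
    have I'b: "\<bar>?I'\<bar> \<le> b"
    proof -
      interpret prob_space "Q (\<theta>, ?y' r)" by (rule Q_prob)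
      show ?thesis by (rule abs_expectation_le) (rule b')
    qed
    have tri: "\<bar>w + x + y + z\<bar> \<le> \<bar>w\<bar> + \<bar>x\<bar> + \<bar>y\<bar> + \<bar>z\<bar>" for w x y z :: real by linarith
    have lb: "0 < ?l" "?l \<le> lamstar" using lam_bounds[of "(\<theta>, ?y r)"] by auto
    \<comment> \<open>Each term changes one factor. The propagated errors \<open>?e\<close>
      (rejection) and \<open>M\<^sub>0 * ?e\<close> (acceptance), both times \<open>lamstar\<close>,
      add up to \<open>M * ?e\<close>; the changes of rate and kernel give
      \<open>2 * C * b * (1 + lamstar)\<close> times \<open>\<delta>\<close>.\<close>
    have eq: "?J r - ?J' r = (lamstar - ?l) * (?H - ?H') + (?l' - ?l) * ?H' + ?l * (?I - ?I') + (?l - ?l') * ?I'"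
      by (simp add: jump_integrand_def flow_map_def algebra_simps)
    have "\<bar>?J r - ?J' r\<bar> \<le> \<bar>(lamstar - ?l) * (?H - ?H')\<bar> + \<bar>(?l' - ?l) * ?H'\<bar> + \<bar>?l * (?I - ?I')\<bar> + \<bar>(?l - ?l') * ?I'\<bar>"
      unfolding eq by (rule tri)
    also have "\<dots> \<le> lamstar * ?e + (C * \<delta>) * b + lamstar * (M\<^sub>0 * ?e + 2 * b * (C * \<delta>)) + (C * \<delta>) * b"
      unfolding abs_mult using lb l H H'b I I'b \<open>0 \<le> C\<close> \<delta>0
      by (intro add_mono mult_mono) auto
    also have "\<dots> = \<delta> * (A * M * exp (M * (t - r)) + 2 * C * b * (1 + lamstar))"
      by (simp add: M_def algebra_simps)
    finally show ?thesis .
  qed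
  let ?G = "\<lambda>r. \<delta> * (- A * exp (M * (t - r)) + 2 * C * b * (1 + lamstar) * r)"
  have "jump_op \<Phi> ?P t s (\<theta>, \<nu>) - jump_op \<Psi> ?P' t s' (\<theta>, \<nu>') = (LINT r:{0..t}|lborel. ?J r - ?J' r)"
    unfolding jump_op_def using set_integral_diff(2)[OF iJ] by simp
  also have "\<bar>\<dots>\<bar> \<le> ?G t - ?G 0"
  proof (rule set_integral_le_FTC[OF prem(2) set_integral_diff(1)[OF iJ] int])
    show "(?G has_real_derivative \<delta> * (A * M * exp (M * (t - r)) + 2 * C * b * (1 + lamstar))) (at r)" for r
      by (auto intro!: derivative_eq_intros simp: algebra_simps)
    show "isCont (\<lambda>r. \<delta> * (A * M * exp (M * (t - r)) + 2 * C * b * (1 + lamstar))) r" for r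
      by (intro continuous_intros)
  qed
  \<comment> \<open>Integrating the exponential leaves a term \<open>- A\<close>. The summand
    \<open>B * T\<close> of \<open>A\<close> survives there and pays for the difference
    \<open>src\<close> of the sources.\<close>
  also have "?G t - ?G 0 \<le> \<delta> * (A * exp (M * t) - B * T)"
  proof -
    have "2 * C * b * (1 + lamstar) * t \<le> 2 * C * b * (1 + lamstar) * T"
      using prem \<open>0 \<le> C\<close> b0 lamstar_pos by (intro mult_left_mono) auto
    then have "- A + 2 * C * b * (1 + lamstar) * t + A * exp (M * t) \<le> A * exp (M * t) - B * T"
      by (simp add: A_def)
    from mult_left_mono[OF this \<delta>0] show ?thesis by (simp add: algebra_simps)
  qed
  finally show ?case using src by (simp add: algebra_simps)
qed

end


section \<open>Uniform bounds for the backward solution\<close>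

lemma has_partials_on_time:
  assumes "has_partials_on g g\<^sub>1 g\<^sub>2 ({0..T} \<times> UNIV)" "t \<in> {0..T}"
  shows "((\<lambda>s. g (s, \<nu>)) has_real_derivative g\<^sub>1 (t, \<nu>)) (at t within {0..T})"
proof -
  have "(g has_derivative (\<lambda>v. g\<^sub>1 (t, \<nu>) * fst v + g\<^sub>2 (t, \<nu>) * snd v)) (at (t, \<nu>) within {0..T} \<times> UNIV)"
    using assms by (auto simp: has_partials_on_def)
  then have "(g has_derivative (\<lambda>v. g\<^sub>1 (t, \<nu>) * fst v + g\<^sub>2 (t, \<nu>) * snd v)) (at (t, \<nu>) within (\<lambda>s. (s, \<nu>)) ` {0..T})"
    by (rule has_derivative_subset) auto
  moreover have "((\<lambda>s. (s, \<nu>)) has_derivative (\<lambda>h. (h, 0))) (at t within {0..T})"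
    by (intro has_derivative_Pair has_derivative_ident has_derivative_const)
  ultimately have "((\<lambda>s. g (s, \<nu>)) has_derivative (\<lambda>h. g\<^sub>1 (t, \<nu>) * h)) (at t within {0..T})"
    using has_derivative_in_compose[of "\<lambda>s. (s, \<nu>)" "\<lambda>h. (h, 0)" t "{0..T}" g] by fastforce
  then show ?thesis by (simp add: has_field_derivative_def)
qed

lemma has_partials_on_space:
  assumes "has_partials_on g g\<^sub>1 g\<^sub>2 ({0..T} \<times> UNIV)" "t \<in> {0..T}"
  shows "((\<lambda>\<nu>. g (t, \<nu>)) has_real_derivative g\<^sub>2 (t, \<nu>)) (at \<nu>)"
proof -
  have "(g has_derivative (\<lambda>v. g\<^sub>1 (t, \<nu>) * fst v + g\<^sub>2 (t, \<nu>) * snd v)) (at (t, \<nu>) within {0..T} \<times> UNIV)"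
    using assms by (auto simp: has_partials_on_def)
  then have "(g has_derivative (\<lambda>v. g\<^sub>1 (t, \<nu>) * fst v + g\<^sub>2 (t, \<nu>) * snd v)) (at (t, \<nu>) within range (\<lambda>\<nu>. (t, \<nu>)))"
    by (rule has_derivative_subset) (use assms in auto)
  moreover have "((\<lambda>\<nu>. (t, \<nu>)) has_derivative (\<lambda>h. (0, h))) (at \<nu>)"
    by (intro has_derivative_Pair has_derivative_ident has_derivative_const)
  ultimately have "((\<lambda>\<nu>. g (t, \<nu>)) has_derivative (\<lambda>h. g\<^sub>2 (t, \<nu>) * h)) (at \<nu>)"
    using has_derivative_in_compose[of "\<lambda>\<nu>. (t, \<nu>)" "\<lambda>h. (0, h)" \<nu> UNIV g] by fastforce
  then show ?thesis by (simp add: has_field_derivative_def)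
qed

lemma has_partials_on_continuous:
  "has_partials_on g g\<^sub>1 g\<^sub>2 S \<Longrightarrow> continuous_on S g"
  by (auto simp: has_partials_on_def intro!: has_derivative_continuous_on)

lemma real_MVT:
  fixes g :: "real \<Rightarrow> real"
  assumes "\<And>x. (g has_real_derivative g' x) (at x)" "a < b"
  obtains x where "a < x" "x < b" "g b - g a = (b - a) * g' x"
  using MVT2[of a b g g'] assms by blast

text \<open>The second difference with step 1 is at most \<open>4 * B\<close> and equals
  \<open>g''\<close> at a point within distance 2, so transport back to \<open>x\<close> costs
  \<open>2 * K\<close>. Likewise the first difference bounds \<open>g'\<close> by
  \<open>2 * B\<close> somewhere, and transport costs the bound on \<open>g''\<close>.\<close>

lemma landau_bounds:
  fixes g :: "real \<Rightarrow> real"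
  assumes g: "\<And>x. (g has_real_derivative g' x) (at x)" and g': "\<And>x. (g' has_real_derivative g'' x) (at x)"
    and B: "\<And>x. \<bar>g x\<bar> \<le> B" and K: "\<And>x y. \<bar>g'' x - g'' y\<bar> \<le> K * \<bar>x - y\<bar>" and "0 \<le> K"
  shows "\<bar>g'' x\<bar> \<le> 4 * B + 2 * K" "\<bar>g' x\<bar> \<le> 6 * B + 2 * K"
proof -
  have second: "\<bar>g'' x\<bar> \<le> 4 * B + 2 * K" for x
  proof -
    have "((\<lambda>x. g (x + 1) - g x) has_real_derivative g' (x + 1) - g' x) (at x)" for x
      using DERIV_shift[of g "g' (x + 1)" x 1] g by (auto intro!: derivative_intros)
    from real_MVT[OF this, of x "x + 1"] obtain y where y: "x < y" "y < x + 1"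
      "(g (x + 1 + 1) - g (x + 1)) - (g (x + 1) - g x) = g' (y + 1) - g' y" by auto
    from real_MVT[OF g', of y "y + 1"] obtain z where z: "y < z" "z < y + 1" "g' (y + 1) - g' y = g'' z" by auto
    have "\<bar>g'' z\<bar> \<le> 4 * B" using y(3) z(3) B[of "x + 1 + 1"] B[of "x + 1"] B[of x] by linarith
    moreover have "\<bar>g'' x - g'' z\<bar> \<le> K * 2"
      using K[of x z] y z mult_left_mono[of "\<bar>x - z\<bar>" 2 K] \<open>0 \<le> K\<close> by linarith
    ultimately show ?thesis by linarith
  qed
  then show "\<bar>g'' x\<bar> \<le> 4 * B + 2 * K" .
  from real_MVT[OF g, of x "x + 1"] obtain y where y: "x < y" "y < x + 1" "g (x + 1) - g x = g' y" by auto
  from real_MVT[OF g' y(1)] obtain z where z: "g' y - g' x = (y - x) * g'' z" by auto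
  have "0 \<le> 4 * B + 2 * K" using B[of 0] \<open>0 \<le> K\<close> by linarith
  then have "\<bar>(y - x) * g'' z\<bar> \<le> 1 * (4 * B + 2 * K)" unfolding abs_mult using y second[of z] by (intro mult_mono) auto
  then have "\<bar>g' y - g' x\<bar> \<le> 4 * B + 2 * K" unfolding z by simp
  then show "\<bar>g' x\<bar> \<le> 6 * B + 2 * K" using y(3) B[of "x + 1"] B[of x] by linarith
qed

definition ubounded :: "('a \<Rightarrow> real) \<Rightarrow> bool" where
  "ubounded g \<longleftrightarrow> (\<exists>B. \<forall>x. \<bar>g x\<bar> \<le> B)"

lemma uboundedI: "(\<And>x. \<bar>g x\<bar> \<le> B) \<Longrightarrow> ubounded g"
  by (auto simp: ubounded_def)

lemma ubounded_add: "ubounded g \<Longrightarrow> ubounded g' \<Longrightarrow> ubounded (\<lambda>x. g x + g' x)"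
  unfolding ubounded_def by (metis abs_triangle_ineq add_mono order_trans)

lemma ubounded_cmult: "ubounded g \<Longrightarrow> ubounded (\<lambda>x. c * g x)"
  unfolding ubounded_def by (metis abs_ge_zero abs_mult mult_left_mono)

lemma ubounded_diff: "ubounded g \<Longrightarrow> ubounded g' \<Longrightarrow> ubounded (\<lambda>x. g x - g' x)"
  using ubounded_add[of g "\<lambda>x. (-1) * g' x"] ubounded_cmult[of g' "-1"] by simp

lemma ubounded_mult: "ubounded g \<Longrightarrow> ubounded g' \<Longrightarrow> ubounded (\<lambda>x. g x * g' x)"
  unfolding ubounded_def by (metis abs_ge_zero abs_mult mult_mono' )

lemmas ubounded_intros = ubounded_add ubounded_diff ubounded_mult ubounded_cmult

text \<open>Here \<open>p\<close> is the Taylor polynomial at \<open>T\<close>. The remainder is not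
  small; what matters is that it is the same for all modes.\<close>

lemma taylor_backward:
  fixes g :: "real \<Rightarrow> real"
  assumes g: "\<And>t. t \<in> {0..T} \<Longrightarrow> (g has_real_derivative g' t) (at t within {0..T})"
    and M: "\<And>t. t \<in> {0..T} \<Longrightarrow> \<bar>g' t - p' t\<bar> \<le> M"
    and p: "\<And>t. (p has_real_derivative p' t) (at t)" and \<tau>: "0 \<le> \<tau>" "\<tau> \<le> T"
  shows "\<bar>g (T - \<tau>) - g T - (p (T - \<tau>) - p T)\<bar> \<le> M * T"
proof -
  have M0: "0 \<le> M" using M[of T] \<tau> by force
  have "norm ((g (T - \<tau>) - p (T - \<tau>)) - (g T - p T)) \<le> M * norm ((T - \<tau>) - T)"
  proof (rule field_differentiable_bound[where S="{0..T}" and f="\<lambda>t. g t - p t" and f'="\<lambda>t. g' t - p' t"])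
    show "((\<lambda>t. g t - p t) has_field_derivative g' t - p' t) (at t within {0..T})" if "t \<in> {0..T}" for t
      using g[OF that] has_field_derivative_at_within[OF p, of t] by (intro derivative_intros)
  qed (use M \<tau> in auto)
  also have "\<dots> \<le> M * T" using M0 \<tau> by (intro mult_left_mono) auto
  finally show ?thesis by (simp add: algebra_simps)
qed

text \<open>The information on \<open>u\<close> that is uniform in the mode consists of
  \<open>K\<close>, the equation and the bounded terminal value; uniform bounds are derived from
  these.\<close>

locale backward_solution = pdmp_kernel lam lamstar Q
  for lam :: "'k::countable \<times> real \<Rightarrow> real" and lamstar Q +
  fixes f f1 f2 :: "'k \<Rightarrow> real \<Rightarrow> real" and C T K :: real
    and F :: "'k \<times> real \<Rightarrow> real" and u :: "real \<Rightarrow> 'k \<times> real \<Rightarrow> real"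
    and u_t u_n u_tt u_tn u_nt u_nn :: "'k \<Rightarrow> real \<times> real \<Rightarrow> real"
  assumes T_pos: "0 < T" and K_nonneg: "0 \<le> K"
    and f1: "\<And>\<theta> \<nu>. (f \<theta> has_real_derivative f1 \<theta> \<nu>) (at \<nu>)"
    and f2: "\<And>\<theta> \<nu>. (f1 \<theta> has_real_derivative f2 \<theta> \<nu>) (at \<nu>)"
    and f_bounds: "\<And>\<theta> \<nu>. \<bar>f \<theta> \<nu>\<bar> \<le> C \<and> \<bar>f1 \<theta> \<nu>\<bar> \<le> C \<and> \<bar>f2 \<theta> \<nu>\<bar> \<le> C"
    and lam_lip: "\<And>\<theta> \<nu> \<nu>'. \<bar>lam (\<theta>, \<nu>) - lam (\<theta>, \<nu>')\<bar> \<le> C * \<bar>\<nu> - \<nu>'\<bar>"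
    and Q_lip: "\<And>\<theta> \<nu> \<nu>' A. \<bar>mode_prob Q (\<theta>, \<nu>) A - mode_prob Q (\<theta>, \<nu>') A\<bar> \<le> C * \<bar>\<nu> - \<nu>'\<bar>"
    and F_ub: "ubounded F"
    and u_partials: "\<And>\<theta>. has_partials_on (\<lambda>(t, \<nu>). u t (\<theta>, \<nu>)) (u_t \<theta>) (u_n \<theta>) ({0..T} \<times> UNIV)"
    and ut_partials: "\<And>\<theta>. has_partials_on (u_t \<theta>) (u_tt \<theta>) (u_tn \<theta>) ({0..T} \<times> UNIV)"
    and un_partials: "\<And>\<theta>. has_partials_on (u_n \<theta>) (u_nt \<theta>) (u_nn \<theta>) ({0..T} \<times> UNIV)"
    and K_lip: "\<And>\<theta>. K-lipschitz_on ({0..T} \<times> UNIV) (u_tt \<theta>)" "\<And>\<theta>. K-lipschitz_on ({0..T} \<times> UNIV) (u_nt \<theta>)"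
      "\<And>\<theta>. K-lipschitz_on ({0..T} \<times> UNIV) (u_nn \<theta>)"
    and u_integrable: "\<And>t x. 0 \<le> t \<Longrightarrow> t < T \<Longrightarrow> integrable (Q x) (u t)"
    and u_equation: "\<And>t \<theta> \<nu>. 0 \<le> t \<Longrightarrow> t < T \<Longrightarrow>
      u_t \<theta> (t, \<nu>) + f \<theta> \<nu> * u_n \<theta> (t, \<nu>) + lam (\<theta>, \<nu>) * ((\<integral>y. u t y \<partial>Q (\<theta>, \<nu>)) - u t (\<theta>, \<nu>)) = 0"
    and u_terminal: "\<And>x. u T x = F x"
begin

lemma C_nonneg: "0 \<le> C"
  using f_bounds[of undefined 0] by linarith

lemma u_time: "t \<in> {0..T} \<Longrightarrow> ((\<lambda>s. u s (\<theta>, \<nu>)) has_real_derivative u_t \<theta> (t, \<nu>)) (at t within {0..T})"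
  using has_partials_on_time[OF u_partials] by simp

lemma u_space: "t \<in> {0..T} \<Longrightarrow> ((\<lambda>\<nu>. u t (\<theta>, \<nu>)) has_real_derivative u_n \<theta> (t, \<nu>)) (at \<nu>)"
  using has_partials_on_space[OF u_partials] by simp

lemmas ut_time = has_partials_on_time[OF ut_partials]
  and un_time = has_partials_on_time[OF un_partials]
  and un_space = has_partials_on_space[OF un_partials]

lemma K_lip_time:
  assumes "K-lipschitz_on ({0..T} \<times> UNIV) g" "t \<in> {0..T}" "t' \<in> {0..T}"
  shows "\<bar>g (t, \<nu>) - g (t', \<nu>)\<bar> \<le> K * T"
proof -
  have "\<bar>g (t, \<nu>) - g (t', \<nu>)\<bar> \<le> K * dist (t, \<nu>) (t', \<nu>)"
    using lipschitz_onD[OF assms(1), of "(t, \<nu>)" "(t', \<nu>)"] assms(2,3) by (simp add: dist_real_def)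
  also have "\<dots> \<le> K * T" using K_nonneg assms(2,3) by (intro mult_left_mono) (auto simp: dist_Pair_Pair dist_real_def)
  finally show ?thesis .
qed

lemma K_lip_space:
  assumes "K-lipschitz_on ({0..T} \<times> UNIV) g" "t \<in> {0..T}"
  shows "\<bar>g (t, \<nu>) - g (t, \<nu>')\<bar> \<le> K * \<bar>\<nu> - \<nu>'\<bar>"
  using lipschitz_onD[OF assms(1), of "(t, \<nu>)" "(t, \<nu>')"] assms(2) by (simp add: dist_real_def dist_Pair_Pair)

lemma ut_expansion:
  assumes "0 \<le> \<tau>" "\<tau> \<le> T"
  shows "\<bar>u_t \<theta> (T - \<tau>, \<nu>) - (u_t \<theta> (T, \<nu>) - \<tau> * u_tt \<theta> (T, \<nu>))\<bar> \<le> K * T * T"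
proof -
  have p: "((\<lambda>t. t * u_tt \<theta> (T, \<nu>)) has_real_derivative u_tt \<theta> (T, \<nu>)) (at t)" for t
    by (auto intro!: derivative_eq_intros)
  have "\<bar>u_t \<theta> (T - \<tau>, \<nu>) - u_t \<theta> (T, \<nu>) - ((T - \<tau>) * u_tt \<theta> (T, \<nu>) - T * u_tt \<theta> (T, \<nu>))\<bar> \<le> K * T * T"
    by (rule taylor_backward[OF ut_time _ p assms]) (use K_lip_time[OF K_lip(1)] T_pos in auto)
  then show ?thesis by (simp add: algebra_simps)
qed

lemma un_expansion:
  assumes "0 \<le> \<tau>" "\<tau> \<le> T"
  shows "\<bar>u_n \<theta> (T - \<tau>, \<nu>) - (u_n \<theta> (T, \<nu>) - \<tau> * u_nt \<theta> (T, \<nu>))\<bar> \<le> K * T * T"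
proof -
  have p: "((\<lambda>t. t * u_nt \<theta> (T, \<nu>)) has_real_derivative u_nt \<theta> (T, \<nu>)) (at t)" for t
    by (auto intro!: derivative_eq_intros)
  have "\<bar>u_n \<theta> (T - \<tau>, \<nu>) - u_n \<theta> (T, \<nu>) - ((T - \<tau>) * u_nt \<theta> (T, \<nu>) - T * u_nt \<theta> (T, \<nu>))\<bar> \<le> K * T * T"
    by (rule taylor_backward[OF un_time _ p assms]) (use K_lip_time[OF K_lip(2)] T_pos in auto)
  then show ?thesis by (simp add: algebra_simps)
qed

lemma u_expansion:
  assumes "0 \<le> \<tau>" "\<tau> \<le> T"
  shows "\<bar>u (T - \<tau>) (\<theta>, \<nu>) - (F (\<theta>, \<nu>) - \<tau> * u_t \<theta> (T, \<nu>) + \<tau>\<^sup>2 / 2 * u_tt \<theta> (T, \<nu>))\<bar> \<le> K * T * T * T"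
proof -
  let ?b = "u_t \<theta> (T, \<nu>)" and ?c = "u_tt \<theta> (T, \<nu>)"
  let ?p = "\<lambda>t. t * ?b + (T - t)\<^sup>2 * (?c / 2)"
  have p: "(?p has_real_derivative ?b - (T - t) * ?c) (at t)" for t
    by (auto intro!: derivative_eq_intros simp: field_simps)
  have "\<bar>u (T - \<tau>) (\<theta>, \<nu>) - u T (\<theta>, \<nu>) - (?p (T - \<tau>) - ?p T)\<bar> \<le> K * T * T * T"
  proof (rule taylor_backward[OF u_time _ p assms])
    show "\<bar>u_t \<theta> (t, \<nu>) - (?b - (T - t) * ?c)\<bar> \<le> K * T * T" if "t \<in> {0..T}" for t
      using ut_expansion[of "T - t" \<theta> \<nu>] that by simp
  qed
  then show ?thesis by (simp add: algebra_simps u_terminal)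
qed

text \<open>The bounds of \<open>u\<close> are only assumed mode by mode. They are uniform nonetheless: linear combinations
  of \<open>u\<close> at several times that cancel the unknown Taylor coefficients at \<open>T\<close> are uniformly bounded, and
  by the equation so are the corresponding combinations of \<open>u_t\<close>, which isolate these coefficients.\<close>

lemma u_uniformly_bounded: "\<exists>B. \<forall>t\<in>{0..T}. \<forall>x. \<bar>u t x\<bar> \<le> B"
proof -
  define U where "U \<tau> x = u (T - \<tau>) x" for \<tau> x
  define Ut where "Ut \<tau> x = u_t (fst x) (T - \<tau>, snd x)" for \<tau> and x :: "'k \<times> real"
  define Us where "Us \<tau> x = u_n (fst x) (T - \<tau>, snd x)" for \<tau> and x :: "'k \<times> real"
  define I where "I \<tau> x = (\<integral>y. U \<tau> y \<partial>Q x)" for \<tau> and x :: "'k \<times> real"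
  define b where "b x = u_t (fst x) (T, snd x)" for x :: "'k \<times> real"
  define c where "c x = u_tt (fst x) (T, snd x)" for x :: "'k \<times> real"
  define d where "d x = u_nt (fst x) (T, snd x)" for x :: "'k \<times> real"
  define Fn where "Fn x = u_n (fst x) (T, snd x)" for x :: "'k \<times> real"
  define ff where "ff x = f (fst x) (snd x)" for x :: "'k \<times> real"
  obtain B0 where B0: "\<And>x. \<bar>F x\<bar> \<le> B0" using F_ub by (auto simp: ubounded_def)
  have ub_ff: "ubounded ff" by (rule uboundedI[of _ C]) (use f_bounds in \<open>auto simp: ff_def\<close>)
  have ub_lam: "ubounded lam" by (rule uboundedI[of _ lamstar]) (use lam_bounds in \<open>auto simp: abs_of_pos\<close>)
  define E0 where "E0 \<tau> x = U \<tau> x - (F x - \<tau> * b x + \<tau>\<^sup>2 / 2 * c x)" for \<tau> x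
  have R0: "ubounded (E0 \<tau>)" if "0 \<le> \<tau>" "\<tau> \<le> T" for \<tau>
  proof (rule uboundedI)
    show "\<bar>E0 \<tau> x\<bar> \<le> K * T * T * T" for x
      using u_expansion[OF that, of "fst x" "snd x"] by (simp add: E0_def U_def b_def c_def)
  qed
  define E1 where "E1 \<tau> x = Ut \<tau> x - (b x - \<tau> * c x)" for \<tau> x
  define E2 where "E2 \<tau> x = Us \<tau> x - (Fn x - \<tau> * d x)" for \<tau> x
  have R1: "ubounded (E1 \<tau>)" if "0 \<le> \<tau>" "\<tau> \<le> T" for \<tau>
    using ut_expansion[OF that] unfolding E1_def[abs_def] Ut_def b_def c_def by (intro uboundedI)
  have R2: "ubounded (E2 \<tau>)" if "0 \<le> \<tau>" "\<tau> \<le> T" for \<tau>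
    using un_expansion[OF that] unfolding E2_def[abs_def] Us_def Fn_def d_def by (intro uboundedI)
  \<comment> \<open>At time \<open>T\<close> the solution is the bounded function \<open>F\<close>,
    and its second space derivative is Lipschitz uniformly in the mode.\<close>
  have ub_Fn: "ubounded Fn"
  proof (rule uboundedI)
    fix x :: "'k \<times> real"
    show "\<bar>Fn x\<bar> \<le> 6 * B0 + 2 * K"
      unfolding Fn_def
    proof (rule landau_bounds(2)[of "\<lambda>\<nu>. u T (fst x, \<nu>)" "\<lambda>\<nu>. u_n (fst x) (T, \<nu>)" "\<lambda>\<nu>. u_nn (fst x) (T, \<nu>)"])
    qed (use u_space[of T "fst x"] un_space[of T "fst x"] K_lip_space[OF K_lip(3), of T "fst x"] T_pos K_nonneg B0 u_terminal in auto)
  qed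
  have EQ: "Ut \<tau> x + ff x * Us \<tau> x + lam x * (I \<tau> x - U \<tau> x) = 0" if "0 < \<tau>" "\<tau> \<le> T" for \<tau> x
    using u_equation[of "T - \<tau>" "fst x" "snd x"] that unfolding Ut_def Us_def ff_def I_def U_def by simp
  have int: "integrable (Q x) (U \<tau>)" if "0 < \<tau>" "\<tau> \<le> T" for \<tau> x
    using u_integrable[of "T - \<tau>" x] that unfolding U_def by simp
  have ub_int: "ubounded (\<lambda>x. \<integral>y. g y \<partial>Q x)" if g: "ubounded g" for g
  proof -
    obtain B where "\<And>x. \<bar>g x\<bar> \<le> B" using g by (auto simp: ubounded_def)
    then show ?thesis by (intro uboundedI prob_space.abs_expectation_le[OF Q_prob])
  qed
  \<comment> \<open>The sample remaining times \<open>?h\<close>, \<open>2 * ?h\<close> and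
    \<open>3 * ?h\<close> lie in (0,T], where the equation is available.\<close>
  let ?h = "T / 3"
  have h: "0 < ?h" "?h \<le> T" "0 < 2 * ?h" "2 * ?h \<le> T" "0 < 3 * ?h" "3 * ?h \<le> T" using T_pos by auto
  have h0: "0 \<le> ?h" "0 \<le> 2 * ?h" "0 \<le> 3 * ?h" using T_pos by auto
  have ub_b: "ubounded b"
  proof -
    \<comment> \<open>The weights 3, -3, 1 annihilate \<tau> and its square and sum to 1. So
      \<open>V\<close> is \<open>F\<close> up to bounded terms, while in the same combination of the
      equations \<open>c\<close> and \<open>d\<close> cancel and \<open>b\<close> has coefficient
      1.\<close>
    define V where "V x = 3 * U ?h x - 3 * U (2 * ?h) x + U (3 * ?h) x" for x
    have eq: "V = (\<lambda>x. F x + (3 * E0 ?h x - 3 * E0 (2 * ?h) x + E0 (3 * ?h) x))"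
      by (rule ext) (simp add: V_def E0_def power2_eq_square field_simps)
    have ub_V: "ubounded V" by (subst eq, intro ubounded_intros R0 F_ub) (use h h0 in auto)
    have IV: "(\<integral>y. V y \<partial>Q x) = 3 * I ?h x - 3 * I (2 * ?h) x + I (3 * ?h) x" for x
      using int h by (simp add: I_def V_def)
    have "b x = - (ff x * (Fn x + (3 * E2 ?h x - 3 * E2 (2 * ?h) x + E2 (3 * ?h) x)))
       - lam x * ((\<integral>y. V y \<partial>Q x) - V x) - (3 * E1 ?h x - 3 * E1 (2 * ?h) x + E1 (3 * ?h) x)" for x
      using EQ[OF h(1,2), of x] EQ[OF h(3,4), of x] EQ[OF h(5,6), of x] unfolding IV unfolding E1_def E2_def V_def by (simp add: field_simps)
    moreover have "ubounded (\<lambda>x. (- 1) * (ff x * (Fn x + (3 * E2 ?h x - 3 * E2 (2 * ?h) x + E2 (3 * ?h) x)))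
       - lam x * ((\<integral>y. V y \<partial>Q x) - V x) - (3 * E1 ?h x - 3 * E1 (2 * ?h) x + E1 (3 * ?h) x))"
      by (intro ubounded_intros ub_ff ub_lam ub_Fn R1 R2 ub_int ub_V) (use h h0 in auto)
    ultimately have "ubounded (\<lambda>x. b x)" by simp
    then show ?thesis .
  qed
  have ub_d: "ubounded d"
  proof -
    obtain B where B: "\<And>x. \<bar>b x\<bar> \<le> B" using ub_b by (auto simp: ubounded_def)
    \<comment> \<open>By the mean value theorem a unit space increment of \<open>u 0 - u T\<close>
      is a difference of \<open>u_n\<close> in time, which is \<open>- T * d\<close> up to bounded
      terms. The expansion of \<open>u\<close> bounds this increment, since \<open>b\<close> is
      bounded and increments of \<open>c\<close> are at most \<open>K\<close>.\<close>
    have "\<bar>T * d x\<bar> \<le> 2 * (T * B) + T\<^sup>2 / 2 * K + 2 * (K * T * T * T) + K * T * T + T * K" for x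
    proof (cases x)
      case (Pair \<theta> \<nu>)
      let ?g = "\<lambda>\<nu>. U T (\<theta>, \<nu>) - F (\<theta>, \<nu>)"
      have "(?g has_real_derivative (u_n \<theta> (0, \<nu>) - u_n \<theta> (T, \<nu>))) (at \<nu>)" for \<nu>
        unfolding U_def u_terminal[symmetric]
        using u_space[of 0 \<theta> \<nu>] u_space[of T \<theta> \<nu>] T_pos by (auto intro!: derivative_intros)
      from real_MVT[OF this, of \<nu> "\<nu> + 1"] obtain \<xi> where \<xi>: "\<nu> < \<xi>" "\<xi> < \<nu> + 1"
        "?g (\<nu> + 1) - ?g \<nu> = u_n \<theta> (0, \<xi>) - u_n \<theta> (T, \<xi>)" by auto
      have 1: "\<bar>u_n \<theta> (0, \<xi>) - (u_n \<theta> (T, \<xi>) - T * u_nt \<theta> (T, \<xi>))\<bar> \<le> K * T * T"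
        using un_expansion[of T \<theta> \<xi>] T_pos by simp
      have 2: "\<bar>?g \<nu>' - (- T * b (\<theta>, \<nu>') + T\<^sup>2 / 2 * c (\<theta>, \<nu>'))\<bar> \<le> K * T * T * T" for \<nu>'
        using u_expansion[of T \<theta> \<nu>'] T_pos by (simp add: U_def b_def c_def algebra_simps)
      have 3: "\<bar>c (\<theta>, \<nu> + 1) - c (\<theta>, \<nu>)\<bar> \<le> K"
        using K_lip_space[OF K_lip(1), of T \<theta> "\<nu> + 1" \<nu>] T_pos by (simp add: c_def)
      have "T\<^sup>2 / 2 * \<bar>c (\<theta>, \<nu> + 1) - c (\<theta>, \<nu>)\<bar> \<le> T\<^sup>2 / 2 * K" using 3 by (intro mult_left_mono) auto
      then have 3: "\<bar>T\<^sup>2 / 2 * c (\<theta>, \<nu> + 1) - T\<^sup>2 / 2 * c (\<theta>, \<nu>)\<bar> \<le> T\<^sup>2 / 2 * K"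
        unfolding right_diff_distrib[symmetric] abs_mult by simp
      have 4: "\<bar>T * b (\<theta>, \<nu>')\<bar> \<le> T * B" for \<nu>' using B T_pos by (simp add: abs_mult)
      have "\<bar>u_nt \<theta> (T, \<nu>) - u_nt \<theta> (T, \<xi>)\<bar> \<le> K * 1"
        using K_lip_space[OF K_lip(2), of T \<theta> \<nu> \<xi>] T_pos \<xi> K_nonneg
        by (intro order_trans[OF _ mult_left_mono[of "\<bar>\<nu> - \<xi>\<bar>" 1 K]]) auto
      from mult_left_mono[OF this, of T] have 5: "\<bar>T * u_nt \<theta> (T, \<nu>) - T * u_nt \<theta> (T, \<xi>)\<bar> \<le> T * K"
        using T_pos by (simp add: right_diff_distrib[symmetric] abs_mult)
      have "\<bar>?g (\<nu> + 1) - ?g \<nu>\<bar> \<le> 2 * (T * B) + T\<^sup>2 / 2 * K + 2 * (K * T * T * T)"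
        using 2[of \<nu>] 2[of "\<nu> + 1"] 3 4[of \<nu>] 4[of "\<nu> + 1"] unfolding abs_le_iff
        by (elim conjE, intro conjI; linarith)
      then show ?thesis
        using 1 5 \<xi>(3) unfolding Pair d_def fst_conv snd_conv abs_le_iff
        by (elim conjE, intro conjI; linarith)
    qed
    then have "ubounded (\<lambda>x. T * d x)" by (rule uboundedI)
    from ubounded_cmult[OF this, of "1 / T"] show ?thesis using T_pos by simp
  qed
  have ub_c: "ubounded c"
  proof -
    \<comment> \<open>The weights 1 and -4 at \<open>2 * ?h\<close> and \<open>?h\<close> cancel the
      square of \<tau>, so \<open>c\<close> drops out of \<open>V\<close>; in the combination of the
      equations it remains with coefficient \<open>2 * ?h\<close>.\<close>
    define V where "V x = U (2 * ?h) x - 4 * U ?h x" for x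
    have eq: "V = (\<lambda>x. (- 3) * F x + (2 * ?h) * b x + (E0 (2 * ?h) x - 4 * E0 ?h x))"
      by (rule ext) (simp add: V_def E0_def power2_eq_square field_simps)
    have ub_V: "ubounded V" by (subst eq, intro ubounded_intros R0 F_ub ub_b) (use h h0 in auto)
    have IV: "(\<integral>y. V y \<partial>Q x) = I (2 * ?h) x - 4 * I ?h x" for x
      using int h by (simp add: I_def V_def)
    have "(2 * ?h) * c x = 3 * b x - ff x * ((- 3) * Fn x + (2 * ?h) * d x + (E2 (2 * ?h) x - 4 * E2 ?h x))
       - lam x * ((\<integral>y. V y \<partial>Q x) - V x) - (E1 (2 * ?h) x - 4 * E1 ?h x)" for x
      using EQ[OF h(1,2), of x] EQ[OF h(3,4), of x] unfolding IV unfolding E1_def E2_def V_def by (simp add: field_simps)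
    moreover have "ubounded (\<lambda>x. 3 * b x - ff x * ((- 3) * Fn x + (2 * ?h) * d x + (E2 (2 * ?h) x - 4 * E2 ?h x))
       - lam x * ((\<integral>y. V y \<partial>Q x) - V x) - (E1 (2 * ?h) x - 4 * E1 ?h x))"
      by (intro ubounded_intros ub_ff ub_lam ub_Fn ub_b ub_d R1 R2 ub_int ub_V) (use h h0 in auto)
    ultimately have "ubounded (\<lambda>x. (2 * ?h) * c x)" by (simp only:)
    from ubounded_cmult[OF this, of "1 / (2 * ?h)"] show ?thesis using T_pos by simp
  qed
  obtain Bb Bc where Bb: "\<And>x. \<bar>b x\<bar> \<le> Bb" and Bc: "\<And>x. \<bar>c x\<bar> \<le> Bc"
    using ub_b ub_c by (auto simp: ubounded_def)
  have "\<bar>u t x\<bar> \<le> B0 + T * Bb + T\<^sup>2 / 2 * Bc + K * T * T * T" if t: "t \<in> {0..T}" for t x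
  proof -
    have 1: "\<bar>(T - t) * b x\<bar> \<le> T * Bb" unfolding abs_mult using t Bb[of x] by (intro mult_mono) auto
    have 2: "\<bar>(T - t)\<^sup>2 / 2 * c x\<bar> \<le> T\<^sup>2 / 2 * Bc" unfolding abs_mult
      using t Bc[of x] by (intro mult_mono) (auto intro!: power_mono)
    have "\<bar>u t x - (F x - (T - t) * b x + (T - t)\<^sup>2 / 2 * c x)\<bar> \<le> K * T * T * T"
      using u_expansion[of "T - t" "fst x" "snd x"] t by (simp add: b_def c_def)
    with 1 2 B0[of x] show ?thesis by linarith
  qed
  then show ?thesis by blast
qed

lemma derivatives_uniformly_bounded:
  "\<exists>B. \<forall>t\<in>{0..T}. \<forall>\<theta> \<nu>. \<bar>u t (\<theta>, \<nu>)\<bar> \<le> B \<and> \<bar>u_n \<theta> (t, \<nu>)\<bar> \<le> B \<and> \<bar>u_nn \<theta> (t, \<nu>)\<bar> \<le> B \<and> \<bar>u_nt \<theta> (t, \<nu>)\<bar> \<le> B"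
proof -
  obtain B where B: "\<And>t x. t \<in> {0..T} \<Longrightarrow> \<bar>u t x\<bar> \<le> B" using u_uniformly_bounded by blast
  have 1: "\<bar>u_nn \<theta> (t, \<nu>)\<bar> \<le> 4 * B + 2 * K" "\<bar>u_n \<theta> (t, \<nu>)\<bar> \<le> 6 * B + 2 * K" if t: "t \<in> {0..T}" for t \<theta> \<nu>
    by (rule landau_bounds[of "\<lambda>\<nu>. u t (\<theta>, \<nu>)" "\<lambda>\<nu>. u_n \<theta> (t, \<nu>)" "\<lambda>\<nu>. u_nn \<theta> (t, \<nu>)"];
        fact u_space[OF t] un_space[OF t] B[OF t] K_lip_space[OF K_lip(3) t] K_nonneg)+
  \<comment> \<open>The expansion of \<open>u_n\<close> over all of [0,T] expresses
    \<open>T * u_nt\<close> at \<open>T\<close> by two values of \<open>u_n\<close>, each at most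
    \<open>6 * B + 2 * K\<close>; the Lipschitz constant then moves it to time
    \<open>t\<close>.\<close>
  have 2: "\<bar>u_nt \<theta> (t, \<nu>)\<bar> \<le> (12 * B + 4 * K + K * T * T) / T + K * T" if t: "t \<in> {0..T}" for t \<theta> \<nu>
  proof -
    have "\<bar>u_n \<theta> (0, \<nu>) - (u_n \<theta> (T, \<nu>) - T * u_nt \<theta> (T, \<nu>))\<bar> \<le> K * T * T"
      using un_expansion[of T \<theta> \<nu>] T_pos by simp
    then have "\<bar>T * u_nt \<theta> (T, \<nu>)\<bar> \<le> 12 * B + 4 * K + K * T * T"
      using 1(2)[of 0 \<theta> \<nu>] 1(2)[of T \<theta> \<nu>] T_pos by auto
    then have "\<bar>u_nt \<theta> (T, \<nu>)\<bar> \<le> (12 * B + 4 * K + K * T * T) / T"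
      using T_pos by (simp add: abs_mult field_simps)
    then show ?thesis using K_lip_time[OF K_lip(2) t, of T \<theta> \<nu>] T_pos by auto
  qed
  have "0 \<le> B" using B[of T undefined] T_pos by force
  then have 3: "0 \<le> (12 * B + 4 * K + K * T * T) / T + K * T" using T_pos K_nonneg by simp
  let ?B = "6 * B + 2 * K + ((12 * B + 4 * K + K * T * T) / T + K * T)"
  show ?thesis
  proof (intro exI[of _ ?B] ballI allI)
    fix t \<theta> \<nu> assume t: "t \<in> {0..T}"
    show "\<bar>u t (\<theta>, \<nu>)\<bar> \<le> ?B \<and> \<bar>u_n \<theta> (t, \<nu>)\<bar> \<le> ?B \<and> \<bar>u_nn \<theta> (t, \<nu>)\<bar> \<le> ?B \<and> \<bar>u_nt \<theta> (t, \<nu>)\<bar> \<le> ?B"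
      using 1[OF t, of \<theta> \<nu>] 2[OF t, of \<theta> \<nu>] B[OF t, of "(\<theta>, \<nu>)"] \<open>0 \<le> B\<close> K_nonneg 3 by linarith
  qed
qed

end


section \<open>Consistency of the backward solution\<close>

text \<open>The increments of \<open>V\<close> are recovered from its derivative \<open>D\<close>
  off a finite set, and \<open>D + g\<close> is small. The gauge integral is used for
  \<open>D\<close>, whose Lebesgue integrability is not at hand.\<close>

lemma FTC_residual:
  fixes V :: "real \<Rightarrow> real"
  assumes t: "0 \<le> t" and S: "finite S" and \<epsilon>: "0 \<le> \<epsilon>" and cont: "continuous_on {0..t} V"
    and D: "\<And>r. 0 < r \<Longrightarrow> r < t \<Longrightarrow> r \<notin> S \<Longrightarrow> (V has_real_derivative D r) (at r)"
    and le: "\<And>r. 0 < r \<Longrightarrow> r < t \<Longrightarrow> r \<notin> S \<Longrightarrow> \<bar>D r + g r\<bar> \<le> \<epsilon>"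
    and g: "set_integrable lborel {0..t} g"
  shows "\<bar>V t - V 0 + (LINT r:{0..t}|lborel. g r)\<bar> \<le> \<epsilon> * t"
proof -
  have 1: "(D has_integral (V t - V 0)) {0..t}"
    by (rule fundamental_theorem_of_calculus_interior_strong[OF S t _ cont])
       (use D in \<open>auto simp: has_real_derivative_iff_has_vector_derivative[symmetric]\<close>)
  have 2: "(g has_integral (LINT r:{0..t}|lborel. g r)) {0..t}"
    using set_borel_integral_eq_integral[OF g] by (auto simp: has_integral_integral)
  have "norm (V t - V 0 + (LINT r:{0..t}|lborel. g r)) \<le> \<epsilon> * measure lborel (cbox 0 t)"
  proof (rule has_integral_bound_spike_finite[OF \<epsilon>, where S="insert 0 (insert t S)" and f="\<lambda>r. D r + g r"])
    show "((\<lambda>r. D r + g r) has_integral V t - V 0 + (LINT r:{0..t}|lborel. g r)) (cbox 0 t)"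
      using has_integral_add[OF 1 2] by simp
    show "norm (D r + g r) \<le> \<epsilon>" if "r \<in> cbox 0 t - insert 0 (insert t S)" for r
      using le[of r] that by auto
  qed (use S in auto)
  then show ?thesis using t by simp
qed

lemma power_over_fact_tendsto_0: "(\<lambda>n. x ^ n / fact n) \<longlonglongrightarrow> (0 :: real)"
  using summable_LIMSEQ_zero[OF summable_exp[of x]] by (simp add: field_simps)

lemma has_partials_on_chain:
  assumes g: "has_partials_on g g\<^sub>1 g\<^sub>2 ({0..T} \<times> UNIV)" and "0 < a + r" "a + r < T"
    and y: "(y has_real_derivative y') (at r)"
  shows "((\<lambda>r. g (a + r, y r)) has_real_derivative g\<^sub>1 (a + r, y r) + g\<^sub>2 (a + r, y r) * y') (at r)"
proof -
  let ?z = "(a + r, y r)"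
  have "?z \<in> interior ({0..T} \<times> UNIV)" using assms by (simp add: interior_Times interior_atLeastAtMost_real)
  then have "at ?z within {0..T} \<times> UNIV = at ?z" by (rule at_within_interior)
  moreover have "(g has_derivative (\<lambda>v. g\<^sub>1 ?z * fst v + g\<^sub>2 ?z * snd v)) (at ?z within {0..T} \<times> UNIV)"
    using g assms by (auto simp: has_partials_on_def)
  ultimately have "(g has_derivative (\<lambda>v. g\<^sub>1 ?z * fst v + g\<^sub>2 ?z * snd v)) (at ?z)" by simp
  moreover have "((\<lambda>r. (a + r, y r)) has_derivative (\<lambda>h. (h, y' * h))) (at r)"
  proof (rule has_derivative_Pair)
    show "((\<lambda>r. a + r) has_derivative (\<lambda>h. h)) (at r)" by (auto intro!: derivative_eq_intros)
    show "(y has_derivative (\<lambda>h. y' * h)) (at r)" using y by (simp add: has_field_derivative_def)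
  qed
  ultimately have "((\<lambda>r. g (a + r, y r)) has_derivative (\<lambda>h. g\<^sub>1 ?z * h + g\<^sub>2 ?z * (y' * h))) (at r)"
    using has_derivative_compose[of "\<lambda>r. (a + r, y r)" "\<lambda>h. (h, y' * h)" r UNIV g] by fastforce
  moreover have "(\<lambda>h. g\<^sub>1 ?z * h + g\<^sub>2 ?z * (y' * h)) = (*) (g\<^sub>1 ?z + g\<^sub>2 ?z * y')"
    by (auto simp: algebra_simps)
  ultimately show ?thesis by (simp only: has_field_derivative_def)
qed

text \<open>The primitive of the sawtooth \<open>a - grid h a - h / 2\<close>; its size \<open>O(h\<^sup>2)\<close> is what makes the local errors
  of the polygon average out to half a step.\<close>

definition sawtooth :: "real \<Rightarrow> real \<Rightarrow> real" where
  "sawtooth h a = (a - grid h a) * (a - grid h a - h) / 2"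

lemma sawtooth_bound: assumes "0 < h" "0 \<le> a" shows "\<bar>sawtooth h a\<bar> \<le> h\<^sup>2"
proof -
  have "\<bar>(a - grid h a) * (a - grid h a - h)\<bar> \<le> h * h"
    unfolding abs_mult using grid_bounds[OF assms] by (intro mult_mono) auto
  then show ?thesis by (simp add: sawtooth_def power2_eq_square)
qed

lemma sawtooth_derivative:
  assumes "0 < h" "0 < a" "\<not> on_grid h a"
  shows "(sawtooth h has_real_derivative (a - grid h a - h / 2)) (at a)"
proof -
  obtain i where i: "real i * h < a" "a < real (Suc i) * h" using off_grid_cell[OF assms] .
  let ?p = "\<lambda>a. (a - real i * h) * (a - real i * h - h) / 2"
  have "(?p has_real_derivative (a - real i * h - h / 2)) (at a)"
    by (auto intro!: derivative_eq_intros simp: field_simps)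
  then have "(sawtooth h has_real_derivative (a - real i * h - h / 2)) (at a)"
  proof (rule has_field_derivative_transform_within_open)
    show "open {real i * h<..<real (Suc i) * h}" "a \<in> {real i * h<..<real (Suc i) * h}" using i by auto
    show "?p x = sawtooth h x" if "x \<in> {real i * h<..<real (Suc i) * h}" for x
      using grid_cell[OF assms(1), of i x] that by (auto simp: sawtooth_def)
  qed
  moreover have "grid h a = real i * h" by (rule grid_cell) (use assms i in auto)
  ultimately show ?thesis by simp
qed

text \<open>Continuity across grid points is what lets the fundamental theorem ignore the finite set
  of corners; there the sawtooth vanishes.\<close>

lemma sawtooth_continuous:
  assumes h: "0 < h" shows "continuous_on {0..} (sawtooth h)"
  unfolding continuous_on_eq_continuous_within
proof
  fix a :: real assume "a \<in> {0..}"
  then have a: "0 \<le> a" by simp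
  show "continuous (at a within {0..}) (sawtooth h)"
  proof (cases "on_grid h a")
    case False
    then have "a \<noteq> 0" by (auto simp: on_grid_def)
    with sawtooth_derivative[OF h _ False] a have "isCont (sawtooth h) a" by (intro DERIV_isCont) auto
    then show ?thesis by (rule continuous_at_imp_continuous_at_within)
  next
    case True
    then obtain i :: nat where i: "a = real i * h" by (auto simp: on_grid_def)
    have zero: "sawtooth h a = 0" using grid_cell[OF h, of i a] i h by (simp add: sawtooth_def algebra_simps)
    have bound: "\<bar>sawtooth h x\<bar> \<le> h * \<bar>x - a\<bar>" if x: "0 \<le> x" "\<bar>x - a\<bar> < h" for x
    proof -
      note g = grid_bounds[OF h x(1)]
      \<comment> \<open>To the right of the grid point \<open>a\<close> the first factor is the
        distance to \<open>a\<close>, to the left the second one is; the other factor is at most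
        \<open>h\<close>.\<close>
      have "\<bar>x - grid h x\<bar> * \<bar>x - grid h x - h\<bar> \<le> h * \<bar>x - a\<bar>"
      proof (cases "a \<le> x")
        case True
        then have "grid h x = a" using grid_cell[OF h, of i x] x i by (auto simp: algebra_simps)
        with g show ?thesis by (subst mult.commute) (intro mult_mono, auto)
      next
        case False
        with x i a have "i \<noteq> 0" by (cases i) auto
        then obtain j where j: "i = Suc j" by (cases i) auto
        then have "grid h x = a - h" using grid_cell[OF h, of j x] False x i by (auto simp: algebra_simps)
        with g show ?thesis by (intro mult_mono) auto
      qed
      then show ?thesis using h by (simp add: sawtooth_def abs_mult) (smt (verit) mult_nonneg_nonneg abs_ge_zero)
    qed
    have "(sawtooth h \<longlongrightarrow> 0) (at a within {0..})"
    proof (rule Lim_null_comparison)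
      have "\<forall>\<^sub>F x in at a within {0..}. x \<in> {0..} \<and> \<bar>x - a\<bar> < h"
        using h by (auto simp: eventually_at dist_real_def intro!: exI[of _ h])
      then show "\<forall>\<^sub>F x in at a within {0..}. norm (sawtooth h x) \<le> h * \<bar>x - a\<bar>"
        by eventually_elim (use bound in auto)
      have "((\<lambda>x. h * \<bar>x - a\<bar>) \<longlongrightarrow> h * \<bar>a - a\<bar>) (at a within {0..})" by (intro tendsto_intros)
      then show "((\<lambda>x. h * \<bar>x - a\<bar>) \<longlongrightarrow> 0) (at a within {0..})" by simp
    qed
    then show ?thesis by (simp add: continuous_within zero)
  qed
qed

text \<open>The indicator cuts off times outside [0,T], where continuity of \<open>G\<close> is
  unknown.\<close>

lemma measurable_time_state:
  fixes G :: "'k::countable \<Rightarrow> real \<times> real \<Rightarrow> real"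
  assumes G: "\<And>\<theta>. continuous_on ({0..T} \<times> UNIV) (G \<theta>)"
  shows "(\<lambda>(q, y). indicator {0..T} q * G (fst y) (T - q, snd y)) \<in> borel_measurable (borel \<Otimes>\<^sub>M state_space)"
proof -
  have c: "(\<lambda>(q, \<nu>). indicator {0..T} q * G \<theta> (T - q, \<nu>)) \<in> borel_measurable (borel \<Otimes>\<^sub>M borel)" for \<theta>
  proof -
    have "continuous_on ({0..T} \<times> UNIV) (\<lambda>z::real \<times> real. G \<theta> (T - fst z, snd z))"
      by (rule continuous_on_compose2[OF G]) (auto intro!: continuous_intros)
    then have "(\<lambda>z::real \<times> real. indicator ({0..T} \<times> UNIV) z *\<^sub>R G \<theta> (T - fst z, snd z)) \<in> borel_measurable borel"
      by (intro borel_measurable_continuous_on_indicator) (auto simp: borel_closed closed_Times)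
    then show ?thesis
      by (simp add: borel_prod case_prod_beta' indicator_times mult.assoc)
  qed
  have "(\<lambda>z. (\<lambda>\<theta> z. indicator {0..T} (fst z) * G \<theta> (T - fst z, snd (snd z))) (fst (snd z)) z) \<in> borel_measurable (borel \<Otimes>\<^sub>M state_space)"
  proof (rule measurable_compose_countable)
    show "(\<lambda>z. indicator {0..T} (fst z) * G \<theta> (T - fst z, snd (snd z))) \<in> borel_measurable (borel \<Otimes>\<^sub>M (state_space :: ('k \<times> real) measure))" for \<theta>
      using measurable_compose[OF _ c[of \<theta>], of "\<lambda>z. (fst z, snd (snd z))" "borel \<Otimes>\<^sub>M (state_space :: ('k \<times> real) measure)"]
      by simp
    show "(\<lambda>z. fst (snd z)) \<in> borel \<Otimes>\<^sub>M (state_space :: ('k \<times> real) measure) \<rightarrow>\<^sub>M count_space UNIV" by measurable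
  qed
  then show ?thesis by (simp add: case_prod_beta')
qed

section \<open>The backward solution as an approximate fixed point\<close>

context backward_solution begin

text \<open>The candidate fixed point: the discounted solution at the state that the flow has
  reached at age \<open>s\<close>.\<close>

definition value_weight :: "('k \<Rightarrow> real \<Rightarrow> real \<Rightarrow> real) \<Rightarrow> 'k weight" where
  "value_weight \<Phi> t s x = indicator {0..T} t * (exp (lamstar * t) * u (T - t) (flow_map \<Phi> s x))"

text \<open>To first order \<open>f(y) - f(y_grid)\<close> is \<open>f * f1\<close> times the time
  since the last grid point, on average \<open>h / 2\<close>. The minus sign reflects that the
  polygon uses the slope of an earlier position; the discount is included.\<close>

definition local_error :: "real \<Rightarrow> 'k \<times> real \<Rightarrow> real" where
  "local_error q y = indicator {0..T} q *
     (- 1 / 2 * (exp (lamstar * q) * (f (fst y) (snd y) * f1 (fst y) (snd y) * u_n (fst y) (T - q, snd y))))"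

lemma value_weight_measurable:
  assumes \<Phi>: "measurable_flow \<Phi>" shows "measurable_weight (value_weight \<Phi>)"
proof (rule measurable_weightI)
  have "(\<lambda>(q, y). indicator {0..T} q * (case (T - q, snd y) of (t, \<nu>) \<Rightarrow> u t (fst y, \<nu>))) \<in> borel_measurable (borel \<Otimes>\<^sub>M state_space)"
    by (rule measurable_time_state) (rule has_partials_on_continuous[OF u_partials])
  then have m: "(\<lambda>z. indicator {0..T} (fst z) * u (T - fst z) (snd z)) \<in> borel_measurable (borel \<Otimes>\<^sub>M state_space)"
    by (simp add: case_prod_beta')
  have fm: "(\<lambda>z. flow_map \<Phi> (fst (snd z)) (snd (snd z))) \<in> borel \<Otimes>\<^sub>M (borel \<Otimes>\<^sub>M state_space) \<rightarrow>\<^sub>M (state_space :: ('k \<times> real) measure)"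
    by (rule measurable_flow_map[OF \<Phi>]) measurable
  have [measurable]: "(\<lambda>z. indicator {0..T} (fst z) * u (T - fst z) (flow_map \<Phi> (fst (snd z)) (snd (snd z)))) \<in> borel_measurable (borel \<Otimes>\<^sub>M (borel \<Otimes>\<^sub>M (state_space :: ('k \<times> real) measure)))"
    using measurable_compose[OF measurable_Pair[OF measurable_fst fm] m] by simp
  have "(\<lambda>z. exp (lamstar * fst z) * (indicator {0..T} (fst z) * u (T - fst z) (flow_map \<Phi> (fst (snd z)) (snd (snd z))))) \<in> borel_measurable (borel \<Otimes>\<^sub>M (borel \<Otimes>\<^sub>M (state_space :: ('k \<times> real) measure)))"
    by measurable
  then show "(\<lambda>z. value_weight \<Phi> (fst z) (fst (snd z)) (snd (snd z))) \<in> borel_measurable (borel \<Otimes>\<^sub>M (borel \<Otimes>\<^sub>M state_space))"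
    by (simp add: value_weight_def mult_ac)
qed

lemma local_error_measurable: "(\<lambda>(q, y). local_error q y) \<in> borel_measurable (borel \<Otimes>\<^sub>M state_space)"
proof -
  let ?G = "\<lambda>\<theta> z. - 1 / 2 * (exp (lamstar * (T - fst z)) * (f \<theta> (snd z) * f1 \<theta> (snd z) * u_n \<theta> z))"
  have c: "continuous_on UNIV (f \<theta>)" "continuous_on UNIV (f1 \<theta>)" for \<theta>
    using f1 f2 by (meson DERIV_isCont continuous_at_imp_continuous_on)+
  have "(\<lambda>(q, y). indicator {0..T} q * ?G (fst y) (T - q, snd y)) \<in> borel_measurable (borel \<Otimes>\<^sub>M state_space)"
    by (rule measurable_time_state)
       (auto intro!: continuous_intros continuous_on_compose2[OF c(1)] continuous_on_compose2[OF c(2)] has_partials_on_continuous[OF un_partials])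
  then show ?thesis by (simp add: local_error_def case_prod_beta')
qed

lemma f_lip: "\<bar>f \<theta> \<nu> - f \<theta> \<nu>'\<bar> \<le> C * \<bar>\<nu> - \<nu>'\<bar>" and f1_lip: "\<bar>f1 \<theta> \<nu> - f1 \<theta> \<nu>'\<bar> \<le> C * \<bar>\<nu> - \<nu>'\<bar>"
  using field_differentiable_bound[of UNIV "f \<theta>" "f1 \<theta>" C \<nu> \<nu>'] field_differentiable_bound[of UNIV "f1 \<theta>" "f2 \<theta>" C \<nu> \<nu>'] f1 f2 f_bounds
  by auto

lemma f_measurable: "f \<theta> \<in> borel_measurable borel"
  using f1 by (intro borel_measurable_continuous_onI continuous_at_imp_continuous_on) (blast intro: DERIV_isCont)

context
  fixes B :: real
  assumes B: "\<And>t \<theta> \<nu>. t \<in> {0..T} \<Longrightarrow>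
    \<bar>u t (\<theta>, \<nu>)\<bar> \<le> B \<and> \<bar>u_n \<theta> (t, \<nu>)\<bar> \<le> B \<and> \<bar>u_nn \<theta> (t, \<nu>)\<bar> \<le> B \<and> \<bar>u_nt \<theta> (t, \<nu>)\<bar> \<le> B"
begin

lemma B_nonneg: "0 \<le> B"
  using B[of 0 undefined undefined] T_pos by auto

lemma value_weight_bounded: "weight_bounded T (exp (lamstar * T) * B) (value_weight \<Phi>)"
proof (rule weight_boundedI)
  fix t s :: real and x assume t: "0 \<le> t" "t \<le> T"
  have "\<bar>u (T - t) (flow_map \<Phi> s x)\<bar> \<le> B" using B[of "T - t"] t by (simp add: flow_map_def)
  moreover have "exp (lamstar * t) \<le> exp (lamstar * T)" using t lamstar_pos by simp
  ultimately show "\<bar>value_weight \<Phi> t s x\<bar> \<le> exp (lamstar * T) * B"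
    unfolding value_weight_def using t by (auto simp: abs_mult intro!: mult_mono)
qed

text \<open>The backward equation replaces \<open>u_t\<close>; its jump part and the derivative of
  the discount combine to minus the jump integrand. What remains is the slope defect
  \<open>y' - f\<close> of the trajectory, tested against \<open>u_n\<close>.\<close>

lemma value_derivative:
  assumes \<Phi>0: "\<And>\<theta> \<nu>. \<Phi> \<theta> 0 \<nu> = \<nu>" and t: "0 \<le> t" "t \<le> T" and r: "0 < r" "r < t"
    and y: "((\<lambda>r. \<Phi> \<theta> (s + r) \<nu>) has_real_derivative y') (at r)"
  shows "((\<lambda>r. exp (lamstar * (t - r)) * u (T - t + r) (\<theta>, \<Phi> \<theta> (s + r) \<nu>)) has_real_derivative
     - jump_integrand \<Phi> (value_weight \<Phi>) t s (\<theta>, \<nu>) r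
     + exp (lamstar * (t - r)) * (y' - f \<theta> (\<Phi> \<theta> (s + r) \<nu>)) * u_n \<theta> (T - t + r, \<Phi> \<theta> (s + r) \<nu>)) (at r)"
proof -
  let ?y = "\<Phi> \<theta> (s + r) \<nu>" and ?e = "exp (lamstar * (t - r))" and ?\<tau> = "T - t + r"
  let ?I = "\<integral>z. u ?\<tau> z \<partial>Q (\<theta>, ?y)"
  have "((\<lambda>r. u (T - t + r) (\<theta>, \<Phi> \<theta> (s + r) \<nu>)) has_real_derivative
      u_t \<theta> (?\<tau>, ?y) + u_n \<theta> (?\<tau>, ?y) * y') (at r)"
    using has_partials_on_chain[OF u_partials _ _ y, of "T - t" \<theta>] t r by simp
  then have 1: "((\<lambda>r. exp (lamstar * (t - r)) * u (T - t + r) (\<theta>, \<Phi> \<theta> (s + r) \<nu>)) has_real_derivative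
     (- lamstar * ?e) * u ?\<tau> (\<theta>, ?y) + (u_t \<theta> (?\<tau>, ?y) + u_n \<theta> (?\<tau>, ?y) * y') * ?e) (at r)"
    by (intro DERIV_mult) (auto intro!: derivative_eq_intros)
  have I: "(\<integral>z. value_weight \<Phi> (t - r) 0 z \<partial>Q (\<theta>, ?y)) = ?e * ?I"
    using t r by (simp add: value_weight_def flow_map_def \<Phi>0 algebra_simps)
  have J: "jump_integrand \<Phi> (value_weight \<Phi>) t s (\<theta>, \<nu>) r
     = (lamstar - lam (\<theta>, ?y)) * (?e * u ?\<tau> (\<theta>, ?y)) + lam (\<theta>, ?y) * (?e * ?I)"
    unfolding jump_integrand_def using t r
    by (simp only: flow_map_def fst_conv snd_conv I) (simp add: value_weight_def flow_map_def algebra_simps)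
  have "u_t \<theta> (?\<tau>, ?y) = - f \<theta> ?y * u_n \<theta> (?\<tau>, ?y) - lam (\<theta>, ?y) * (?I - u ?\<tau> (\<theta>, ?y))"
    using u_equation[of ?\<tau> \<theta> ?y] t r by simp
  note ut = this
  have eq: "(- lamstar * ?e) * u ?\<tau> (\<theta>, ?y) + (u_t \<theta> (?\<tau>, ?y) + u_n \<theta> (?\<tau>, ?y) * y') * ?e
     = - jump_integrand \<Phi> (value_weight \<Phi>) t s (\<theta>, \<nu>) r + ?e * (y' - f \<theta> ?y) * u_n \<theta> (?\<tau>, ?y)"
    unfolding J ut by (simp add: algebra_simps)
  show ?thesis using 1 unfolding eq .
qed

lemma value_continuous:
  assumes y: "continuous_on {0..t} y" and t: "0 \<le> t" "t \<le> T"
  shows "continuous_on {0..t} (\<lambda>r. exp (lamstar * (t - r)) * u (T - t + r) (\<theta>, y r))"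
    and "continuous_on {0..t} (\<lambda>r. u_n \<theta> (T - t + r, y r))"
proof -
  have p: "continuous_on {0..t} (\<lambda>r. (T - t + r, y r))" by (intro continuous_intros y)
  have "continuous_on {0..t} (\<lambda>r. (case (T - t + r, y r) of (t, \<nu>) \<Rightarrow> u t (\<theta>, \<nu>)))"
    by (rule continuous_on_compose2[OF has_partials_on_continuous[OF u_partials] p]) (use t in auto)
  then show "continuous_on {0..t} (\<lambda>r. exp (lamstar * (t - r)) * u (T - t + r) (\<theta>, y r))"
    by (intro continuous_intros) simp
  show "continuous_on {0..t} (\<lambda>r. u_n \<theta> (T - t + r, y r))"
    by (rule continuous_on_compose2[OF has_partials_on_continuous[OF un_partials] p]) (use t in auto)
qed

text \<open>For the exact flow the slope defect in \<open>value_derivative\<close> vanishes, so the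
  residual is 0.\<close>

lemma exact_consistency:
  assumes flow: "is_flow f \<phi>" and t: "0 \<le> t" "t \<le> T" "0 \<le> s"
  shows "\<bar>value_weight \<phi> t s x - terminal_weight \<phi> F t s x - jump_op \<phi> (value_weight \<phi>) t s x\<bar> \<le> 0"
proof (cases x)
  case (Pair \<theta> \<nu>)
  have \<Phi>: "measurable_flow \<phi>" by (rule measurable_flow_exact[OF flow f_lip C_nonneg])
  have \<phi>0: "\<phi> \<theta> 0 \<nu> = \<nu>" for \<theta> \<nu> using flow by (simp add: is_flow_def)
  let ?y = "\<lambda>r. \<phi> \<theta> (s + r) \<nu>"
  let ?V = "\<lambda>r. exp (lamstar * (t - r)) * u (T - t + r) (\<theta>, ?y r)"
  have y: "(?y has_real_derivative f \<theta> (?y r)) (at r)" for r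
    using flow DERIV_shift[of "\<lambda>s. \<phi> \<theta> s \<nu>" "f \<theta> (?y r)" r s] by (simp add: is_flow_def add.commute)
  have "\<bar>?V t - ?V 0 + (LINT r:{0..t}|lborel. jump_integrand \<phi> (value_weight \<phi>) t s (\<theta>, \<nu>) r)\<bar> \<le> 0 * t"
  proof (rule FTC_residual[where S="{}"])
    show "continuous_on {0..t} ?V"
      by (rule value_continuous[OF _ t(1,2)]) (rule DERIV_atLeastAtMost_imp_continuous_on, use y in blast)
    show "(?V has_real_derivative - jump_integrand \<phi> (value_weight \<phi>) t s (\<theta>, \<nu>) r) (at r)" if "0 < r" "r < t" for r
      using value_derivative[where \<Phi>=\<phi>, OF \<phi>0 t(1,2) that y] by simp
    show "set_integrable lborel {0..t} (jump_integrand \<phi> (value_weight \<phi>) t s (\<theta>, \<nu>))"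
      by (rule jump_integrand_integrable[OF \<Phi> value_weight_measurable[OF \<Phi>] value_weight_bounded t(2,3)])
  qed (use t in auto)
  then show ?thesis using t Pair
    by (simp add: jump_op_def value_weight_def terminal_weight_def flow_map_def u_terminal)
qed

lemma local_error_bound:
  assumes "0 \<le> q" "q \<le> T"
  shows "\<bar>local_error q y\<bar> \<le> exp (lamstar * T) * (C * C * B)"
proof -
  let ?X = "exp (lamstar * q) * (f (fst y) (snd y) * f1 (fst y) (snd y) * u_n (fst y) (T - q, snd y))"
  have "\<bar>?X\<bar> \<le> exp (lamstar * T) * (C * C * B)"
    unfolding abs_mult using f_bounds B[of "T - q"] assms C_nonneg B_nonneg lamstar_pos by (intro mult_mono) auto
  moreover have "local_error q y = - (?X / 2)" using assms by (simp add: local_error_def)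
  ultimately show ?thesis by linarith
qed

lemma taylor_field: "\<bar>f \<theta> \<nu>' - f \<theta> \<nu> - (\<nu>' - \<nu>) * f1 \<theta> \<nu>\<bar> \<le> C * (\<nu>' - \<nu>)\<^sup>2"
proof -
  have "norm ((f \<theta> \<nu>' - \<nu>' * f1 \<theta> \<nu>) - (f \<theta> \<nu> - \<nu> * f1 \<theta> \<nu>)) \<le> C * \<bar>\<nu>' - \<nu>\<bar> * norm (\<nu>' - \<nu>)"
  proof (rule field_differentiable_bound[where S="closed_segment \<nu> \<nu>'" and f="\<lambda>x. f \<theta> x - x * f1 \<theta> \<nu>" and f'="\<lambda>x. f1 \<theta> x - f1 \<theta> \<nu>"])
    show "((\<lambda>x. f \<theta> x - x * f1 \<theta> \<nu>) has_field_derivative f1 \<theta> x - f1 \<theta> \<nu>) (at x within closed_segment \<nu> \<nu>')" for x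
      by (rule has_field_derivative_at_within) (auto intro!: derivative_eq_intros f1)
    show "norm (f1 \<theta> x - f1 \<theta> \<nu>) \<le> C * \<bar>\<nu>' - \<nu>\<bar>" if x: "x \<in> closed_segment \<nu> \<nu>'" for x
    proof -
      have "\<bar>x - \<nu>\<bar> \<le> \<bar>\<nu>' - \<nu>\<bar>" using segment_bound(1)[OF x] by simp
      then show ?thesis using f1_lip[of \<theta> x \<nu>] mult_left_mono[OF _ C_nonneg] by (metis order_trans real_norm_def)
    qed
  qed auto
  then show ?thesis by (simp add: algebra_simps power2_eq_square)
qed

text \<open>Three sources: \<open>2 * C ^ 3 * B\<close> from expanding the field within a cell, the
  next bracket from the derivative of the integrand multiplying the sawtooth, both over time
  \<open>T\<close>, and \<open>2 * (C\<^sup>2 * B)\<close> from the sawtooth terms at the two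
  ends.\<close>

definition consistency_const :: real where
  "consistency_const = exp (lamstar * T) *
     ((2 * C ^ 3 * B + (lamstar * (C\<^sup>2 * B) + 2 * C ^ 3 * B + C\<^sup>2 * (B + B * C))) * T + 2 * (C\<^sup>2 * B))"

lemma euler_consistency:
  assumes h: "0 < h" and t: "0 \<le> t" "t \<le> T" "0 \<le> s"
  defines "\<Phi> \<equiv> euler_flow f h"
  shows "\<bar>value_weight \<Phi> t s x - (terminal_weight \<Phi> F t s x + (- h) * running_weight local_error \<Phi> t s x)
      - jump_op \<Phi> (value_weight \<Phi>) t s x\<bar> \<le> consistency_const * h\<^sup>2"
proof (cases x)
  case (Pair \<theta> \<nu>)
  have \<Phi>: "measurable_flow \<Phi>" unfolding \<Phi>_def by (rule measurable_flow_euler[OF f_measurable])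
  have \<Phi>0: "\<Phi> \<theta> 0 \<nu> = \<nu>" for \<theta> \<nu> unfolding \<Phi>_def by (rule euler_flow_0[OF h])
  have fC: "\<bar>f \<theta> \<nu>\<bar> \<le> C" "\<bar>f1 \<theta> \<nu>\<bar> \<le> C" "\<bar>f2 \<theta> \<nu>\<bar> \<le> C" for \<theta> \<nu> using f_bounds by auto
  let ?y = "\<lambda>r. \<Phi> \<theta> (s + r) \<nu>" and ?yg = "\<lambda>r. \<Phi> \<theta> (grid h (s + r)) \<nu>" and ?\<rho> = "\<lambda>r. s + r - grid h (s + r)"
  let ?e = "\<lambda>r. exp (lamstar * (t - r))" and ?E = "exp (lamstar * T)"
  let ?un = "\<lambda>r. u_n \<theta> (T - t + r, ?y r)"
  let ?V = "\<lambda>r. ?e r * u (T - t + r) (\<theta>, ?y r)"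
  let ?\<chi> = "\<lambda>r. ?e r * (f \<theta> (?y r) * f1 \<theta> (?y r) * ?un r)"
  let ?\<chi>' = "\<lambda>r. - lamstar * ?\<chi> r + ?e r * ((f1 \<theta> (?y r) * f \<theta> (?yg r) * f1 \<theta> (?y r) + f \<theta> (?y r) * (f2 \<theta> (?y r) * f \<theta> (?yg r))) * ?un r
      + f \<theta> (?y r) * f1 \<theta> (?y r) * (u_nt \<theta> (T - t + r, ?y r) + u_nn \<theta> (T - t + r, ?y r) * f \<theta> (?yg r)))"
  let ?p = "\<lambda>r. sawtooth h (s + r)"
  let ?J = "jump_integrand \<Phi> (value_weight \<Phi>) t s (\<theta>, \<nu>)"
  \<comment> \<open>The corrector \<open>?p * ?\<chi>\<close> has derivative
    \<open>(?\<rho> - h / 2) * ?\<chi>\<close> up to O(h^2), so it trades the oscillating distance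
    \<open>?\<rho>\<close> for its mean \<open>h / 2\<close>.\<close>
  let ?W = "\<lambda>r. ?V r + ?p r * ?\<chi> r"
  let ?S = "{r. 0 \<le> r \<and> r \<le> t \<and> on_grid h (s + r)}"
  let ?c1 = "2 * C ^ 3 * B" and ?c2 = "lamstar * (C\<^sup>2 * B) + 2 * C ^ 3 * B + C\<^sup>2 * (B + B * C)"
  have cont_y: "continuous_on {0..t} ?y"
  proof (rule continuous_on_compose2[where g="\<lambda>a. \<Phi> \<theta> a \<nu>" and t="{0..}"])
    show "continuous_on {0..} (\<lambda>a. \<Phi> \<theta> a \<nu>)" unfolding \<Phi>_def by (rule euler_flow_continuous[where f=f, OF fC(1) h])
  qed (use t in \<open>auto intro!: continuous_intros\<close>)
  have cont_f: "continuous_on UNIV (f \<theta>)" "continuous_on UNIV (f1 \<theta>)"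
    using f1 f2 by (meson DERIV_isCont continuous_at_imp_continuous_on)+
  have dy: "(?y has_real_derivative f \<theta> (?yg r)) (at r)" if "0 < r" "r \<notin> ?S" "r < t" for r
  proof -
    have "((\<lambda>a. \<Phi> \<theta> a \<nu>) has_real_derivative f \<theta> (?yg r)) (at (s + r))"
      unfolding \<Phi>_def by (rule euler_flow_derivative[OF h]) (use that t in auto)
    then show ?thesis using DERIV_shift[of "\<lambda>a. \<Phi> \<theta> a \<nu>" "f \<theta> (?yg r)" r s] by (simp add: add.commute)
  qed
  have \<tau>: "T - t + r \<in> {0..T}" if "0 \<le> r" "r \<le> t" for r using that t by auto
  have e: "\<bar>?e r\<bar> \<le> ?E" "0 \<le> ?e r" if "0 \<le> r" "r \<le> t" for r
    using that t lamstar_pos by (auto intro!: mult_left_mono)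
  have \<chi>b: "\<bar>?\<chi> r\<bar> \<le> ?E * (C\<^sup>2 * B)" if r: "0 \<le> r" "r \<le> t" for r
    unfolding abs_mult power2_eq_square using fC B[OF \<tau>[OF r]] e[OF r] C_nonneg B_nonneg by (intro mult_mono) auto
  have \<chi>'b: "\<bar>?\<chi>' r\<bar> \<le> ?E * ?c2" if r: "0 \<le> r" "r \<le> t" for r
  proof -
    have 1: "\<bar>- lamstar * ?\<chi> r\<bar> \<le> lamstar * (?E * (C\<^sup>2 * B))"
      unfolding abs_mult[of "- lamstar"] using \<chi>b[OF r] lamstar_pos by (intro mult_mono) auto
    have 2: "\<bar>(f1 \<theta> (?y r) * f \<theta> (?yg r) * f1 \<theta> (?y r) + f \<theta> (?y r) * (f2 \<theta> (?y r) * f \<theta> (?yg r))) * ?un r\<bar>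
       \<le> (C * C * C + C * (C * C)) * B"
      unfolding abs_mult[of _ "?un r"] using fC B[OF \<tau>[OF r]] C_nonneg B_nonneg
      by (intro mult_mono order_trans[OF abs_triangle_ineq] add_mono) (auto simp: abs_mult intro!: mult_mono)
    have 3: "\<bar>f \<theta> (?y r) * f1 \<theta> (?y r) * (u_nt \<theta> (T - t + r, ?y r) + u_nn \<theta> (T - t + r, ?y r) * f \<theta> (?yg r))\<bar>
       \<le> C * C * (B + B * C)"
      unfolding abs_mult[of "f \<theta> (?y r) * f1 \<theta> (?y r)"] using fC B[OF \<tau>[OF r]] C_nonneg B_nonneg
      by (intro mult_mono order_trans[OF abs_triangle_ineq] add_mono) (auto simp: abs_mult intro!: mult_mono)
    let ?D = "(f1 \<theta> (?y r) * f \<theta> (?yg r) * f1 \<theta> (?y r) + f \<theta> (?y r) * (f2 \<theta> (?y r) * f \<theta> (?yg r))) * ?un r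
      + f \<theta> (?y r) * f1 \<theta> (?y r) * (u_nt \<theta> (T - t + r, ?y r) + u_nn \<theta> (T - t + r, ?y r) * f \<theta> (?yg r))"
    have "\<bar>?D\<bar> \<le> (C * C * C + C * (C * C)) * B + C * C * (B + B * C)"
      using 2 3 by (rule order_trans[OF abs_triangle_ineq add_mono])
    then have 4: "\<bar>?e r * ?D\<bar> \<le> ?E * ((C * C * C + C * (C * C)) * B + C * C * (B + B * C))"
      unfolding abs_mult[of "?e r"] using e[OF r] by (intro mult_mono) auto
    have "\<bar>?\<chi>' r\<bar> \<le> lamstar * (?E * (C\<^sup>2 * B)) + ?E * ((C * C * C + C * (C * C)) * B + C * C * (B + B * C))"
      using 1 4 by (rule order_trans[OF abs_triangle_ineq add_mono])
    also have "\<dots> = ?E * ?c2" by (simp add: power2_eq_square power3_eq_cube algebra_simps)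
    finally show ?thesis .
  qed
  \<comment> \<open>Differentiating the corrector brings in \<open>f2\<close>, \<open>u_nt\<close>
    and \<open>u_nn\<close>.\<close>
  have d\<chi>: "(?\<chi> has_real_derivative ?\<chi>' r) (at r)" if r: "0 < r" "r \<notin> ?S" "r < t" for r
  proof -
    note dy = dy[OF r]
    have 1: "((\<lambda>r. f \<theta> (?y r)) has_real_derivative f1 \<theta> (?y r) * f \<theta> (?yg r)) (at r)"
      by (rule DERIV_chain2[OF f1 dy])
    have 2: "((\<lambda>r. f1 \<theta> (?y r)) has_real_derivative f2 \<theta> (?y r) * f \<theta> (?yg r)) (at r)"
      by (rule DERIV_chain2[OF f2 dy])
    have 3: "(?un has_real_derivative u_nt \<theta> (T - t + r, ?y r) + u_nn \<theta> (T - t + r, ?y r) * f \<theta> (?yg r)) (at r)"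
      by (rule has_partials_on_chain[OF un_partials _ _ dy]) (use r t in auto)
    have 4: "(?e has_real_derivative - lamstar * ?e r) (at r)"
      by (auto intro!: derivative_eq_intros)
    show ?thesis
      by (rule DERIV_cong[OF DERIV_mult[OF 4 DERIV_mult[OF DERIV_mult[OF 1 2] 3]]]) (simp add: algebra_simps)
  qed
  have dp: "(?p has_real_derivative (?\<rho> r - h / 2)) (at r)" if "0 < r" "r \<notin> ?S" "r < t" for r
  proof -
    have "(sawtooth h has_real_derivative (?\<rho> r - h / 2)) (at (s + r))"
      by (rule sawtooth_derivative[OF h]) (use that t in auto)
    then show ?thesis using DERIV_shift[of "sawtooth h" "?\<rho> r - h / 2" r s] by (simp add: add.commute)
  qed
  have local: "\<bar>?e r * (f \<theta> (?yg r) - f \<theta> (?y r)) * ?un r + ?\<rho> r * ?\<chi> r\<bar> \<le> ?E * ?c1 * h\<^sup>2" if r: "0 \<le> r" "r \<le> t" for r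
  proof -
    have \<rho>: "0 \<le> ?\<rho> r" "?\<rho> r \<le> h" using grid_bounds[OF h, of "s + r"] r t by auto
    have y: "?y r = ?yg r + ?\<rho> r * f \<theta> (?yg r)"
      unfolding \<Phi>_def by (rule euler_flow_grid[OF h]) (use r t in auto)
    have d: "\<bar>?yg r - ?y r\<bar> \<le> h * C" unfolding y using \<rho> fC h by (auto simp: abs_mult intro!: mult_mono)
    have 1: "\<bar>f \<theta> (?yg r) - f \<theta> (?y r) - (?yg r - ?y r) * f1 \<theta> (?y r)\<bar> \<le> C * (h * C)\<^sup>2"
      using taylor_field[of \<theta> "?yg r" "?y r"] power_mono[OF d, of 2] C_nonneg
      by (intro order_trans[OF taylor_field] mult_left_mono) auto
    have 2: "\<bar>?\<rho> r * f1 \<theta> (?y r) * (f \<theta> (?y r) - f \<theta> (?yg r))\<bar> \<le> h * C * (C * (h * C))"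
    proof -
      have "\<bar>f \<theta> (?y r) - f \<theta> (?yg r)\<bar> \<le> C * (h * C)"
        using f_lip[of \<theta> "?y r" "?yg r"] mult_left_mono[OF d C_nonneg] by (simp add: abs_minus_commute)
      then show ?thesis unfolding abs_mult using \<rho> fC C_nonneg h by (intro mult_mono) auto
    qed
    \<comment> \<open>Taylor's formula at \<open>?y r\<close> has increment
      \<open>?yg r - ?y r = - ?\<rho> r * f(?yg r)\<close>; replacing this slope by the one at
      \<open>?y r\<close> gives the last term. Both errors are at most
      \<open>C ^ 3 * h\<^sup>2\<close>.\<close>
    have eq: "f \<theta> (?yg r) - f \<theta> (?y r) + ?\<rho> r * (f \<theta> (?y r) * f1 \<theta> (?y r))
      = (f \<theta> (?yg r) - f \<theta> (?y r) - (?yg r - ?y r) * f1 \<theta> (?y r)) + ?\<rho> r * f1 \<theta> (?y r) * (f \<theta> (?y r) - f \<theta> (?yg r))"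
    proof -
      have "?yg r - ?y r = - (?\<rho> r * f \<theta> (?yg r))" using y by linarith
      then show ?thesis by (simp only:) (simp add: algebra_simps)
    qed
    have 3: "\<bar>f \<theta> (?yg r) - f \<theta> (?y r) + ?\<rho> r * (f \<theta> (?y r) * f1 \<theta> (?y r))\<bar> \<le> C * (h * C)\<^sup>2 + h * C * (C * (h * C))"
      unfolding eq using 1 2 by (rule order_trans[OF abs_triangle_ineq add_mono])
    have "?e r * (f \<theta> (?yg r) - f \<theta> (?y r)) * ?un r + ?\<rho> r * ?\<chi> r
      = ?e r * ((f \<theta> (?yg r) - f \<theta> (?y r) + ?\<rho> r * (f \<theta> (?y r) * f1 \<theta> (?y r))) * ?un r)"
      by (simp add: algebra_simps)
    also have "\<bar>\<dots>\<bar> \<le> ?E * ((C * (h * C)\<^sup>2 + h * C * (C * (h * C))) * B)"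
      unfolding abs_mult[of "?e r"] abs_mult[of _ "?un r"] using 3 e[OF r] B[OF \<tau>[OF r]] C_nonneg h by (intro mult_mono) auto
    also have "\<dots> = ?E * ?c1 * h\<^sup>2" by (simp add: power2_eq_square power3_eq_cube algebra_simps)
    finally show ?thesis .
  qed
  have pb: "\<bar>?p r\<bar> \<le> h\<^sup>2" if "0 \<le> r" for r by (rule sawtooth_bound[OF h]) (use that t in auto)
  have i\<chi>: "set_integrable lborel {0..t} (\<lambda>r. local_error (t - r) (flow_map \<Phi> (s + r) (\<theta>, \<nu>)))"
    by (rule running_integrand_integrable[OF local_error_measurable \<Phi> local_error_bound t(2)])
  have le_eq: "local_error (t - r) (flow_map \<Phi> (s + r) (\<theta>, \<nu>)) = - ?\<chi> r / 2" if "0 \<le> r" "r \<le> t" for r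
    using that t by (simp add: local_error_def flow_map_def algebra_simps)
  have iJ: "set_integrable lborel {0..t} ?J"
    by (rule jump_integrand_integrable[OF \<Phi> value_weight_measurable[OF \<Phi>] value_weight_bounded t(2,3)])
  have sum_split: "(LINT r:{0..t}|lborel. ?J r + (- h) * local_error (t - r) (flow_map \<Phi> (s + r) (\<theta>, \<nu>)))
     = (LINT r:{0..t}|lborel. ?J r) + (- h) * (LINT r:{0..t}|lborel. local_error (t - r) (flow_map \<Phi> (s + r) (\<theta>, \<nu>)))"
    by (subst set_integral_add(2)[OF iJ set_integrable_mult_right[of "- h", OF i\<chi>]]) (simp only: set_integral_mult_right)
  have "\<bar>?W t - ?W 0 + (LINT r:{0..t}|lborel. ?J r + (- h) * local_error (t - r) (flow_map \<Phi> (s + r) (\<theta>, \<nu>)))\<bar>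
     \<le> (?E * ?c1 * h\<^sup>2 + h\<^sup>2 * (?E * ?c2)) * t"
  proof (rule FTC_residual[where S="?S" and D="\<lambda>r. (- ?J r + ?e r * (f \<theta> (?yg r) - f \<theta> (?y r)) * ?un r) + ((?\<rho> r - h / 2) * ?\<chi> r + ?\<chi>' r * ?p r)"])
    show "finite ?S" by (rule finite_on_grid[OF h])
    show "0 \<le> ?E * ?c1 * h\<^sup>2 + h\<^sup>2 * (?E * ?c2)" using C_nonneg B_nonneg lamstar_pos by simp
    show "continuous_on {0..t} ?W"
    proof -
      have "continuous_on {0..t} ?p"
        by (rule continuous_on_compose2[OF sawtooth_continuous[OF h]]) (use t in \<open>auto intro!: continuous_intros\<close>)
      then show ?thesis
        by (intro continuous_on_add continuous_on_mult value_continuous[OF cont_y t(1,2)]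
           continuous_on_compose2[OF cont_f(1) cont_y] continuous_on_compose2[OF cont_f(2) cont_y]) (auto intro!: continuous_intros)
    qed
    show "(?W has_real_derivative (- ?J r + ?e r * (f \<theta> (?yg r) - f \<theta> (?y r)) * ?un r) + ((?\<rho> r - h / 2) * ?\<chi> r + ?\<chi>' r * ?p r)) (at r)"
      if r: "0 < r" "r < t" "r \<notin> ?S" for r
      by (rule DERIV_add[OF value_derivative[where \<Phi>=\<Phi>, OF \<Phi>0 t(1,2) r(1,2) dy[OF r(1,3,2)]] DERIV_mult[OF dp[OF r(1,3,2)] d\<chi>[OF r(1,3,2)]]])
    show "\<bar>(- ?J r + ?e r * (f \<theta> (?yg r) - f \<theta> (?y r)) * ?un r) + ((?\<rho> r - h / 2) * ?\<chi> r + ?\<chi>' r * ?p r)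
       + (?J r + (- h) * local_error (t - r) (flow_map \<Phi> (s + r) (\<theta>, \<nu>)))\<bar> \<le> ?E * ?c1 * h\<^sup>2 + h\<^sup>2 * (?E * ?c2)"
      if r: "0 < r" "r < t" for r
    proof -
      have r': "0 \<le> r" "r \<le> t" using r by auto
      \<comment> \<open>The jump integrand cancels, and so does \<open>h / 2\<close> times
        \<open>?\<chi>\<close> against the contribution of \<open>local_error\<close>.\<close>
      have alg: "(- J + a) + ((\<rho> - h / 2) * c + c' * p) + (J + (- h) * (- c / 2)) = (a + \<rho> * c) + p * c'"
        for J a \<rho> c c' p :: real by (simp add: algebra_simps)
      have eq: "(- ?J r + ?e r * (f \<theta> (?yg r) - f \<theta> (?y r)) * ?un r) + ((?\<rho> r - h / 2) * ?\<chi> r + ?\<chi>' r * ?p r)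
       + (?J r + (- h) * local_error (t - r) (flow_map \<Phi> (s + r) (\<theta>, \<nu>)))
       = (?e r * (f \<theta> (?yg r) - f \<theta> (?y r)) * ?un r + ?\<rho> r * ?\<chi> r) + ?p r * ?\<chi>' r"
        unfolding le_eq[OF r'] by (rule alg)
      have "\<bar>?p r * ?\<chi>' r\<bar> \<le> h\<^sup>2 * (?E * ?c2)"
        unfolding abs_mult[of "?p r"] using pb[OF r'(1)] \<chi>'b[OF r'] by (intro mult_mono) auto
      from order_trans[OF abs_triangle_ineq add_mono[OF local[OF r'] this]]
      show ?thesis unfolding eq .
    qed
    show "set_integrable lborel {0..t} (\<lambda>r. ?J r + (- h) * local_error (t - r) (flow_map \<Phi> (s + r) (\<theta>, \<nu>)))"
      by (intro set_integral_add(1) iJ set_integrable_mult_right i\<chi>)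
  qed (use t in auto)
  also have "\<dots> \<le> (?E * ?c1 * h\<^sup>2 + h\<^sup>2 * (?E * ?c2)) * T"
    using t C_nonneg B_nonneg lamstar_pos by (intro mult_left_mono) auto
  finally have main: "\<bar>?W t - ?W 0 + (jump_op \<Phi> (value_weight \<Phi>) t s (\<theta>, \<nu>) + (- h) * running_weight local_error \<Phi> t s (\<theta>, \<nu>))\<bar>
     \<le> (?E * ?c1 * h\<^sup>2 + h\<^sup>2 * (?E * ?c2)) * T"
    unfolding jump_op_def running_weight_def sum_split .
  \<comment> \<open>The corrector does not vanish at the ends unless they are grid points, but it is
    O(h^2) there.\<close>
  have end0: "\<bar>?p r * ?\<chi> r\<bar> \<le> h\<^sup>2 * (?E * (C\<^sup>2 * B))" if "0 \<le> r" "r \<le> t" for r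
    unfolding abs_mult[of "?p r"] using pb[OF that(1)] \<chi>b[OF that] by (intro mult_mono) auto
  have Vt: "?V t = terminal_weight \<Phi> F t s (\<theta>, \<nu>)" by (simp add: terminal_weight_def flow_map_def u_terminal)
  have V0: "?V 0 = value_weight \<Phi> t s (\<theta>, \<nu>)" using t by (simp add: value_weight_def flow_map_def)
  have "\<bar>value_weight \<Phi> t s (\<theta>, \<nu>) - (terminal_weight \<Phi> F t s (\<theta>, \<nu>) + (- h) * running_weight local_error \<Phi> t s (\<theta>, \<nu>))
      - jump_op \<Phi> (value_weight \<Phi>) t s (\<theta>, \<nu>)\<bar>
    \<le> (?E * ?c1 * h\<^sup>2 + h\<^sup>2 * (?E * ?c2)) * T + 2 * (h\<^sup>2 * (?E * (C\<^sup>2 * B)))"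
  proof -
    have tri: "\<bar>v - (w + q) - j\<bar> \<le> m + 2 * k"
      if "\<bar>(w + a) - (v + b) + (j + q')\<bar> \<le> m" "q' = q" "\<bar>a\<bar> \<le> k" "\<bar>b\<bar> \<le> k" for v w q q' j m k a b :: real
      using that by linarith
    show ?thesis
      by (rule tri[OF main[unfolded Vt V0] refl end0[of t] end0[of 0]]) (use t in auto)
  qed
  also have "\<dots> = consistency_const * h\<^sup>2"
    by (simp add: consistency_const_def algebra_simps)
  finally show ?thesis using Pair by simp
qed

text \<open>Needed to compare the source along the two flows. The product rule gives three terms,
  each bounded by \<open>C * C * B\<close>.\<close>

lemma local_error_lip:
  assumes "0 \<le> q" "q \<le> T"
  shows "\<bar>local_error q (\<theta>, \<nu>) - local_error q (\<theta>, \<nu>')\<bar> \<le> exp (lamstar * T) * (3 * C * C * B) * \<bar>\<nu> - \<nu>'\<bar>"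
proof -
  let ?g = "\<lambda>\<nu>. f \<theta> \<nu> * f1 \<theta> \<nu> * u_n \<theta> (T - q, \<nu>)"
  let ?g' = "\<lambda>\<nu>. (f1 \<theta> \<nu> * f1 \<theta> \<nu> + f2 \<theta> \<nu> * f \<theta> \<nu>) * u_n \<theta> (T - q, \<nu>) + u_nn \<theta> (T - q, \<nu>) * (f \<theta> \<nu> * f1 \<theta> \<nu>)"
  have q: "T - q \<in> {0..T}" using assms by auto
  have fC: "\<bar>f \<theta> \<nu>\<bar> \<le> C" "\<bar>f1 \<theta> \<nu>\<bar> \<le> C" "\<bar>f2 \<theta> \<nu>\<bar> \<le> C" for \<theta> \<nu> using f_bounds by auto
  have "norm (?g \<nu> - ?g \<nu>') \<le> ((C * C + C * C) * B + B * (C * C)) * norm (\<nu> - \<nu>')"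
  proof (rule field_differentiable_bound[where S=UNIV and f'="?g'"])
    show "(?g has_field_derivative ?g' z) (at z within UNIV)" for z
      by (rule DERIV_mult[OF DERIV_mult[OF f1 f2] un_space[OF q]])
    show "norm (?g' z) \<le> (C * C + C * C) * B + B * (C * C)" for z
    proof -
      have "\<bar>f1 \<theta> z * f1 \<theta> z\<bar> \<le> C * C" "\<bar>f2 \<theta> z * f \<theta> z\<bar> \<le> C * C" "\<bar>f \<theta> z * f1 \<theta> z\<bar> \<le> C * C"
        unfolding abs_mult using fC C_nonneg by (intro mult_mono; simp)+
      then have "\<bar>f1 \<theta> z * f1 \<theta> z + f2 \<theta> z * f \<theta> z\<bar> \<le> C * C + C * C" "\<bar>f \<theta> z * f1 \<theta> z\<bar> \<le> C * C" by linarith+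
      then show ?thesis unfolding real_norm_def using B[OF q] C_nonneg B_nonneg
        by (intro order_trans[OF abs_triangle_ineq] add_mono; simp only: abs_mult[of _ "u_n \<theta> (T - q, z)"] abs_mult[of "u_nn \<theta> (T - q, z)"])
           (intro mult_mono; simp)+
    qed
  qed auto
  then have g: "\<bar>?g \<nu> - ?g \<nu>'\<bar> \<le> 3 * C * C * B * \<bar>\<nu> - \<nu>'\<bar>" by (simp add: algebra_simps)
  have "\<bar>exp (lamstar * q) * (?g \<nu> - ?g \<nu>')\<bar> \<le> exp (lamstar * T) * (3 * C * C * B * \<bar>\<nu> - \<nu>'\<bar>)"
    unfolding abs_mult[of "exp _"] using g assms lamstar_pos by (intro mult_mono) auto
  moreover have "local_error q (\<theta>, \<nu>) - local_error q (\<theta>, \<nu>') = - (exp (lamstar * q) * (?g \<nu> - ?g \<nu>') / 2)"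
    using assms by (simp add: local_error_def right_diff_distrib diff_divide_distrib)
  ultimately show ?thesis by (simp add: mult.assoc)
qed

text \<open>The Feynman-Kac representation in discounted form: the residual is 0, so only the
  factorially small term of \<open>picard_stability\<close> remains.\<close>

lemma exact_limit:
  assumes flow: "is_flow f \<phi>" and F: "F \<in> borel_measurable state_space"
  shows "(\<lambda>n. picard \<phi> (terminal_weight \<phi> F) n T 0 x) \<longlonglongrightarrow> exp (lamstar * T) * u 0 x"
proof -
  have \<Phi>: "measurable_flow \<phi>" by (rule measurable_flow_exact[OF flow f_lip C_nonneg])
  obtain b where b: "\<And>y. \<bar>F y\<bar> \<le> b" using F_ub by (auto simp: ubounded_def)
  have tw: "weight_bounded T b (terminal_weight \<phi> F)" by (rule weight_boundedI) (simp add: terminal_weight_def b)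
  let ?r = "\<lambda>n. exp (lamstar * T) * B * ((lamstar * T) ^ n / fact n)"
  have W: "value_weight \<phi> T 0 x = exp (lamstar * T) * u 0 x"
    using flow T_pos by (simp add: value_weight_def flow_map_def is_flow_def)
  have bound: "\<bar>picard \<phi> (terminal_weight \<phi> F) n T 0 x - value_weight \<phi> T 0 x\<bar> \<le> 0 * exp (lamstar * T) + ?r n" for n
    by (rule picard_stability[OF \<Phi> terminal_weight_measurable[OF \<Phi> F] tw value_weight_measurable[OF \<Phi>] value_weight_bounded])
       (use exact_consistency[OF flow] T_pos in auto)
  have "(\<lambda>n. (lamstar * T) ^ n / fact n) \<longlonglongrightarrow> 0" by (rule power_over_fact_tendsto_0)
  then have "?r \<longlonglongrightarrow> exp (lamstar * T) * B * 0" by (intro tendsto_intros)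
  then have r0: "?r \<longlonglongrightarrow> 0" by (simp only: mult_zero_right)
  have "(\<lambda>n. picard \<phi> (terminal_weight \<phi> F) n T 0 x - value_weight \<phi> T 0 x) \<longlonglongrightarrow> 0"
    by (rule Lim_null_comparison[OF _ r0]) (use bound in \<open>simp add: always_eventually\<close>)
  then show ?thesis unfolding W by (rule LIM_zero_cancel)
qed

text \<open>Linearity of the iterates separates the first-order source from the terminal value,
  stability replaces the corrected iterate by \<open>u\<close>, and \<open>picard_compare\<close>
  makes the coefficient independent of \<open>h\<close>.\<close>

lemma euler_limit:
  assumes flow: "is_flow f \<phi>" and F: "F \<in> borel_measurable state_space"
  shows "\<exists>c R. \<forall>h>0. \<forall>a. (\<lambda>n. picard (euler_flow f h) (terminal_weight (euler_flow f h) F) n T 0 x) \<longlonglongrightarrow> a \<longrightarrow>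
     \<bar>a - exp (lamstar * T) * u 0 x - h * c\<bar> \<le> R * h\<^sup>2"
proof -
  have \<phi>: "measurable_flow \<phi>" by (rule measurable_flow_exact[OF flow f_lip C_nonneg])
  obtain b where b: "\<And>y. \<bar>F y\<bar> \<le> b" using F_ub by (auto simp: ubounded_def)
  let ?E = "exp (lamstar * T)"
  \<comment> \<open>One constant serves as bound and as Lipschitz constant of
    \<open>local_error\<close>, as \<open>picard_compare\<close> expects.\<close>
  let ?L = "?E * (3 * C * C * B)"
  have Bl: "\<bar>local_error q y\<bar> \<le> ?L" if "0 \<le> q" "q \<le> T" for q y
  proof -
    have "?E * (C * C * B) \<le> ?L" using C_nonneg B_nonneg by simp
    with local_error_bound[OF that, of y] show ?thesis by linarith
  qed
  let ?r = "running_weight local_error"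
  have r: "measurable_weight (?r \<Phi>)" "weight_bounded T (?L * T) (?r \<Phi>)" if "measurable_flow \<Phi>" for \<Phi>
    using running_weight_measurable[OF local_error_measurable that] running_weight_bounded[OF local_error_measurable that Bl] by auto
  have "convergent (\<lambda>n. picard \<phi> (?r \<phi>) n T 0 x)"
    by (rule picard_convergent[OF \<phi> r[OF \<phi>]]) (use T_pos in auto)
  then obtain c where c: "(\<lambda>n. picard \<phi> (?r \<phi>) n T 0 x) \<longlonglongrightarrow> c" by (auto simp: convergent_def)
  \<comment> \<open>The factor of \<open>euler_flow_error\<close> when both the initial distance and
    \<open>h\<close> are at most \<delta>.\<close>
  define M0 where "M0 = (1 + C * C * T) * exp (C * T)"
  have M0: "1 \<le> M0"
  proof -
    have "1 * 1 \<le> (1 + C * C * T) * exp (C * T)" using C_nonneg T_pos by (intro mult_mono) auto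
    then show ?thesis by (simp add: M0_def)
  qed
  define A where "A = ?L * T + 2 * C * (?L * T * ?E) * (1 + lamstar) * T"
  \<comment> \<open>First summand: the consistency residual amplified over [0,T]. Second: the effect
    of replacing the polygon by the exact flow in the coefficient, of order \<open>h\<close> and
    multiplied by \<open>h\<close>.\<close>
  define R where "R = consistency_const * ?E + M0 * A * exp (lamstar * (1 + M0) * T)"
  have "\<bar>a - ?E * u 0 x - h * c\<bar> \<le> R * h\<^sup>2"
    if h: "0 < h" and a: "(\<lambda>n. picard (euler_flow f h) (terminal_weight (euler_flow f h) F) n T 0 x) \<longlonglongrightarrow> a" for h a
  proof -
    let ?\<Phi> = "euler_flow f h"
    have \<Phi>: "measurable_flow ?\<Phi>" by (rule measurable_flow_euler[OF f_measurable])
    have fC: "\<bar>f \<theta> \<nu>\<bar> \<le> C" for \<theta> \<nu> using f_bounds by auto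
    let ?F = "terminal_weight ?\<Phi> F"
    note tw = terminal_weight_measurable[OF \<Phi> F]
    have twb: "weight_bounded T b ?F" by (rule weight_boundedI) (simp add: terminal_weight_def b)
    \<comment> \<open>With this corrected source \<open>u\<close> is a fixed point up to O(h^2), so
      the uncorrected iterate exceeds it by \<open>h\<close> times the iterate of
      \<open>?r ?\<Phi>\<close>.\<close>
    let ?src = "\<lambda>t s x. ?F t s x + (- h) * ?r ?\<Phi> t s x"
    have src: "measurable_weight ?src" by (rule measurable_weight_lincomb[OF tw r(1)[OF \<Phi>]])
    have srcb: "weight_bounded T (b + h * (?L * T)) ?src"
    proof (rule weight_boundedI)
      fix t s :: real and x assume t: "0 \<le> t" "t \<le> T" "0 \<le> s"
      have "\<bar>(- h) * ?r ?\<Phi> t s x\<bar> \<le> h * (?L * T)"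
        unfolding abs_mult using h weight_boundedD[OF r(2)[OF \<Phi>] t, of x] by (intro mult_mono) auto
      with weight_boundedD[OF twb t, of x] show "\<bar>?src t s x\<bar> \<le> b + h * (?L * T)"
        by (intro order_trans[OF abs_triangle_ineq] add_mono)
    qed
    let ?q = "\<lambda>n. ?E * B * ((lamstar * T) ^ n / fact n)"
    have W: "value_weight ?\<Phi> T 0 x = ?E * u 0 x"
      using T_pos h by (simp add: value_weight_def flow_map_def)
    have 1: "\<bar>picard ?\<Phi> ?src n T 0 x - ?E * u 0 x\<bar> \<le> consistency_const * h\<^sup>2 * ?E + ?q n" for n
      unfolding W[symmetric]
      by (rule picard_stability[OF \<Phi> src srcb value_weight_measurable[OF \<Phi>] value_weight_bounded euler_consistency[OF h]])
         (use T_pos in auto)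
    have 2: "picard ?\<Phi> ?src n T 0 x = picard ?\<Phi> ?F n T 0 x + (- h) * picard ?\<Phi> (?r ?\<Phi>) n T 0 x" for n
      by (rule picard_lincomb[OF \<Phi> tw twb r[OF \<Phi>]]) (use T_pos in auto)
    have 3: "\<bar>picard ?\<Phi> (?r ?\<Phi>) n T 0 x - picard \<phi> (?r \<phi>) n T 0 x\<bar> \<le> (M0 * h) * A * exp (lamstar * (1 + M0) * T)" for n
    proof -
      have err: "\<bar>?\<Phi> \<theta> r \<nu> - \<phi> \<theta> r \<nu>'\<bar> \<le> M0 * \<delta>"
        if "h \<le> \<delta>" "\<bar>\<nu> - \<nu>'\<bar> \<le> \<delta>" "0 \<le> r" "r \<le> T" for \<theta> \<nu> \<nu>' \<delta> r
      proof -
        have "\<bar>?\<Phi> \<theta> r \<nu> - \<phi> \<theta> r \<nu>'\<bar> \<le> (\<bar>\<nu> - \<nu>'\<bar> + C * C * h * T) * exp (C * r)"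
          by (rule euler_flow_error[where f=f, OF flow f_lip fC h that(3,4)])
        also have "\<dots> \<le> (\<delta> + C * C * \<delta> * T) * exp (C * T)"
          using that h C_nonneg T_pos by (intro mult_mono add_mono) (auto intro!: mult_left_mono mult_right_mono)
        also have "\<dots> = M0 * \<delta>" by (simp add: M0_def algebra_simps)
        finally show ?thesis .
      qed
      \<comment> \<open>Both flows start at \<open>x\<close>, so the discrepancy before the first
        jump is the pure discretization error, at most \<open>M0 * h\<close>.\<close>
      have "\<bar>picard ?\<Phi> (?r ?\<Phi>) n T 0 (fst x, snd x) - picard \<phi> (?r \<phi>) n T 0 (fst x, snd x)\<bar>
        \<le> (M0 * h) * (?L * T + 2 * C * (?L * T * ?E) * (1 + lamstar) * T) * exp (lamstar * (1 + M0) * T)"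
      proof (rule picard_compare[OF \<Phi> \<phi> local_error_measurable Bl local_error_lip lam_lip Q_lip err M0])
        show "h \<le> M0 * h" using M0 h by simp
        show "\<bar>?\<Phi> (fst x) (0 + r) (snd x) - \<phi> (fst x) (0 + r) (snd x)\<bar> \<le> M0 * h" if "0 \<le> r" "r \<le> T" for r
          using err[of h "snd x" "snd x" r "fst x"] that h by simp
      qed (use h C_nonneg T_pos in auto)
      then show ?thesis by (simp add: A_def)
    qed
    have 4: "\<bar>picard ?\<Phi> ?F n T 0 x - ?E * u 0 x - h * picard \<phi> (?r \<phi>) n T 0 x\<bar> \<le> R * h\<^sup>2 + ?q n" for n
    proof -
      have "\<bar>h * (picard ?\<Phi> (?r ?\<Phi>) n T 0 x - picard \<phi> (?r \<phi>) n T 0 x)\<bar> \<le> h * ((M0 * h) * A * exp (lamstar * (1 + M0) * T))"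
        unfolding abs_mult using 3[of n] h by (intro mult_mono) auto
      then have "\<bar>h * picard ?\<Phi> (?r ?\<Phi>) n T 0 x - h * picard \<phi> (?r \<phi>) n T 0 x\<bar> \<le> M0 * A * exp (lamstar * (1 + M0) * T) * h\<^sup>2"
        by (simp add: algebra_simps power2_eq_square)
      moreover have "R * h\<^sup>2 = consistency_const * h\<^sup>2 * ?E + M0 * A * exp (lamstar * (1 + M0) * T) * h\<^sup>2"
        by (simp add: R_def algebra_simps)
      ultimately show ?thesis using 1[of n] unfolding 2 by linarith
    qed
    show ?thesis
    proof (rule LIMSEQ_le)
      show "(\<lambda>n. \<bar>picard ?\<Phi> ?F n T 0 x - ?E * u 0 x - h * picard \<phi> (?r \<phi>) n T 0 x\<bar>) \<longlonglongrightarrow> \<bar>a - ?E * u 0 x - h * c\<bar>"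
        by (intro tendsto_intros a c)
      have "(\<lambda>n. (lamstar * T) ^ n / fact n) \<longlonglongrightarrow> 0" by (rule power_over_fact_tendsto_0)
      then have "(\<lambda>n. R * h\<^sup>2 + ?q n) \<longlonglongrightarrow> R * h\<^sup>2 + ?E * B * 0" by (intro tendsto_intros)
      then show "(\<lambda>n. R * h\<^sup>2 + ?q n) \<longlonglongrightarrow> R * h\<^sup>2" by simp
    qed (use 4 in blast)
  qed
  then show ?thesis by blast
qed

end

end


section \<open>The weak error expansion\<close>

theorem theorem4p1:
  fixes M :: "'w measure"
    and k :: "nat \<Rightarrow> 'k::countable" and N :: enat
    and f :: "'k \<Rightarrow> real \<Rightarrow> real" and L :: real
    and lam :: "'k \<times> real \<Rightarrow> real" and lamstar :: real
    and Q :: "'k \<times> real \<Rightarrow> ('k \<times> real) measure"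
    and \<phi> :: "'k \<Rightarrow> real \<Rightarrow> real \<Rightarrow> real"
    and Np :: "real \<Rightarrow> 'w \<Rightarrow> nat" and Ts U V :: "nat \<Rightarrow> 'w \<Rightarrow> real"
    and T :: real and x :: "'k \<times> real"
    and F :: "'k \<times> real \<Rightarrow> real" and u :: "real \<Rightarrow> 'k \<times> real \<Rightarrow> real"
  assumes modes: "bij_betw k (mode_indices N) UNIV"
    and f_bounded: "\<And>\<theta>. bounded (range (f \<theta>))"
    and f_lipschitz: "\<And>\<theta>. L-lipschitz_on UNIV (f \<theta>)"
    and lam_measurable: "lam \<in> borel_measurable state_space"
    and lam_bounds: "\<And>y. 0 < lam y \<and> lam y \<le> lamstar"
    and Q_kernel: "Q \<in> state_space \<rightarrow>\<^sub>M prob_algebra state_space"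
    and Q_mode_jump: "\<And>\<theta> \<nu> A B. B \<in> sets borel \<Longrightarrow>
          measure (Q (\<theta>, \<nu>)) (A \<times> B) = mode_prob Q (\<theta>, \<nu>) A * indicator B \<nu>"
    and flow: "is_flow f \<phi>"
    and prob: "prob_space M"
    and noise: "thinning_data M lamstar Np Ts U V"
    and T_pos: "0 < T"
    and coeff_regular: "\<exists>C. \<forall>\<theta> A. C2_bounded_by C (\<lambda>\<nu>. mode_prob Q (\<theta>, \<nu>) A) \<and>
          C2_bounded_by C (\<lambda>\<nu>. lam (\<theta>, \<nu>)) \<and> C2_bounded_by C (f \<theta>)"
    and F_bounded: "bounded (range F)"
    and u_solution: "solves_backward_equation f lam Q T F u"
    and u_regular: "regular_solution T u"
  shows "\<exists>c1::real.
    (\<lambda>h. (\<integral>\<omega>. F (thinning_path k N Q lam lamstar (euler_flow f h) x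
                   (\<lambda>j. Ts j \<omega>) (\<lambda>j. U j \<omega>) (\<lambda>j. V j \<omega>) T) \<partial>M)
       - (\<integral>\<omega>. F (thinning_path k N Q lam lamstar \<phi> x
                   (\<lambda>j. Ts j \<omega>) (\<lambda>j. U j \<omega>) (\<lambda>j. V j \<omega>) T) \<partial>M)
       - h * c1) \<in> O[at_right 0](\<lambda>h. h ^ 2)"
proof -
  interpret pdmp_modes lam lamstar Q k N
    by unfold_locales (fact lam_measurable lam_bounds Q_kernel Q_mode_jump modes)+
  obtain C where C: "\<And>\<theta> A. C2_bounded_by C (\<lambda>\<nu>. mode_prob Q (\<theta>, \<nu>) A)"
    "\<And>\<theta>. C2_bounded_by C (\<lambda>\<nu>. lam (\<theta>, \<nu>))" "\<And>\<theta>. C2_bounded_by C (f \<theta>)"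
    using coeff_regular by blast
  have lip: "\<bar>g \<nu> - g \<nu>'\<bar> \<le> C * \<bar>\<nu> - \<nu>'\<bar>" if g: "C2_bounded_by C g" for g \<nu> \<nu>'
  proof -
    obtain g' where g': "\<And>\<nu>. (g has_real_derivative g' \<nu>) (at \<nu>)" "\<And>\<nu>. \<bar>g' \<nu>\<bar> \<le> C"
      using g unfolding C2_bounded_by_def by blast
    then show ?thesis using field_differentiable_bound[of UNIV g g' C \<nu> \<nu>'] by auto
  qed
  have "\<forall>\<theta>. \<exists>f1 f2. (\<forall>\<nu>. (f \<theta> has_real_derivative f1 \<nu>) (at \<nu>)) \<and> (\<forall>\<nu>. (f1 has_real_derivative f2 \<nu>) (at \<nu>)) \<and>
      (\<forall>\<nu>. \<bar>f \<theta> \<nu>\<bar> \<le> C \<and> \<bar>f1 \<nu>\<bar> \<le> C \<and> \<bar>f2 \<nu>\<bar> \<le> C)"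
    using C(3) unfolding C2_bounded_by_def by blast
  then obtain f1 f2 where f12: "\<And>\<theta> \<nu>. (f \<theta> has_real_derivative f1 \<theta> \<nu>) (at \<nu>)" "\<And>\<theta> \<nu>. (f1 \<theta> has_real_derivative f2 \<theta> \<nu>) (at \<nu>)"
    "\<And>\<theta> \<nu>. \<bar>f \<theta> \<nu>\<bar> \<le> C \<and> \<bar>f1 \<theta> \<nu>\<bar> \<le> C \<and> \<bar>f2 \<theta> \<nu>\<bar> \<le> C"
    by metis
  let ?S = "{0..T} \<times> (UNIV :: real set)"
  obtain K where "\<forall>\<theta>. \<exists>u\<^sub>t u\<^sub>\<nu> u\<^sub>t\<^sub>t u\<^sub>t\<^sub>\<nu> u\<^sub>\<nu>\<^sub>t u\<^sub>\<nu>\<^sub>\<nu>. has_partials_on (\<lambda>(t, \<nu>). u t (\<theta>, \<nu>)) u\<^sub>t u\<^sub>\<nu> ?S \<and>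
      has_partials_on u\<^sub>t u\<^sub>t\<^sub>t u\<^sub>t\<^sub>\<nu> ?S \<and> has_partials_on u\<^sub>\<nu> u\<^sub>\<nu>\<^sub>t u\<^sub>\<nu>\<^sub>\<nu> ?S \<and>
      K-lipschitz_on ?S u\<^sub>t\<^sub>t \<and> K-lipschitz_on ?S u\<^sub>\<nu>\<^sub>t \<and> K-lipschitz_on ?S u\<^sub>\<nu>\<^sub>\<nu>"
    using u_regular unfolding regular_solution_def Let_def by (elim exE) (rule that, fastforce)
  then obtain ut un utt utn unt unn where part: "\<And>\<theta>. has_partials_on (\<lambda>(t, \<nu>). u t (\<theta>, \<nu>)) (ut \<theta>) (un \<theta>) ?S"
      "\<And>\<theta>. has_partials_on (ut \<theta>) (utt \<theta>) (utn \<theta>) ?S" "\<And>\<theta>. has_partials_on (un \<theta>) (unt \<theta>) (unn \<theta>) ?S"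
    and Klip: "\<And>\<theta>. K-lipschitz_on ?S (utt \<theta>)" "\<And>\<theta>. K-lipschitz_on ?S (unt \<theta>)" "\<And>\<theta>. K-lipschitz_on ?S (unn \<theta>)"
    by metis
  obtain b where b: "\<And>y. \<bar>F y\<bar> \<le> b" using F_bounded by (auto simp: bounded_iff)
  \<comment> \<open>The generator is formulated with \<open>deriv\<close> and
    \<open>vector_derivative\<close>; these must first be identified with the partial derivatives
    supplied by \<open>regular_solution\<close>.\<close>
  have eq: "ut \<theta> (t, \<nu>) + f \<theta> \<nu> * un \<theta> (t, \<nu>) + lam (\<theta>, \<nu>) * ((\<integral>y. u t y \<partial>Q (\<theta>, \<nu>)) - u t (\<theta>, \<nu>)) = 0"
    if t: "0 \<le> t" "t < T" for t \<theta> \<nu>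
  proof -
    interpret prob_space "Q (\<theta>, \<nu>)" by (rule Q_prob)
    have int: "integrable (Q (\<theta>, \<nu>)) (u t)" and gen: "generator f lam Q u t (\<theta>, \<nu>) = 0"
      using u_solution t unfolding solves_backward_equation_def by auto
    have "((\<lambda>s. u s (\<theta>, \<nu>)) has_real_derivative ut \<theta> (t, \<nu>)) (at t within {0..T})"
      using has_partials_on_time[OF part(1), of t] t by simp
    \<comment> \<open>Near \<open>t < T\<close> the sets {0..T} and {0..} agree; at
      \<open>t = 0\<close> both give the one-sided derivative.\<close>
    moreover have "at t within {0..T} = at t within {0..}"
      by (rule at_within_nhd[of t "{..<T}"]) (use t in auto)
    ultimately have "((\<lambda>s. u s (\<theta>, \<nu>)) has_vector_derivative ut \<theta> (t, \<nu>)) (at t within {0..})"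
      by (simp add: has_real_derivative_iff_has_vector_derivative)
    moreover have "at t within {0..} \<noteq> bot"
      using t islimpt_Icc[of t "t + 1" t] by (auto simp: trivial_limit_within islimpt_subset[of t "{t..t+1}" "{0..}"])
    ultimately have 1: "vector_derivative (\<lambda>s. u s (\<theta>, \<nu>)) (at t within {0..}) = ut \<theta> (t, \<nu>)"
      by (intro vector_derivative_within)
    have 2: "deriv (\<lambda>\<nu>. u t (\<theta>, \<nu>)) \<nu> = un \<theta> (t, \<nu>)"
      using has_partials_on_space[OF part(1), of t] t by (intro DERIV_imp_deriv) simp
    \<comment> \<open>Splitting the integral uses the integrability part of
      \<open>solves_backward_equation\<close>.\<close>
    have 3: "(\<integral>y. (u t y - u t (\<theta>, \<nu>)) \<partial>Q (\<theta>, \<nu>)) = (\<integral>y. u t y \<partial>Q (\<theta>, \<nu>)) - u t (\<theta>, \<nu>)"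
      using int by (simp add: prob_space)
    show ?thesis using gen unfolding generator_def by (simp add: 1 2 3)
  qed
  interpret backward_solution lam lamstar Q f f1 f2 C T K F u ut un utt utn unt unn
  proof unfold_locales
    show "0 \<le> K" using Klip(1) by (rule lipschitz_on_nonneg)
    show "ubounded F" using b by (rule uboundedI)
    show "integrable (Q x) (u t)" if "0 \<le> t" "t < T" for t x
      using u_solution that unfolding solves_backward_equation_def by (cases x) auto
    show "u T x = F x" for x using u_solution unfolding solves_backward_equation_def by (cases x) auto
    show "\<bar>mode_prob Q (\<theta>, \<nu>) A - mode_prob Q (\<theta>, \<nu>') A\<bar> \<le> C * \<bar>\<nu> - \<nu>'\<bar>" for \<theta> \<nu> \<nu>' A by (rule lip[OF C(1)])
    show "\<bar>lam (\<theta>, \<nu>) - lam (\<theta>, \<nu>')\<bar> \<le> C * \<bar>\<nu> - \<nu>'\<bar>" for \<theta> \<nu> \<nu>' by (rule lip[OF C(2)])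
  qed (fact T_pos f12 part Klip eq)+
  \<comment> \<open>In each mode \<open>F\<close> is differentiable, being \<open>u\<close> at time
    \<open>T\<close>, and there are only countably many modes.\<close>
  have F_meas: "F \<in> borel_measurable state_space"
  proof -
    have "continuous_on UNIV (\<lambda>\<nu>. F (\<theta>, \<nu>))" for \<theta>
      using u_space[of T \<theta>] T_pos u_terminal by (auto intro!: continuous_at_imp_continuous_on DERIV_isCont)
    then have "(\<lambda>\<nu>. F (\<theta>, \<nu>)) \<in> borel_measurable borel" for \<theta>
      by (rule borel_measurable_continuous_onI)
    then have "(\<lambda>z. F (\<theta>, snd z)) \<in> borel_measurable (state_space :: ('k \<times> real) measure)" for \<theta>
      by (rule measurable_compose[OF measurable_snd])
    then have "(\<lambda>z. (\<lambda>\<theta> z. F (\<theta>, snd z)) (fst z) z) \<in> borel_measurable state_space"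
      by (rule measurable_compose_countable) simp
    then show ?thesis by simp
  qed
  obtain B where B: "\<And>t \<theta> \<nu>. t \<in> {0..T} \<Longrightarrow>
    \<bar>u t (\<theta>, \<nu>)\<bar> \<le> B \<and> \<bar>un \<theta> (t, \<nu>)\<bar> \<le> B \<and> \<bar>unn \<theta> (t, \<nu>)\<bar> \<le> B \<and> \<bar>unt \<theta> (t, \<nu>)\<bar> \<le> B"
    using derivatives_uniformly_bounded by blast
  let ?X = "\<lambda>\<Phi>. \<integral>\<omega>. F (thinning_path k N Q lam lamstar \<Phi> x (\<lambda>j. Ts j \<omega>) (\<lambda>j. U j \<omega>) (\<lambda>j. V j \<omega>) T) \<partial>M"
  let ?E = "exp (lamstar * T)"
  \<comment> \<open>The discount is put back: the iterates at age 0 converge to \<open>?E\<close>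
    times the expectation.\<close>
  have lim: "(\<lambda>n. picard \<Phi> (terminal_weight \<Phi> F) n T 0 x) \<longlonglongrightarrow> ?E * ?X \<Phi>" if "measurable_flow \<Phi>" for \<Phi>
  proof -
    have "(\<lambda>n. ?E * (exp (- lamstar * T) * picard \<Phi> (terminal_weight \<Phi> F) n T 0 x)) \<longlonglongrightarrow> ?E * ?X \<Phi>"
      by (intro tendsto_mult_left expectation_thinning_path[OF that F_meas b prob noise]) (use T_pos in simp)
    then show ?thesis by (simp add: mult.assoc[symmetric] exp_minus)
  qed
  have "measurable_flow \<phi>" by (rule measurable_flow_exact[OF flow f_lip C_nonneg])
  \<comment> \<open>The same iterates have two limits, which identifies \<open>u 0 x\<close> with
    the expectation for the exact flow.\<close>
  from LIMSEQ_unique[OF lim[OF this] exact_limit[OF B flow F_meas]]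
  have exact: "?E * u 0 x = ?E * ?X \<phi>" by simp
  obtain c R where R: "\<And>h a. 0 < h \<Longrightarrow> (\<lambda>n. picard (euler_flow f h) (terminal_weight (euler_flow f h) F) n T 0 x) \<longlonglongrightarrow> a \<Longrightarrow>
     \<bar>a - ?E * u 0 x - h * c\<bar> \<le> R * h\<^sup>2"
    using euler_limit[OF B flow F_meas] by blast
  have euler: "measurable_flow (euler_flow f h)" for h by (rule measurable_flow_euler[OF f_measurable])
  \<comment> \<open>Dividing by the discount \<open>?E\<close> gives the witness
    \<open>c / ?E\<close>; the estimate even holds for every positive \<open>h\<close>.\<close>
  have "\<bar>?X (euler_flow f h) - ?X \<phi> - h * (c / ?E)\<bar> \<le> R / ?E * h\<^sup>2" if "0 < h" for h
  proof -
    have "\<bar>?E * (?X (euler_flow f h) - ?X \<phi> - h * (c / ?E))\<bar> \<le> R * h\<^sup>2"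
      using R[OF that lim[OF euler]] unfolding exact by (simp add: algebra_simps)
    then have "\<bar>?X (euler_flow f h) - ?X \<phi> - h * (c / ?E)\<bar> * ?E \<le> R * h\<^sup>2"
      by (simp only: abs_mult abs_exp_cancel mult.commute)
    then have "\<bar>?X (euler_flow f h) - ?X \<phi> - h * (c / ?E)\<bar> \<le> R * h\<^sup>2 / ?E"
      by (simp only: pos_le_divide_eq[OF exp_gt_zero])
    then show ?thesis by (simp only: times_divide_eq_left)
  qed
  then have "(\<lambda>h. ?X (euler_flow f h) - ?X \<phi> - h * (c / ?E)) \<in> O[at_right 0](\<lambda>h. h\<^sup>2)"
    by (intro bigoI[where c="R / ?E"] eventually_at_rightI[of 0 1]) auto
  then show ?thesis by blast
qed

end
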